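(* A planar state sum model over the field $k=\mathbb{C}$ or $\mathbb{R}$ is isomorphic, by a change of basis, to one in which the algebra $A$ is a direct sum of matrix algebras over $\mathbb{C}$ (if $k=\mathbb{C}$) or over the division rings $\mathbb{R},\mathbb{C}_{\mathbb{R}},\mathbb{H}_{\mathbb{R}}$ (if $k=\mathbb{R}$), and the Frobenius form is determined by a fixed invertible element $x=\oplus_i x_i\in A$, as follows. (1) For $k=\mathbb{C}$: $A=\bigoplus_{i=1}^N\mathbb{M}_{n_i}(\mathbb{C})$ and $$\varepsilon(a)=\sum_{i=1}^N\mathrm{Tr}(x_ia_i),\qquad a=\oplus_i a_i\in A,$$ and the element $x$ must satisfy $R\,\mathrm{Tr}(x_i^{-1})=1$ for all $i=1,\dots,N$. (2) For $k=\mathbb{R}$: $A=\bigoplus_{i=1}^N\mathbb{M}_{n_i}(D_i)$ with $D_i\in\{\mathbb{R},\mathbb{C}_{\mathbb{R}},\mathbb{H}_{\mathbb{R}}\}$ and $$\varepsilon(a)=\sum_{i=1}^N\mathrm{Re}\,\mathrm{Tr}(x_ia_i),\qquad a=\oplus_i a_i\in A,$$ and the element $x$ must satisfy, for all $i=1,\dots,N$, $$R^{-1}=\begin{cases}\mathrm{Tr}(x_i^{-1}) & (D_i=\mathbb{R})\\ 2\,\mathrm{Tr}(x_i^{-1}) & (D_i=\mathbb{C}_{\mathbb{R}})\\ 4\,\mathrm{Re}\,\mathrm{Tr}(x_i^{-1}) & (D_i=\mathbb{H}_{\mathbb{R}}).\end{cases}$$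
   Context: $\mathbb{C}_{\mathbb{R}}$ and $\mathbb{H}_{\mathbb{R}}$ are the complex numbers and quaternions regarded as $\mathbb{R}$-algebras; $\mathbb{M}_n(D)$ is the algebra of $n\times n$ matrices over $D$; $\mathrm{Tr}$ is the sum of the diagonal entries and $\mathrm{Re}$ the real part in $D$. Repeated indices are summed. Diagrammatic state sum model data over a field $k$ consist of a finite set $S$, the vector space $A$ with basis $(e_a)_{a\in S}$, a trilinear form $C$ on $A$ with $C_{abc}=C(e_a,e_b,e_c)$, an element $B=B^{ab}e_a\otimes e_b\in A\otimes A$ and $R\in k$ such that $C_{abc}B^{cd}=B^{de}C_{eab}$. The data are assumed non-degenerate: $R\ne0$, $C(\cdot,\cdot,x)=0$ implies $x=0$, and $B$ is non-degenerate, with inverse $B_{ab}$ defined by $B_{ac}B^{cb}=\delta_a^b$. Put $B^{-1}(e_a,e_b)=B_{ab}$, $m(e_a\otimes e_b)=e_a\cdot e_b=C_{abd}B^{dc}e_c$ and $\beta=m(B)=B^{ab}\,e_a\cdot e_b$. For a triangulated compact $M\subset\mathbb{R}^2$ with dual graph $G$ drawn generically in the plane (not horizontal at vertices or at the boundary), $|G|$ is the number obtained, for fixed states on boundary edges, by assigning $C_{abc}$ to vertices with downward legs $a,b,c$ (left to right; upward legs are obtained by bending with $B$, e.g. $C_{abd}B^{dc}$ for two downward legs $a,b$ and one upward leg $c$), $B^{ab}$ to local minima, $B_{ab}$ to local maxima, and summing over internal states; the partition function is $Z(M)=R^V|G|$ with $V$ the number of interior vertices. A planar state sum model is such data for which $Z(M)$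 is invariant, for every compact $M\subset\mathbb{R}^2$, under the 2-2 and 1-3 Pachner moves (with dual edges unchanged near the boundary of the region). Equivalently, $A$ with multiplication $m$ is a Frobenius algebra (finite-dimensional, associative and unital, with a linear map $\varepsilon\colon A\to k$, the Frobenius form, such that $\varepsilon\circ m$ is non-degenerate) with $\varepsilon\circ m=B^{-1}$ and identity $1=R\beta$; the Frobenius form is $\varepsilon(y)=B^{-1}(y,1)$, and $C(x,y,z)=\varepsilon(x\cdot y\cdot z)$. Two models are isomorphic by a change of basis if there is a linear isomorphism of the underlying vector spaces carrying $C$ to $C$ and $B$ to $B$, with equal $R$. *)

theory Defs
  imports "HOL-Analysis.Analysis" "HOL-Library.Function_Algebras"
begin

section \<open>State sum model data\<close>

text \<open>
  The vector space \<open>A\<close> is the span of the basis vectors \<open>bas X a\<close>, for \<open>a\<close> in \<open>states X\<close>, inside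
  an ambient vector space with scalar multiplication \<open>scl X\<close>. The trilinear form and the element
  of the tensor square are given by their components with respect to this basis. The values
  of \<open>Cc\<close>, \<open>Bc\<close> and \<open>bas\<close> outside \<open>states X\<close> play no role.
\<close>

record ('s, 'v, 'k) ssm =
  states :: "'s set"
  scl :: "'k \<Rightarrow> 'v \<Rightarrow> 'v"
  bas :: "'s \<Rightarrow> 'v"
  Cc :: "'s \<Rightarrow> 's \<Rightarrow> 's \<Rightarrow> 'k"
  Bc :: "'s \<Rightarrow> 's \<Rightarrow> 'k"
  Rc :: 'k

definition space_of :: "('s, 'v::ab_group_add, 'k::field) ssm \<Rightarrow> 'v set" where
  "space_of X = module.span (scl X) (bas X ` states X)"

definition coord :: "('s, 'v::ab_group_add, 'k::field) ssm \<Rightarrow> 'v \<Rightarrow> 's \<Rightarrow> 'k" where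
  "coord X v a = module.representation (scl X) (bas X ` states X) v (bas X a)"

definition C_form :: "('s, 'v::ab_group_add, 'k::field) ssm \<Rightarrow> 'v \<Rightarrow> 'v \<Rightarrow> 'v \<Rightarrow> 'k" where
  "C_form X x y z =
     (\<Sum>a\<in>states X. \<Sum>b\<in>states X. \<Sum>c\<in>states X.
        coord X x a * coord X y b * coord X z c * Cc X a b c)"

definition diagrammatic_data :: "('s, 'v::ab_group_add, 'k::field) ssm \<Rightarrow> bool" where
  "diagrammatic_data X \<longleftrightarrow>
     vector_space (scl X) \<and> finite (states X) \<and>
     inj_on (bas X) (states X) \<and> \<not> module.dependent (scl X) (bas X ` states X) \<and>
     (\<forall>a\<in>states X. \<forall>b\<in>states X. \<forall>d\<in>states X.
        (\<Sum>c\<in>states X. Cc X a b c * Bc X c d) = (\<Sum>e\<in>states X. Bc X d e * Cc X e a b))"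

definition is_inverse_B :: "('s, 'v, 'k::field) ssm \<Rightarrow> ('s \<Rightarrow> 's \<Rightarrow> 'k) \<Rightarrow> bool" where
  "is_inverse_B X b \<longleftrightarrow>
     (\<forall>a\<in>states X. \<forall>d\<in>states X.
        (\<Sum>c\<in>states X. b a c * Bc X c d) = (if a = d then 1 else 0))"

definition Binv :: "('s, 'v, 'k::field) ssm \<Rightarrow> 's \<Rightarrow> 's \<Rightarrow> 'k" where
  "Binv X = (SOME b. is_inverse_B X b)"

definition nondegenerate_data :: "('s, 'v::ab_group_add, 'k::field) ssm \<Rightarrow> bool" where
  "nondegenerate_data X \<longleftrightarrow>
     diagrammatic_data X \<and> Rc X \<noteq> 0 \<and>
     (\<forall>x\<in>space_of X.
        (\<forall>y\<in>space_of X. \<forall>z\<in>space_of X. C_form X y z x = 0) \<longrightarrow> x = 0) \<and>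
     (\<exists>b. is_inverse_B X b)"

definition mult_of :: "('s, 'v::ab_group_add, 'k::field) ssm \<Rightarrow> 'v \<Rightarrow> 'v \<Rightarrow> 'v" where
  "mult_of X x y =
     (\<Sum>a\<in>states X. \<Sum>b\<in>states X. \<Sum>c\<in>states X. \<Sum>d\<in>states X.
        scl X (coord X x a * coord X y b * Cc X a b d * Bc X d c) (bas X c))"

definition beta_of :: "('s, 'v::ab_group_add, 'k::field) ssm \<Rightarrow> 'v" where
  "beta_of X =
     (\<Sum>a\<in>states X. \<Sum>b\<in>states X. scl X (Bc X a b) (mult_of X (bas X a) (bas X b)))"

definition unit_of :: "('s, 'v::ab_group_add, 'k::field) ssm \<Rightarrow> 'v" where
  "unit_of X = scl X (Rc X) (beta_of X)"

definition Binv_form :: "('s, 'v::ab_group_add, 'k::field) ssm \<Rightarrow> 'v \<Rightarrow> 'v \<Rightarrow> 'k" where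
  "Binv_form X x y = (\<Sum>a\<in>states X. \<Sum>b\<in>states X. coord X x a * coord X y b * Binv X a b)"

definition frobenius_form :: "('s, 'v::ab_group_add, 'k::field) ssm \<Rightarrow> 'v \<Rightarrow> 'k" where
  "frobenius_form X y = Binv_form X y (unit_of X)"

text \<open>
  The last-but-one clause says that the image of \<open>B\<close> under the tensor square of \<open>\<phi>\<close> is the
  element \<open>B\<close> of the second model.
\<close>

definition isomorphic_ssm ::
  "('s, 'v::ab_group_add, 'k::field) ssm \<Rightarrow> ('t, 'w::ab_group_add, 'k) ssm \<Rightarrow> bool" where
  "isomorphic_ssm X Y \<longleftrightarrow>
     (\<exists>\<phi>. bij_betw \<phi> (space_of X) (space_of Y) \<and>
       (\<forall>x\<in>space_of X. \<forall>y\<in>space_of X. \<phi> (x + y) = \<phi> x + \<phi> y) \<and>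
       (\<forall>c. \<forall>x\<in>space_of X. \<phi> (scl X c x) = scl Y c (\<phi> x)) \<and>
       (\<forall>x\<in>space_of X. \<forall>y\<in>space_of X. \<forall>z\<in>space_of X.
          C_form Y (\<phi> x) (\<phi> y) (\<phi> z) = C_form X x y z) \<and>
       (\<forall>c\<in>states Y. \<forall>d\<in>states Y.
          Bc Y c d = (\<Sum>a\<in>states X. \<Sum>b\<in>states X.
            Bc X a b * coord Y (\<phi> (bas X a)) c * coord Y (\<phi> (bas X b)) d)) \<and>
       Rc Y = Rc X)"


section \<open>Plane diagrams and their evaluation\<close>

text \<open>
  Diagrams are drawn piecewise linearly in the plane, whose second coordinate is the height. A
  diagram is a finite set of closed line segments, each given by its pair of end points, which
  meet only in common end points; no segment is horizontal. End points of valency 3 are the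
  vertices of the drawn graph, those of valency 2 are the corners of its polygonal edges
  (a local minimum or maximum, or a point that is passed monotonically), and those of
  valency 1 lie on the boundary.
\<close>

type_synonym plane = "real \<times> real"

definition plane_diagram :: "plane set set \<Rightarrow> bool" where
  "plane_diagram G \<longleftrightarrow>
     finite G \<and>
     (\<forall>e\<in>G. \<exists>v w. e = {v, w} \<and> snd v \<noteq> snd w) \<and>
     (\<forall>e\<in>G. \<forall>f\<in>G. (convex hull e) \<inter> (convex hull f) = convex hull (e \<inter> f))"

definition drawing :: "plane set set \<Rightarrow> plane set" where
  "drawing G = (\<Union>e\<in>G. convex hull e)"

definition valency :: "plane set set \<Rightarrow> plane \<Rightarrow> nat" where
  "valency G v = card {e \<in> G. v \<in> e}"

text \<open>
  Horizontal displacement per unit of height, so that smaller values are further to the left,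
  among the downward legs at \<open>v\<close> as well as among the upward legs at \<open>v\<close>.
\<close>

definition lateral :: "plane \<Rightarrow> plane \<Rightarrow> real" where
  "lateral v w = (fst w - fst v) / \<bar>snd w - snd v\<bar>"

definition left_to_right :: "plane \<Rightarrow> plane set \<Rightarrow> plane list" where
  "left_to_right v W =
     (THE ws. set ws = W \<and> sorted_wrt (\<lambda>w w'. lateral v w < lateral v w') ws)"

definition down_legs :: "plane set set \<Rightarrow> plane \<Rightarrow> plane list" where
  "down_legs G v = left_to_right v {w. {v, w} \<in> G \<and> snd w < snd v}"

definition up_legs :: "plane set set \<Rightarrow> plane \<Rightarrow> plane list" where
  "up_legs G v = left_to_right v {w. {v, w} \<in> G \<and> snd v < snd w}"

text \<open>
  The weight of a point with states \<open>ds\<close> on its downward and \<open>us\<close> on its upward legs, both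
  listed from left to right. At a trivalent vertex the legs in anticlockwise order, starting
  from the leftmost downward leg, are \<open>ds\<close> followed by the reverse of \<open>us\<close>, and each upward leg
  is bent upwards on the right with \<open>B\<close>.
\<close>

fun weight :: "('s, 'v, 'k::field) ssm \<Rightarrow> 's list \<Rightarrow> 's list \<Rightarrow> 'k" where
  "weight X [a, b, c] [] = Cc X a b c"
| "weight X [a, b] [c] = (\<Sum>d\<in>states X. Cc X a b d * Bc X d c)"
| "weight X [a] [b, c] =
     (\<Sum>d\<in>states X. \<Sum>e\<in>states X. Cc X a d e * Bc X d c * Bc X e b)"
| "weight X [] [a, b, c] =
     (\<Sum>d\<in>states X. \<Sum>e\<in>states X. \<Sum>f\<in>states X.
        Cc X d e f * Bc X d c * Bc X e b * Bc X f a)"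
| "weight X [] [a, b] = Bc X a b"
| "weight X [a, b] [] = Binv X a b"
| "weight X [a] [b] = (if a = b then 1 else 0)"
| "weight X [a] [] = 1"
| "weight X [] [a] = 1"
| "weight X _ _ = 0"

text \<open>
  Sum over all assignments of states to segments that have the prescribed state \<open>\<tau> v\<close> on the
  segment ending at the boundary point \<open>v\<close>.
\<close>

definition evaluation ::
  "('s, 'v, 'k::field) ssm \<Rightarrow> plane set set \<Rightarrow> (plane \<Rightarrow> 's) \<Rightarrow> 'k" where
  "evaluation X G \<tau> =
     (\<Sum>\<sigma> \<in> {\<sigma> \<in> G \<rightarrow>\<^sub>E states X. \<forall>e\<in>G. \<forall>v\<in>e. valency G v = 1 \<longrightarrow> \<sigma> e = \<tau> v}.
        \<Prod>v\<in>\<Union>G. weight X (map (\<lambda>w. \<sigma> {v, w}) (down_legs G v))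
                          (map (\<lambda>w. \<sigma> {v, w}) (up_legs G v)))"


section \<open>Triangulated regions, dual graphs and Pachner moves\<close>

text \<open>The region is the union of the triangles; every simplex is a face of a triangle.\<close>

definition triangulated_region :: "plane set set \<Rightarrow> bool" where
  "triangulated_region \<T> \<longleftrightarrow> triangulation \<T> \<and> (\<forall>t\<in>\<T>. 2 simplex t)"

definition interior_vertices :: "plane set set \<Rightarrow> plane set" where
  "interior_vertices \<T> = {v. (\<exists>t\<in>\<T>. v extreme_point_of t) \<and> v \<in> interior (\<Union>\<T>)}"

text \<open>
  The conditions force the part of the diagram inside each triangle to be a tripod with its
  trivalent vertex in the interior of the triangle and one leg crossing each of the three sides.
\<close>

definition drawn_dual_graph :: "plane set set \<Rightarrow> plane set set \<Rightarrow> bool" where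
  "drawn_dual_graph \<T> G \<longleftrightarrow>
     plane_diagram G \<and>
     drawing G \<subseteq> \<Union>\<T> \<and>
     (\<forall>v\<in>\<Union>G. valency G v \<le> 3) \<and>
     (\<forall>v\<in>\<Union>G. valency G v = 1 \<longleftrightarrow> v \<in> frontier (\<Union>\<T>)) \<and>
     drawing G \<inter> frontier (\<Union>\<T>) \<subseteq> \<Union>G \<and>
     (\<forall>t\<in>\<T>. connected (drawing G \<inter> t) \<and>
        (\<exists>p\<in>interior t. {v \<in> \<Union>G \<inter> t. valency G v = 3} = {p}) \<and>
        (\<forall>s. s facet_of t \<longrightarrow> (\<exists>q\<in>rel_interior s. drawing G \<inter> s = {q})))"

definition partition_function ::
  "('s, 'v, 'k::field) ssm \<Rightarrow> plane set set \<Rightarrow> plane set set \<Rightarrow> (plane \<Rightarrow> 's) \<Rightarrow> 'k" where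
  "partition_function X \<T> G \<tau> = Rc X ^ card (interior_vertices \<T>) * evaluation X G \<tau>"

text \<open>In both moves \<open>P\<close> is the polygon that is retriangulated.\<close>

definition pachner_2_2 :: "plane set set \<Rightarrow> plane set set \<Rightarrow> plane set \<Rightarrow> bool" where
  "pachner_2_2 \<T> \<T>' P \<longleftrightarrow>
     (\<exists>a b c d. open_segment a c \<inter> open_segment b d \<noteq> {} \<and>
        P = convex hull {a, b, c, d} \<and>
        {convex hull {a, b, c}, convex hull {a, c, d}} \<subseteq> \<T> \<and>
        \<T>' = (\<T> - {convex hull {a, b, c}, convex hull {a, c, d}}) \<union>
              {convex hull {a, b, d}, convex hull {b, c, d}})"

definition pachner_1_3 :: "plane set set \<Rightarrow> plane set set \<Rightarrow> plane set \<Rightarrow> bool" where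
  "pachner_1_3 \<T> \<T>' P \<longleftrightarrow>
     (\<exists>a b c v. P = convex hull {a, b, c} \<and> v \<in> interior P \<and> P \<in> \<T> \<and>
        \<T>' = (\<T> - {P}) \<union>
              {convex hull {a, b, v}, convex hull {b, c, v}, convex hull {c, a, v}})"

text \<open>
  The two drawings agree outside a closed set in the interior of the retriangulated polygon; in
  particular the dual edges are unchanged near the boundary of the polygon.
\<close>

definition planar_ssm :: "('s, 'v::ab_group_add, 'k::field) ssm \<Rightarrow> bool" where
  "planar_ssm X \<longleftrightarrow>
     nondegenerate_data X \<and>
     (\<forall>\<T> \<T>' P G G' \<tau>.
        triangulated_region \<T> \<longrightarrow> triangulated_region \<T>' \<longrightarrow>
        pachner_2_2 \<T> \<T>' P \<or> pachner_1_3 \<T> \<T>' P \<longrightarrow>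
        drawn_dual_graph \<T> G \<longrightarrow> drawn_dual_graph \<T>' G' \<longrightarrow>
        (\<exists>K. closed K \<and> K \<subseteq> interior P \<and> drawing G - K = drawing G' - K) \<longrightarrow>
        range \<tau> \<subseteq> states X \<longrightarrow>
        partition_function X \<T> G \<tau> = partition_function X \<T>' G' \<tau>)"


section \<open>Quaternions\<close>

datatype quat = Quat (Qre: real) (Qi: real) (Qj: real) (Qk: real)

lemma quat_eq_iff: "p = q \<longleftrightarrow> Qre p = Qre q \<and> Qi p = Qi q \<and> Qj p = Qj q \<and> Qk p = Qk q"
  by (cases p; cases q) auto

instantiation quat :: real_algebra_1
begin

definition "0 = Quat 0 0 0 0"
definition "1 = Quat 1 0 0 0"
definition "p + q = Quat (Qre p + Qre q) (Qi p + Qi q) (Qj p + Qj q) (Qk p + Qk q)"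
definition "- p = Quat (- Qre p) (- Qi p) (- Qj p) (- Qk p)"
definition "p - q = Quat (Qre p - Qre q) (Qi p - Qi q) (Qj p - Qj q) (Qk p - Qk q)"
definition "c *\<^sub>R p = Quat (c * Qre p) (c * Qi p) (c * Qj p) (c * Qk p)"
definition "p * q = Quat
   (Qre p * Qre q - Qi p * Qi q - Qj p * Qj q - Qk p * Qk q)
   (Qre p * Qi q + Qi p * Qre q + Qj p * Qk q - Qk p * Qj q)
   (Qre p * Qj q - Qi p * Qk q + Qj p * Qre q + Qk p * Qi q)
   (Qre p * Qk q + Qi p * Qj q - Qj p * Qi q + Qk p * Qre q)"

instance
  by standard
    (simp_all add: quat_eq_iff zero_quat_def one_quat_def plus_quat_def uminus_quat_def
      minus_quat_def scaleR_quat_def times_quat_def algebra_simps)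

end

definition quat_cnj :: "quat \<Rightarrow> quat" where
  "quat_cnj q = Quat (Qre q) (- Qi q) (- Qj q) (- Qk q)"

definition quat_normsq :: "quat \<Rightarrow> real" where
  "quat_normsq q = (Qre q)\<^sup>2 + (Qi q)\<^sup>2 + (Qj q)\<^sup>2 + (Qk q)\<^sup>2"

instantiation quat :: real_div_algebra
begin

definition "inverse q = inverse (quat_normsq q) *\<^sub>R quat_cnj q"
definition "p div q = p * inverse (q :: quat)"

instance
proof
  fix q :: quat
  assume "q \<noteq> 0"
  then have "Qre q \<noteq> 0 \<or> Qi q \<noteq> 0 \<or> Qj q \<noteq> 0 \<or> Qk q \<noteq> 0"
    by (simp add: quat_eq_iff zero_quat_def)
  then have pos: "quat_normsq q \<noteq> 0"
    unfolding quat_normsq_def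
    by (metis add_nonneg_eq_0_iff add_nonneg_nonneg zero_eq_power2 zero_le_power2)
  have "quat_cnj q * q = quat_normsq q *\<^sub>R 1" "q * quat_cnj q = quat_normsq q *\<^sub>R 1"
    by (simp_all add: quat_eq_iff one_quat_def scaleR_quat_def times_quat_def quat_cnj_def
        quat_normsq_def power2_eq_square)
  with pos show "inverse q * q = 1" "q * inverse q = 1"
    by (simp_all add: inverse_quat_def)
next
  show "inverse (0 :: quat) = 0"
    by (simp add: inverse_quat_def quat_eq_iff zero_quat_def scaleR_quat_def quat_cnj_def)
qed (simp add: divide_quat_def)

end

definition quat_of_complex :: "complex \<Rightarrow> quat" where
  "quat_of_complex z = Quat (Re z) (Im z) 0 0"

lemma inj_quat_of_complex: "inj quat_of_complex"
  by (auto simp: inj_def quat_of_complex_def complex_eq_iff)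

lemma quat_of_complex_hom:
  "quat_of_complex (y + z) = quat_of_complex y + quat_of_complex z"
  "quat_of_complex (y * z) = quat_of_complex y * quat_of_complex z"
  "quat_of_complex (c *\<^sub>R z) = c *\<^sub>R quat_of_complex z"
  "quat_of_complex 1 = 1"
  by (simp_all add: quat_eq_iff quat_of_complex_def plus_quat_def times_quat_def
      scaleR_quat_def one_quat_def)

text \<open>
  The real division algebras \<open>\<real>\<close>, \<open>\<complex>\<close> and \<open>\<H>\<close> are represented by their standard copies in the
  quaternions, so that one type of entries suffices for matrices over any of the three.
\<close>

datatype real_division = RealD | ComplexD | QuaternionD

fun division_ring_of :: "real_division \<Rightarrow> quat set" where
  "division_ring_of RealD = range of_real"
| "division_ring_of ComplexD = range quat_of_complex"
| "division_ring_of QuaternionD = UNIV"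


section \<open>Direct sums of matrix algebras\<close>

text \<open>
  An element of the direct sum of the algebras of \<open>n i \<times> n i\<close> matrices over \<open>D i\<close>, for \<open>i < N\<close>, is
  the function taking \<open>i\<close>, \<open>r\<close>, \<open>s\<close> to the entry in row \<open>r\<close> and column \<open>s\<close> of its \<open>i\<close>-th summand,
  and taking the value 0 outside the index range. Blocks, rows and columns are counted from 0.
\<close>

type_synonym 'd blocks = "nat \<Rightarrow> nat \<Rightarrow> nat \<Rightarrow> 'd"

definition matrix_sum :: "nat \<Rightarrow> (nat \<Rightarrow> nat) \<Rightarrow> (nat \<Rightarrow> 'd::zero set) \<Rightarrow> 'd blocks set" where
  "matrix_sum N n D =
     {a. \<forall>i r s. if i < N \<and> r < n i \<and> s < n i then a i r s \<in> D i else a i r s = 0}"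

definition blocks_mult ::
  "(nat \<Rightarrow> nat) \<Rightarrow> 'd::semiring_0 blocks \<Rightarrow> 'd blocks \<Rightarrow> 'd blocks" where
  "blocks_mult n a b = (\<lambda>i r s. \<Sum>t<n i. a i r t * b i t s)"

definition blocks_one :: "nat \<Rightarrow> (nat \<Rightarrow> nat) \<Rightarrow> 'd::zero_neq_one blocks" where
  "blocks_one N n = (\<lambda>i r s. if i < N \<and> r < n i \<and> r = s then 1 else 0)"

definition Tr :: "(nat \<Rightarrow> nat) \<Rightarrow> 'd::comm_monoid_add blocks \<Rightarrow> nat \<Rightarrow> 'd" where
  "Tr n a i = (\<Sum>r<n i. a i r r)"

definition mutually_inverse ::
  "nat \<Rightarrow> (nat \<Rightarrow> nat) \<Rightarrow> (nat \<Rightarrow> 'd::ring_1 set) \<Rightarrow> 'd blocks \<Rightarrow> 'd blocks \<Rightarrow> bool" where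
  "mutually_inverse N n D x y \<longleftrightarrow>
     x \<in> matrix_sum N n D \<and> y \<in> matrix_sum N n D \<and>
     blocks_mult n x y = blocks_one N n \<and> blocks_mult n y x = blocks_one N n"

definition has_matrix_algebra ::
  "('k \<Rightarrow> 'd \<Rightarrow> 'd) \<Rightarrow> nat \<Rightarrow> (nat \<Rightarrow> nat) \<Rightarrow> (nat \<Rightarrow> 'd::ring_1 set) \<Rightarrow>
    ('s, 'd blocks, 'k::field) ssm \<Rightarrow> bool" where
  "has_matrix_algebra smul N n D X \<longleftrightarrow>
     (\<forall>i<N. 0 < n i) \<and>
     scl X = (\<lambda>c a i r s. smul c (a i r s)) \<and>
     space_of X = matrix_sum N n D \<and>
     (\<forall>a\<in>space_of X. \<forall>b\<in>space_of X. mult_of X a b = blocks_mult n a b)"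

text \<open>
  In the following two definitions \<open>y\<close> is the inverse of the element \<open>x\<close> that determines the
  Frobenius form.
\<close>

definition complex_matrix_model ::
  "nat \<Rightarrow> (nat \<Rightarrow> nat) \<Rightarrow> complex blocks \<Rightarrow> complex blocks \<Rightarrow>
    ('s, complex blocks, complex) ssm \<Rightarrow> bool" where
  "complex_matrix_model N n x y X \<longleftrightarrow>
     has_matrix_algebra (*) N n (\<lambda>i. UNIV) X \<and>
     mutually_inverse N n (\<lambda>i. UNIV) x y \<and>
     (\<forall>a\<in>space_of X. frobenius_form X a = (\<Sum>i<N. Tr n (blocks_mult n x a) i))"

definition real_matrix_model ::
  "nat \<Rightarrow> (nat \<Rightarrow> nat) \<Rightarrow> (nat \<Rightarrow> real_division) \<Rightarrow> quat blocks \<Rightarrow> quat blocks \<Rightarrow>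
    ('s, quat blocks, real) ssm \<Rightarrow> bool" where
  "real_matrix_model N n D x y X \<longleftrightarrow>
     has_matrix_algebra (*\<^sub>R) N n (\<lambda>i. division_ring_of (D i)) X \<and>
     mutually_inverse N n (\<lambda>i. division_ring_of (D i)) x y \<and>
     (\<forall>a\<in>space_of X. frobenius_form X a = (\<Sum>i<N. Qre (Tr n (blocks_mult n x a) i)))"

fun real_trace_condition :: "real \<Rightarrow> real_division \<Rightarrow> quat \<Rightarrow> bool" where
  "real_trace_condition R RealD t \<longleftrightarrow> of_real (inverse R) = t"
| "real_trace_condition R ComplexD t \<longleftrightarrow> of_real (inverse R) = 2 * t"
| "real_trace_condition R QuaternionD t \<longleftrightarrow> inverse R = 4 * Qre t"

end

theory Submission
  imports Defs "HOL-Computational_Algebra.Fundamental_Theorem_Algebra"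
begin

text \<open>
  The 2-2 move, for drawings with two legs at the bottom and two at the top, is associativity of \<open>m\<close>
  composed with the invertible \<open>B\<close>; the 1-3 move then reads \<open>x (R \<beta>) y = x y\<close>, and non-degeneracy makes
  \<open>R \<beta>\<close> the identity. As \<open>\<beta> = \<Sum> f\<^sub>i e\<^sub>i\<close> for dual bases of the Frobenius form, \<open>R \<Sum> f\<^sub>i \<otimes> e\<^sub>i\<close> is a
  separability element, and averaging with it makes the algebra von Neumann regular. A maximal family
  of orthogonal idempotents \<open>p\<close> then has division algebras \<open>p A p\<close>, and matrix units linking equivalent
  idempotents identify \<open>A\<close> with a direct sum of matrix algebras over them; these division algebras
  are known by the fundamental theorem of algebra and by Frobenius' theorem. Every linear form on
  the direct sum is \<open>a \<mapsto> Re Tr (x a)\<close>, with \<open>x\<close> invertible by non-degeneracy. Since \<open>\<beta>\<close> does not depend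
  on the dual bases, it may be computed from the matrix units, which gives the trace condition.
\<close>

section \<open>Triangles and segments in the plane\<close>

text \<open>Invariance enters through one explicit move of each type. The price is that every clause
  of \<open>drawn_dual_graph\<close> has to be verified for four concrete drawings, and for this
  purpose triangles and segments are turned into linear inequalities in coordinates. Radicals and
  modules are avoided. Regularity makes \<open>x z\<close> and \<open>z x\<close> idempotent
  whenever \<open>x z x = x\<close>; this one fact yields inverses in the corner of a primitive
  idempotent, links between idempotents with \<open>p A q \<noteq> 0\<close>, and invertibility of
  the element representing the Frobenius form. The factors 1, 2, 4 of the real case come from the
  dual families \<open>q E_rs\<close> and \<open>bar q E_sr y\<close>, where \<open>y\<close> is
  inverse to \<open>x\<close> and \<open>q\<close> runs through the standard basis of the division
  algebra. The identity \<open>R \<beta> = 1\<close> becomes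
  \<open>R \<Sum> bar q (Tr y_i) q = 1\<close> in each block, and \<open>\<Sum> bar q t q\<close> is
  \<open>t\<close> over the reals, \<open>2 t\<close> over the complex numbers and
  \<open>4 Re t\<close> over the quaternions.\<close>

definition cross :: "plane \<Rightarrow> plane \<Rightarrow> plane \<Rightarrow> real" where
  "cross a b x = (fst b - fst a) * (snd x - snd a) - (snd b - snd a) * (fst x - fst a)"

text \<open>\<open>cross\<close> is twice the signed area of a triangle, positive for anticlockwise
  order. Dividing the three values at \<open>x\<close> by \<open>cross a b c\<close> gives the
  barycentric coordinates of \<open>x\<close>.\<close>

lemma convex_hull_3_eq_cross:
  assumes "cross a b c > 0"
  shows "convex hull {a, b, c} = {x. 0 \<le> cross a b x \<and> 0 \<le> cross b c x \<and> 0 \<le> cross c a x}"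
proof (intro equalityI subsetI)
  fix x assume "x \<in> convex hull {a, b, c}"
  then obtain u v w where uvw: "0 \<le> u" "0 \<le> v" "0 \<le> w" "u + v + w = 1"
    and x: "x = u *\<^sub>R a + v *\<^sub>R b + w *\<^sub>R c"
    unfolding convex_hull_3 by blast
  have u: "u = 1 - v - w" using uvw by simp
  have "cross a b x = w * cross a b c" "cross b c x = u * cross a b c" "cross c a x = v * cross a b c"
    unfolding x u cross_def by (simp_all add: algebra_simps)
  then show "x \<in> {x. 0 \<le> cross a b x \<and> 0 \<le> cross b c x \<and> 0 \<le> cross c a x}"
    using assms uvw by simp
next
  fix x assume x: "x \<in> {x. 0 \<le> cross a b x \<and> 0 \<le> cross b c x \<and> 0 \<le> cross c a x}"
  let ?d = "cross a b c"
  have d: "cross b c x + cross c a x + cross a b x = ?d"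
    by (simp add: cross_def algebra_simps)
  have "?d *\<^sub>R x = cross b c x *\<^sub>R a + cross c a x *\<^sub>R b + cross a b x *\<^sub>R c"
    by (simp add: cross_def prod_eq_iff algebra_simps)
  then have "inverse ?d *\<^sub>R (?d *\<^sub>R x) =
      inverse ?d *\<^sub>R (cross b c x *\<^sub>R a + cross c a x *\<^sub>R b + cross a b x *\<^sub>R c)" by simp
  then have "x = (cross b c x / ?d) *\<^sub>R a + (cross c a x / ?d) *\<^sub>R b + (cross a b x / ?d) *\<^sub>R c"
    using assms by (simp add: scaleR_add_right divide_inverse mult.commute)
  moreover have "cross b c x / ?d + cross c a x / ?d + cross a b x / ?d = 1"
    using assms d by (simp add: add_divide_distrib[symmetric])
  ultimately show "x \<in> convex hull {a, b, c}"
    unfolding convex_hull_3 using x assms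
    by (intro CollectI exI[of _ "cross b c x / ?d"] exI[of _ "cross c a x / ?d"]
        exI[of _ "cross a b x / ?d"]) simp
qed

text \<open>The height is an affine parameter along a segment that is not horizontal, and
  \<open>cross a b x = 0\<close> puts \<open>x\<close> on its line. The variant by abscissa below
  serves the horizontal sides of triangles.\<close>

lemma convex_hull_2_eq_snd:
  assumes "snd a < snd b"
  shows "convex hull {a, b} = {x. snd a \<le> snd x \<and> snd x \<le> snd b \<and> cross a b x = 0}"
proof (intro equalityI subsetI)
  fix x assume "x \<in> convex hull {a, b}"
  then obtain u where u: "0 \<le> u" "u \<le> 1" and x: "x = a + u *\<^sub>R (b - a)"
    unfolding convex_hull_2_alt by blast
  have "u * (snd b - snd a) \<le> 1 * (snd b - snd a)"
    using u assms by (intro mult_right_mono) auto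
  moreover have "0 \<le> u * (snd b - snd a)" using u assms by simp
  ultimately show "x \<in> {x. snd a \<le> snd x \<and> snd x \<le> snd b \<and> cross a b x = 0}"
    by (auto simp: x cross_def algebra_simps)
next
  fix x assume x: "x \<in> {x. snd a \<le> snd x \<and> snd x \<le> snd b \<and> cross a b x = 0}"
  define u where "u = (snd x - snd a) / (snd b - snd a)"
  have 01: "0 \<le> u" "u \<le> 1" using x assms by (auto simp: u_def divide_le_eq)
  have u: "u * (snd b - snd a) = snd x - snd a" using assms by (simp add: u_def)
  then have "(snd b - snd a) * (fst x - fst a - u * (fst b - fst a)) = 0"
    using x unfolding cross_def mem_Collect_eq by algebra
  then have "x = a + u *\<^sub>R (b - a)"
    using u assms by (simp add: prod_eq_iff)
  with 01 show "x \<in> convex hull {a, b}"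
    unfolding convex_hull_2_alt by blast
qed

lemma convex_hull_2_eq_fst:
  assumes "fst a < fst b"
  shows "convex hull {a, b} = {x. fst a \<le> fst x \<and> fst x \<le> fst b \<and> cross a b x = 0}"
proof (intro equalityI subsetI)
  fix x assume "x \<in> convex hull {a, b}"
  then obtain u where u: "0 \<le> u" "u \<le> 1" and x: "x = a + u *\<^sub>R (b - a)"
    unfolding convex_hull_2_alt by blast
  have "u * (fst b - fst a) \<le> 1 * (fst b - fst a)"
    using u assms by (intro mult_right_mono) auto
  moreover have "0 \<le> u * (fst b - fst a)" using u assms by simp
  ultimately show "x \<in> {x. fst a \<le> fst x \<and> fst x \<le> fst b \<and> cross a b x = 0}"
    by (auto simp: x cross_def algebra_simps)
next
  fix x assume x: "x \<in> {x. fst a \<le> fst x \<and> fst x \<le> fst b \<and> cross a b x = 0}"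
  define u where "u = (fst x - fst a) / (fst b - fst a)"
  have 01: "0 \<le> u" "u \<le> 1" using x assms by (auto simp: u_def divide_le_eq)
  have u: "u * (fst b - fst a) = fst x - fst a" using assms by (simp add: u_def)
  then have "(fst b - fst a) * (snd x - snd a - u * (snd b - snd a)) = 0"
    using x unfolding cross_def mem_Collect_eq by algebra
  then have "x = a + u *\<^sub>R (b - a)"
    using u assms by (simp add: prod_eq_iff)
  with 01 show "x \<in> convex hull {a, b}"
    unfolding convex_hull_2_alt by blast
qed

lemma cross_eq_inner:
  "cross a b x = (snd a - snd b, fst b - fst a) \<bullet> x - (snd a - snd b, fst b - fst a) \<bullet> a"
  by (simp add: cross_def inner_prod_def algebra_simps)

lemma interior_half_plane:
  assumes "a \<noteq> b"
  shows "interior {x. 0 \<le> cross a b x} = {x. 0 < cross a b x}"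
proof -
  have "(snd a - snd b, fst b - fst a) \<noteq> 0"
    using assms by (auto simp: prod_eq_iff)
  then show ?thesis
    using interior_halfspace_ge[of "(snd a - snd b, fst b - fst a)" "(snd a - snd b, fst b - fst a) \<bullet> a"]
    by (simp add: cross_eq_inner)
qed

lemma interior_convex_hull_3:
  assumes "cross a b c > 0"
  shows "interior (convex hull {a, b, c}) = {x. 0 < cross a b x \<and> 0 < cross b c x \<and> 0 < cross c a x}"
proof -
  have ne: "a \<noteq> b" "b \<noteq> c" "c \<noteq> a" using assms by (auto simp: cross_def)
  have "convex hull {a, b, c} = {x. 0 \<le> cross a b x} \<inter> {x. 0 \<le> cross b c x} \<inter> {x. 0 \<le> cross c a x}"
    using convex_hull_3_eq_cross[OF assms] by auto
  then show ?thesis using ne by (auto simp: interior_half_plane)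
qed

lemma not_affine_dependent_3:
  assumes "cross a b c > 0"
  shows "\<not> affine_dependent {a, b, c}" "card {a, b, c} = 3"
proof -
  have ne: "a \<noteq> b" "b \<noteq> c" "c \<noteq> a" using assms by (auto simp: cross_def)
  then show "card {a, b, c} = 3" by simp
  show "\<not> affine_dependent {a, b, c}"
  proof
    assume "affine_dependent {a, b, c}"
    then have "collinear {a, b, c}" using collinear_3_eq_affine_dependent by blast
    then obtain u where u: "\<forall>x\<in>{a, b, c}. \<forall>y\<in>{a, b, c}. \<exists>t. x - y = t *\<^sub>R u"
      unfolding collinear_def by blast
    obtain s t where "b - a = s *\<^sub>R u" "c - a = t *\<^sub>R u" using u by blast
    then have "b = a + s *\<^sub>R u" "c = a + t *\<^sub>R u" by (metis add.commute diff_add_cancel)+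
    then have "cross a b c = 0" by (simp add: cross_def)
    with assms show False by simp
  qed
qed

lemma simplex_convex_hull_3:
  assumes "cross a b c > 0" shows "2 simplex (convex hull {a, b, c})"
  unfolding simplex_def using not_affine_dependent_3[OF assms] by (intro exI[of _ "{a, b, c}"]) simp

lemma facet_of_convex_hull_3:
  assumes "cross a b c > 0"
  shows "s facet_of convex hull {a, b, c} \<longleftrightarrow>
    s = convex hull {a, b} \<or> s = convex hull {b, c} \<or> s = convex hull {c, a}"
proof -
  have ne: "a \<noteq> b" "b \<noteq> c" "c \<noteq> a" using assms by (auto simp: cross_def)
  have "{a, b, c} - {a} = {b, c}" "{a, b, c} - {b} = {c, a}" "{a, b, c} - {c} = {a, b}"
    using ne by auto
  then have "(\<exists>u. u \<in> {a, b, c} \<and> s = convex hull ({a, b, c} - {u})) \<longleftrightarrow>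
      s = convex hull {a, b} \<or> s = convex hull {b, c} \<or> s = convex hull {c, a}"
    by (simp only: insert_iff empty_iff simp_thms conj_disj_distribR ex_disj_distrib) (metis (no_types))
  then show ?thesis
    unfolding facet_of_convex_hull_affine_independent_alt[OF not_affine_dependent_3(1)[OF assms]]
      not_affine_dependent_3(2)[OF assms] by (simp only:) simp
qed

lemma face_of_convex_hull_3:
  assumes "cross a b c > 0" "S \<subseteq> {a, b, c}"
  shows "convex hull S face_of convex hull {a, b, c}"
  using face_of_convex_hull_affine_independent[OF not_affine_dependent_3(1)[OF assms(1)]] assms(2)
  by blast

lemma extreme_point_of_convex_hull_3:
  assumes "cross a b c > 0"
  shows "v extreme_point_of convex hull {a, b, c} \<longleftrightarrow> v \<in> {a, b, c}"
  using extreme_point_of_convex_hull_affine_independent[OF not_affine_dependent_3(1)[OF assms]]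
  by blast

text \<open>A strictly sorted list is determined by its set of values, and \<open>lateral v\<close>
  is injective on \<open>W\<close> because its values along \<open>ws\<close> are strictly
  increasing. This evaluates the definite description for explicit lists.\<close>

lemma left_to_right_eq:
  assumes "sorted_wrt (\<lambda>w w'. lateral v w < lateral v w') ws" "set ws = W"
  shows "left_to_right v W = ws"
  unfolding left_to_right_def
proof (rule the_equality)
  fix ws' assume ws': "set ws' = W \<and> sorted_wrt (\<lambda>w w'. lateral v w < lateral v w') ws'"
  have s: "sorted_wrt (<) (map (lateral v) ws)" "sorted_wrt (<) (map (lateral v) ws')"
    using assms ws' by (simp_all add: sorted_wrt_map)
  then have "map (lateral v) ws' = map (lateral v) ws"
    using assms ws' by (intro strict_sorted_equal) auto
  moreover have "inj_on (lateral v) (set ws \<union> set ws')"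
    using s(1) assms ws' strict_sorted_iff distinct_map by (metis sup.idem)
  ultimately show "ws' = ws" by (simp add: map_inj_on Un_commute)
qed (use assms in auto)

section \<open>Valencies and the tripod condition\<close>

lemma valency_empty: "valency {} v = 0" by (simp add: valency_def)

lemma valency_insert:
  assumes "finite G" "e \<notin> G"
  shows "valency (insert e G) v = (if v \<in> e then Suc (valency G v) else valency G v)"
proof -
  have "{f \<in> insert e G. v \<in> f} = (if v \<in> e then insert e {f \<in> G. v \<in> f} else {f \<in> G. v \<in> f})"
    by auto
  then show ?thesis using assms by (simp add: valency_def)
qed

text \<open>The last clause of \<open>drawn_dual_graph\<close> for a single triangle, isolated so
  that each triangle can be checked on its own.\<close>

definition tripod_in :: "plane set set \<Rightarrow> plane set \<Rightarrow> bool" where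
  "tripod_in G t \<longleftrightarrow> connected (drawing G \<inter> t) \<and>
     (\<exists>p\<in>interior t. {v \<in> \<Union>G \<inter> t. valency G v = 3} = {p}) \<and>
     (\<forall>s. s facet_of t \<longrightarrow> (\<exists>q\<in>rel_interior s. drawing G \<inter> s = {q}))"

text \<open>The part of the drawing in the triangle is a union of three segments through
  \<open>p\<close>, hence connected; the relative interior of a side is its open segment.\<close>

lemma tripod_in_triangle:
  assumes t: "cross a b c > 0"
    and p: "0 < cross a b p" "0 < cross b c p" "0 < cross c a p"
    and tri: "{v \<in> \<Union>G \<inter> convex hull {a, b, c}. valency G v = 3} = {p}"
    and q: "q1 \<in> open_segment a b" "q2 \<in> open_segment b c" "q3 \<in> open_segment c a"
    and cut: "drawing G \<inter> convex hull {a, b} = {q1}" "drawing G \<inter> convex hull {b, c} = {q2}"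
      "drawing G \<inter> convex hull {c, a} = {q3}"
    and legs: "drawing G \<inter> convex hull {a, b, c} =
      convex hull {p, q1} \<union> convex hull {p, q2} \<union> convex hull {p, q3}"
  shows "tripod_in G (convex hull {a, b, c})"
  unfolding tripod_in_def
proof (intro conjI allI impI)
  have ne: "a \<noteq> b" "b \<noteq> c" "c \<noteq> a" using t by (auto simp: cross_def)
  have "p \<in> convex hull {p, q1} \<inter> convex hull {p, q2}" 
    "p \<in> (convex hull {p, q1} \<union> convex hull {p, q2}) \<inter> convex hull {p, q3}"
    by (simp_all add: hull_inc)
  then show "connected (drawing G \<inter> convex hull {a, b, c})"
    unfolding legs by (intro connected_Un convex_connected convex_convex_hull) auto
  show "\<exists>p\<in>interior (convex hull {a, b, c}). {v \<in> \<Union>G \<inter> convex hull {a, b, c}. valency G v = 3} = {p}"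
    using p tri by (auto simp: interior_convex_hull_3[OF t])
  fix s assume "s facet_of convex hull {a, b, c}"
  then show "\<exists>q\<in>rel_interior s. drawing G \<inter> s = {q}"
    using cut q ne
    by (auto simp: facet_of_convex_hull_3[OF t] segment_convex_hull[symmetric] rel_interior_closed_segment)
qed

section \<open>Drawings of the Pachner moves\<close>

lemma mem_segment_up:
  fixes a b c d x y :: real
  assumes "b < d"
  shows "(x, y) \<in> convex hull {(a, b), (c, d)} \<longleftrightarrow> b \<le> y \<and> y \<le> d \<and> (c - a) * (y - b) = (d - b) * (x - a)"
  using convex_hull_2_eq_snd[of "(a, b)" "(c, d)"] assms by (simp add: cross_def)

lemma mem_segment_down:
  fixes a b c d x y :: real
  assumes "d < b"
  shows "(x, y) \<in> convex hull {(a, b), (c, d)} \<longleftrightarrow> d \<le> y \<and> y \<le> b \<and> (a - c) * (y - d) = (b - d) * (x - c)"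
  using mem_segment_up[OF assms, of x y c a] by (simp add: insert_commute)

lemma mem_segment_right:
  fixes a b c x y :: real
  assumes "a < c"
  shows "(x, y) \<in> convex hull {(a, b), (c, b)} \<longleftrightarrow> a \<le> x \<and> x \<le> c \<and> y = b"
  using convex_hull_2_eq_fst[of "(a, b)" "(c, b)"] assms by (simp add: cross_def)

lemma mem_segment_left:
  fixes a b c x y :: real
  assumes "c < a"
  shows "(x, y) \<in> convex hull {(a, b), (c, b)} \<longleftrightarrow> c \<le> x \<and> x \<le> a \<and> y = b"
  using mem_segment_right[OF assms, of x y b] by (simp add: insert_commute)

lemmas mem_segment = mem_segment_up mem_segment_down mem_segment_right mem_segment_left

lemma mem_triangle:
  assumes "cross (a, b) (c, d) (e, f) > 0"
  shows "(x, y) \<in> convex hull {(a, b), (c, d), (e, f)} \<longleftrightarrow>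
    (d - b) * (x - a) \<le> (c - a) * (y - b) \<and> (f - d) * (x - c) \<le> (e - c) * (y - d) \<and>
    (b - f) * (x - e) \<le> (a - e) * (y - f)"
  unfolding convex_hull_3_eq_cross[OF assms] by (simp add: cross_def)

lemma edge_not_horizontal: "b \<noteq> d \<Longrightarrow> \<exists>v w. {(a, b), (c, d)} = {v, w} \<and> snd v \<noteq> snd w"
  by (intro exI[of _ "(a, b)"] exI[of _ "(c, d)"]) simp

lemma open_segmentI:
  assumes "0 < u" "u < 1" "x = (1 - u) *\<^sub>R a + u *\<^sub>R b" "a \<noteq> b"
  shows "x \<in> open_segment a b"
  using assms by (auto simp: in_segment)

text \<open>
  The vertices of the two dual graphs are the pairwise intersections of four fixed lines carrying the
  outer legs, so straight legs with the same germs at the boundary can be used before and after the move.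
  The heights are chosen such that the two drawings evaluate to both sides of associativity, with
  one input leg bent upwards.
\<close>

definition diamond_h :: "plane set set" where
  "diamond_h = {convex hull {(-6,0), (0,-6), (6,0)}, convex hull {(-6,0), (6,0), (0,6)}}"

definition diamond_v :: "plane set set" where
  "diamond_v = {convex hull {(-6,0), (0,-6), (0,6)}, convex hull {(0,-6), (6,0), (0,6)}}"

definition dual_h :: "plane set set" where
  "dual_h = {{(-1,-1), (-1,-5)}, {(-1,-1), (2,-4)}, {(-1,-1), (1,1)}, {(1,1), (1,5)}, {(1,1), (-2,4)}}"

definition dual_v :: "plane set set" where
  "dual_v = {{(-1,3), (-1,-5)}, {(1,-3), (2,-4)}, {(1,-3), (-1,3)}, {(1,-3), (1,5)}, {(-1,3), (-2,4)}}"

text \<open>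
  The new vertex of the triangulation is also the vertex of the first dual graph; the second one is a
  triangle around it with vertices on the three legs of the first.
\<close>

definition triangle_1 :: "plane set set" where
  "triangle_1 = {convex hull {(0,-72), (36,36), (-36,36)}}"

definition triangle_3 :: "plane set set" where
  "triangle_3 = {convex hull {(0,-72), (36,36), (0,0)}, convex hull {(36,36), (-36,36), (0,0)},
     convex hull {(-36,36), (0,-72), (0,0)}}"

definition dual_1 :: "plane set set" where
  "dual_1 = {{(0,0), (-18,-18)}, {(0,0), (18,-18)}, {(0,0), (0,36)}}"

text \<open>A mirror symmetric inner triangle would have a horizontal side, hence the lower vertices
  (-12,-12) and (6,-6). The heights -12, -6, 12 make the three vertices a fork followed by two
  joins, and the sides meet the new edges of \<open>triangle_3\<close> in the integer points (0,-8),
  (3,3) and (-4,4).\<close>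

definition dual_3 :: "plane set set" where
  "dual_3 = {{(-12,-12), (-18,-18)}, {(6,-6), (18,-18)}, {(0,12), (0,36)},
     {(-12,-12), (6,-6)}, {(-12,-12), (0,12)}, {(6,-6), (0,12)}}"

section \<open>The quadrilateral with its two triangulations\<close>

lemma Union_diamond_h: "\<Union>diamond_h = {(x, y). \<bar>x\<bar> + \<bar>y\<bar> \<le> 6}"
  unfolding diamond_h_def by (auto simp: mem_triangle cross_def abs_if split: if_splits)

lemma Union_diamond_v: "\<Union>diamond_v = {(x, y). \<bar>x\<bar> + \<bar>y\<bar> \<le> 6}"
  unfolding diamond_v_def by (auto simp: mem_triangle cross_def abs_if split: if_splits)

text \<open>Interiors commute with finite intersections, so the interior is computed from four
  half-planes.\<close>

lemma interior_diamond: "interior {(x, y). \<bar>x\<bar> + \<bar>y\<bar> \<le> 6} = {(x, y). \<bar>x\<bar> + \<bar>y\<bar> < (6::real)}"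
proof -
  have "{(x, y). \<bar>x\<bar> + \<bar>y\<bar> \<le> (6::real)} =
    {z. 0 \<le> cross (-6,0) (0,-6) z} \<inter> {z. 0 \<le> cross (0,-6) (6,0) z} \<inter>
    {z. 0 \<le> cross (6,0) (0,6) z} \<inter> {z. 0 \<le> cross (0,6) (-6,0) z}"
    by (auto simp: cross_def abs_if split: if_splits)
  then show ?thesis
    by (simp add: interior_Int interior_half_plane) (auto simp: cross_def abs_if split: if_splits)
qed

lemma closed_diamond: "closed {(x, y). \<bar>x\<bar> + \<bar>y\<bar> \<le> (6::real)}"
  unfolding case_prod_unfold by (intro closed_Collect_le continuous_intros)

lemma frontier_diamond: "frontier {(x, y). \<bar>x\<bar> + \<bar>y\<bar> \<le> 6} = {(x, y). \<bar>x\<bar> + \<bar>y\<bar> = (6::real)}"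
  unfolding frontier_def closure_closed[OF closed_diamond] interior_diamond by auto

lemma triangulated_diamond_h: "triangulated_region diamond_h"
proof -
  have "convex hull {(-6,0), (0,-6), (6,0)} \<inter> convex hull {(-6,0), (6,0), (0,6)} =
      convex hull {(-6,0), (6::real,0::real)}"
    by (auto simp: mem_triangle mem_segment cross_def)
  then show ?thesis
    unfolding triangulated_region_def triangulation_def diamond_h_def
    by (auto simp: face_of_refl convex_convex_hull Int_commute cross_def simplex_convex_hull_3
        intro!: face_of_convex_hull_3 exI[of _ 2])
qed

lemma triangulated_diamond_v: "triangulated_region diamond_v"
proof -
  have "convex hull {(-6,0), (0,-6), (0,6)} \<inter> convex hull {(0,-6), (6,0), (0,6)} =
      convex hull {(0,-6), (0::real,6::real)}"
    by (auto simp: mem_triangle mem_segment cross_def)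
  then show ?thesis
    unfolding triangulated_region_def triangulation_def diamond_v_def
    by (auto simp: face_of_refl convex_convex_hull Int_commute cross_def simplex_convex_hull_3
        intro!: face_of_convex_hull_3 exI[of _ 2])
qed

lemma plane_diagram_dual_h: "plane_diagram dual_h"
  unfolding plane_diagram_def
proof (intro conjI)
  show "\<forall>e\<in>dual_h. \<forall>f\<in>dual_h. convex hull e \<inter> convex hull f = convex hull (e \<inter> f)"
    unfolding dual_h_def by (simp add: set_eq_iff mem_segment) auto
  show "\<forall>e\<in>dual_h. \<exists>v w. e = {v, w} \<and> snd v \<noteq> snd w"
    unfolding dual_h_def by (simp add: edge_not_horizontal del: split_paired_Ex)
qed (simp add: dual_h_def)

lemma plane_diagram_dual_v: "plane_diagram dual_v"
  unfolding plane_diagram_def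
proof (intro conjI)
  show "\<forall>e\<in>dual_v. \<forall>f\<in>dual_v. convex hull e \<inter> convex hull f = convex hull (e \<inter> f)"
    unfolding dual_v_def by (simp add: set_eq_iff mem_segment) auto
qed (simp_all add: dual_v_def edge_not_horizontal del: split_paired_Ex)

lemma Union_dual_h: "\<Union>dual_h = {(-1,-1), (1,1), (-1,-5), (2,-4), (1,5), (-2,4)}"
  unfolding dual_h_def by auto

lemma Union_dual_v: "\<Union>dual_v = {(1,-3), (-1,3), (-1,-5), (2,-4), (1,5), (-2,4)}"
  unfolding dual_v_def by auto

lemma valency_dual_h: "valency dual_h v = 
  (if v \<in> {(-1,-1), (1,1)} then 3 else if v \<in> {(-1,-5), (2,-4), (1,5), (-2,4)} then 1 else 0)"
  unfolding dual_h_def by (simp add: valency_insert valency_empty doubleton_eq_iff)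

lemma valency_dual_v: "valency dual_v v = 
  (if v \<in> {(1,-3), (-1,3)} then 3 else if v \<in> {(-1,-5), (2,-4), (1,5), (-2,4)} then 1 else 0)"
  unfolding dual_v_def by (simp add: valency_insert valency_empty doubleton_eq_iff)

lemma drawing_insert: "drawing (insert e G) = convex hull e \<union> drawing G" "drawing {} = {}"
  by (auto simp: drawing_def)

lemmas mem_drawing_dual_h = dual_h_def drawing_insert mem_segment
lemmas mem_drawing_dual_v = dual_v_def drawing_insert mem_segment
lemmas mem_drawing_dual_1 = dual_1_def drawing_insert mem_segment
lemmas mem_drawing_dual_3 = dual_3_def drawing_insert mem_segment

text \<open>The three points are the two boundary end points below the diagonal and the crossing of
  the inner edge with the diagonal; the argument of \<open>open_segmentI\<close> is the affine
  parameter of the point on its side.\<close>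

lemma tripod_dual_h_1: "tripod_in dual_h (convex hull {(-6,0), (0,-6), (6,0)})"
proof (rule tripod_in_triangle)
  show "(-1,-5) \<in> open_segment (-6,0) (0::real,-6::real)" by (rule open_segmentI[of "5/6"]) simp_all
  show "(2,-4) \<in> open_segment (0,-6) (6::real,0::real)" by (rule open_segmentI[of "1/3"]) simp_all
  show "(0,0) \<in> open_segment (6,0) (-6::real,0::real)" by (rule open_segmentI[of "1/2"]) simp_all
  show "{v \<in> \<Union>dual_h \<inter> convex hull {(-6,0), (0,-6), (6,0)}. valency dual_h v = 3} = {(-1,-1)}"
    by (auto simp: valency_dual_h mem_triangle cross_def Union_dual_h split: if_splits)
qed (auto simp: cross_def mem_drawing_dual_h mem_triangle)

lemma tripod_dual_h_2: "tripod_in dual_h (convex hull {(-6,0), (6,0), (0,6)})"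
proof (rule tripod_in_triangle)
  show "(0,0) \<in> open_segment (-6,0) (6::real,0::real)" by (rule open_segmentI[of "1/2"]) simp_all
  show "(1,5) \<in> open_segment (6,0) (0::real,6::real)" by (rule open_segmentI[of "5/6"]) simp_all
  show "(-2,4) \<in> open_segment (0,6) (-6::real,0::real)" by (rule open_segmentI[of "1/3"]) simp_all
  show "{v \<in> \<Union>dual_h \<inter> convex hull {(-6,0), (6,0), (0,6)}. valency dual_h v = 3} = {(1,1)}"
    by (auto simp: valency_dual_h mem_triangle cross_def Union_dual_h split: if_splits)
qed (auto simp: cross_def mem_drawing_dual_h mem_triangle)

lemma tripod_dual_v_1: "tripod_in dual_v (convex hull {(-6,0), (0,-6), (0,6)})"
proof (rule tripod_in_triangle)
  show "(-1,-5) \<in> open_segment (-6,0) (0::real,-6::real)" by (rule open_segmentI[of "5/6"]) simp_all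
  show "(0,0) \<in> open_segment (0,-6) (0::real,6::real)" by (rule open_segmentI[of "1/2"]) simp_all
  show "(-2,4) \<in> open_segment (0,6) (-6::real,0::real)" by (rule open_segmentI[of "1/3"]) simp_all
  show "{v \<in> \<Union>dual_v \<inter> convex hull {(-6,0), (0,-6), (0,6)}. valency dual_v v = 3} = {(-1,3)}"
    by (auto simp: valency_dual_v mem_triangle cross_def Union_dual_v split: if_splits)
qed (auto simp: cross_def mem_drawing_dual_v mem_triangle)

lemma tripod_dual_v_2: "tripod_in dual_v (convex hull {(0,-6), (6,0), (0,6)})"
proof (rule tripod_in_triangle)
  show "(2,-4) \<in> open_segment (0,-6) (6::real,0::real)" by (rule open_segmentI[of "1/3"]) simp_all
  show "(1,5) \<in> open_segment (6,0) (0::real,6::real)" by (rule open_segmentI[of "5/6"]) simp_all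
  show "(0,0) \<in> open_segment (0,6) (0::real,-6::real)" by (rule open_segmentI[of "1/2"]) simp_all
  show "{v \<in> \<Union>dual_v \<inter> convex hull {(0,-6), (6,0), (0,6)}. valency dual_v v = 3} = {(1,-3)}"
    by (auto simp: valency_dual_v mem_triangle cross_def Union_dual_v split: if_splits)
qed (auto simp: cross_def mem_drawing_dual_v mem_triangle)

section \<open>The triangle and its subdivision\<close>

lemma Union_triangle_1: "\<Union>triangle_1 = {(x, y). y \<le> 36 \<and> 3 * \<bar>x\<bar> \<le> y + 72}"
  unfolding triangle_1_def by (auto simp: mem_triangle cross_def abs_if split: if_splits)

lemma Union_triangle_3: "\<Union>triangle_3 = {(x, y). y \<le> 36 \<and> 3 * \<bar>x\<bar> \<le> y + 72}"
  unfolding triangle_3_def by (auto simp: mem_triangle cross_def abs_if split: if_splits)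

lemma interior_triangle: "interior {(x, y). y \<le> 36 \<and> 3 * \<bar>x\<bar> \<le> y + (72::real)} = {(x, y). y < 36 \<and> 3 * \<bar>x\<bar> < y + (72::real)}"
proof -
  have "0 < cross (0,-72) (36,36) (-36,36)" by (simp add: cross_def)
  moreover have "{(x, y). y \<le> 36 \<and> 3 * \<bar>x\<bar> \<le> y + (72::real)} = convex hull {(0,-72), (36,36), (-36,36)}"
    using Union_triangle_1 by (simp add: triangle_1_def)
  ultimately show ?thesis
    by (simp only: interior_convex_hull_3) (auto simp: cross_def abs_if split: if_splits)
qed

lemma closed_triangle: "closed {(x, y). y \<le> 36 \<and> 3 * \<bar>x\<bar> \<le> y + (72::real)}"
  unfolding case_prod_unfold by (intro closed_Collect_conj closed_Collect_le continuous_intros)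

lemma frontier_triangle: "frontier {(x, y). y \<le> 36 \<and> 3 * \<bar>x\<bar> \<le> y + (72::real)} =
  {(x, y). y \<le> 36 \<and> 3 * \<bar>x\<bar> \<le> y + 72 \<and> (y = 36 \<or> 3 * \<bar>x\<bar> = y + (72::real))}"
  unfolding frontier_def closure_closed[OF closed_triangle] interior_triangle by auto

lemma triangulated_triangle_1: "triangulated_region triangle_1"
  unfolding triangulated_region_def triangulation_def triangle_1_def
  by (auto simp: face_of_refl convex_convex_hull cross_def simplex_convex_hull_3 intro!: exI[of _ 2])

lemma triangulated_triangle_3: "triangulated_region triangle_3"
proof -
  have "convex hull {(0,-72), (36,36), (0,0)} \<inter> convex hull {(36,36), (-36,36), (0,0)} =
      convex hull {(36,36), (0::real,0::real)}"
    "convex hull {(0,-72), (36,36), (0,0)} \<inter> convex hull {(-36,36), (0,-72), (0,0)} =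
      convex hull {(0,-72), (0::real,0::real)}"
    "convex hull {(36,36), (-36,36), (0,0)} \<inter> convex hull {(-36,36), (0,-72), (0,0)} =
      convex hull {(-36,36), (0::real,0::real)}"
    by (auto simp: mem_triangle mem_segment cross_def)
  then show ?thesis
    unfolding triangulated_region_def triangulation_def triangle_3_def
    by (auto simp: face_of_refl convex_convex_hull Int_commute cross_def simplex_convex_hull_3
        intro!: face_of_convex_hull_3 exI[of _ 2])
qed

lemma plane_diagram_dual_1: "plane_diagram dual_1"
  unfolding plane_diagram_def
proof (intro conjI)
  show "\<forall>e\<in>dual_1. \<forall>f\<in>dual_1. convex hull e \<inter> convex hull f = convex hull (e \<inter> f)"
    unfolding dual_1_def by (simp add: set_eq_iff mem_segment) auto
qed (simp_all add: dual_1_def edge_not_horizontal del: split_paired_Ex)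

lemma Union_dual_1: "\<Union>dual_1 = {(0,0), (-18,-18), (18,-18), (0,36)}"
  unfolding dual_1_def by auto

lemma valency_dual_1: "valency dual_1 v =
  (if v \<in> {(0,0)} then 3 else if v \<in> {(-18,-18), (18,-18), (0,36)} then 1 else 0)"
  unfolding dual_1_def by (simp add: valency_insert valency_empty doubleton_eq_iff)

lemma plane_diagram_dual_3: "plane_diagram dual_3"
  unfolding plane_diagram_def
proof (intro conjI)
  show "\<forall>e\<in>dual_3. \<forall>f\<in>dual_3. convex hull e \<inter> convex hull f = convex hull (e \<inter> f)"
    unfolding dual_3_def by (simp add: set_eq_iff mem_segment) auto
qed (simp_all add: dual_3_def edge_not_horizontal del: split_paired_Ex)

lemma Union_dual_3: "\<Union>dual_3 = {(-12,-12), (6,-6), (0,12), (-18,-18), (18,-18), (0,36)}"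
  unfolding dual_3_def by auto

lemma valency_dual_3: "valency dual_3 v =
  (if v \<in> {(-12,-12), (6,-6), (0,12)} then 3 else if v \<in> {(-18,-18), (18,-18), (0,36)} then 1 else 0)"
  unfolding dual_3_def by (simp add: valency_insert valency_empty doubleton_eq_iff)

lemma tripod_dual_1_1: "tripod_in dual_1 (convex hull {(0,-72), (36,36), (-36,36)})"
proof (rule tripod_in_triangle)
  show "(18,-18) \<in> open_segment (0,-72) (36::real,36::real)" by (rule open_segmentI[of "1/2"]) simp_all
  show "(0,36) \<in> open_segment (36,36) (-36::real,36::real)" by (rule open_segmentI[of "1/2"]) simp_all
  show "(-18,-18) \<in> open_segment (-36,36) (0::real,-72::real)" by (rule open_segmentI[of "1/2"]) simp_all
  show "{v \<in> \<Union>dual_1 \<inter> convex hull {(0,-72), (36,36), (-36,36)}. valency dual_1 v = 3} = {(0,0)}"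
    by (auto simp: valency_dual_1 mem_triangle cross_def Union_dual_1 split: if_splits)
qed (auto simp: cross_def mem_drawing_dual_1 mem_triangle)

lemma tripod_dual_3_1: "tripod_in dual_3 (convex hull {(0,-72), (36,36), (0,0)})"
proof (rule tripod_in_triangle)
  show "(18,-18) \<in> open_segment (0,-72) (36::real,36::real)" by (rule open_segmentI[of "1/2"]) simp_all
  show "(3,3) \<in> open_segment (36,36) (0::real,0::real)" by (rule open_segmentI[of "11/12"]) simp_all
  show "(0,-8) \<in> open_segment (0,0) (0::real,-72::real)" by (rule open_segmentI[of "1/9"]) simp_all
  show "{v \<in> \<Union>dual_3 \<inter> convex hull {(0,-72), (36,36), (0,0)}. valency dual_3 v = 3} = {(6,-6)}"
    by (auto simp: valency_dual_3 mem_triangle cross_def Union_dual_3 split: if_splits)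
qed (auto simp: cross_def mem_drawing_dual_3 mem_triangle)

lemma tripod_dual_3_2: "tripod_in dual_3 (convex hull {(36,36), (-36,36), (0,0)})"
proof (rule tripod_in_triangle)
  show "(0,36) \<in> open_segment (36,36) (-36::real,36::real)" by (rule open_segmentI[of "1/2"]) simp_all
  show "(-4,4) \<in> open_segment (-36,36) (0::real,0::real)" by (rule open_segmentI[of "8/9"]) simp_all
  show "(3,3) \<in> open_segment (0,0) (36::real,36::real)" by (rule open_segmentI[of "1/12"]) simp_all
  show "{v \<in> \<Union>dual_3 \<inter> convex hull {(36,36), (-36,36), (0,0)}. valency dual_3 v = 3} = {(0,12)}"
    by (auto simp: valency_dual_3 mem_triangle cross_def Union_dual_3 split: if_splits)
qed (auto simp: cross_def mem_drawing_dual_3 mem_triangle)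

lemma tripod_dual_3_3: "tripod_in dual_3 (convex hull {(-36,36), (0,-72), (0,0)})"
proof (rule tripod_in_triangle)
  show "(-18,-18) \<in> open_segment (-36,36) (0::real,-72::real)" by (rule open_segmentI[of "1/2"]) simp_all
  show "(0,-8) \<in> open_segment (0,-72) (0::real,0::real)" by (rule open_segmentI[of "8/9"]) simp_all
  show "(-4,4) \<in> open_segment (0,0) (-36::real,36::real)" by (rule open_segmentI[of "1/9"]) simp_all
  show "{v \<in> \<Union>dual_3 \<inter> convex hull {(-36,36), (0,-72), (0,0)}. valency dual_3 v = 3} = {(-12,-12)}"
    by (auto simp: valency_dual_3 mem_triangle cross_def Union_dual_3 split: if_splits)
qed (auto simp: cross_def mem_drawing_dual_3 mem_triangle)

text \<open>The open segment from an interior point of a closed convex set to any of its points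
  stays in the interior. Thus a straight leg can touch the boundary of the region only at its outer
  end.\<close>

lemma segment_Int_frontier:
  fixes p q :: "'a::euclidean_space"
  assumes "convex S" "closed S" "p \<in> interior S" "q \<in> S"
  shows "convex hull {p, q} \<inter> frontier S \<subseteq> {q}"
proof -
  have "open_segment p q \<subseteq> interior S"
    using assms in_interior_closure_convex_segment[of S p q] by (simp add: closure_closed)
  moreover have "convex hull {p, q} = insert p (insert q (open_segment p q))"
    by (auto simp: segment_convex_hull[symmetric] open_segment_def)
  ultimately show ?thesis using assms(3) by (auto simp: frontier_def)
qed

lemma convex_half_plane: "convex {x. 0 \<le> cross a b x}"
  using convex_halfspace_ge[of "(snd a - snd b, fst b - fst a) \<bullet> a" "(snd a - snd b, fst b - fst a)"]
  by (simp add: cross_eq_inner)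

lemma convex_diamond: "convex {(x, y). \<bar>x\<bar> + \<bar>y\<bar> \<le> (6::real)}"
proof -
  have "{(x, y). \<bar>x\<bar> + \<bar>y\<bar> \<le> (6::real)} =
    {z. 0 \<le> cross (-6,0) (0,-6) z} \<inter> {z. 0 \<le> cross (0,-6) (6,0) z} \<inter>
    {z. 0 \<le> cross (6,0) (0,6) z} \<inter> {z. 0 \<le> cross (0,6) (-6,0) z}"
    by (auto simp: cross_def abs_if split: if_splits)
  then show ?thesis by (simp only: convex_Int convex_half_plane)
qed

lemma convex_triangle: "convex {(x, y). y \<le> 36 \<and> 3 * \<bar>x\<bar> \<le> y + (72::real)}"
  using Union_triangle_1 convex_convex_hull[of "{(0,-72), (36,36), (-36::real,36::real)}"]
  by (simp add: triangle_1_def)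

section \<open>Verification of the four drawn dual graphs\<close>

lemma drawn_dual_h: "drawn_dual_graph diamond_h dual_h"
proof -
  have "drawing dual_h \<subseteq> {(x, y). \<bar>x\<bar> + \<bar>y\<bar> \<le> 6}"
    by (auto simp: mem_drawing_dual_h abs_if)
  moreover have "\<forall>v\<in>\<Union>dual_h. valency dual_h v \<le> 3"
    by (simp add: valency_dual_h)
  moreover have "\<forall>v\<in>\<Union>dual_h. (valency dual_h v = 1) = (v \<in> {(x, y). \<bar>x\<bar> + \<bar>y\<bar> = 6})"
    by (simp add: valency_dual_h Union_dual_h)
  \<comment> \<open>Each edge is written with an interior point of the region first, so
    \<open>segment_Int_frontier\<close> applies edge by edge.\<close>
  moreover have "drawing dual_h \<inter> frontier {(x, y). \<bar>x\<bar> + \<bar>y\<bar> \<le> 6} \<subseteq> \<Union>dual_h"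
    unfolding Union_dual_h unfolding drawing_insert dual_h_def Int_Un_distrib2
    by (intro Un_least; (rule order_trans[OF segment_Int_frontier[OF convex_diamond closed_diamond]])?)
      (auto simp: interior_diamond)
  moreover have "\<forall>t\<in>diamond_h. tripod_in dual_h t"
    unfolding diamond_h_def by (simp add: tripod_dual_h_1 tripod_dual_h_2)
  ultimately show ?thesis
    unfolding drawn_dual_graph_def tripod_in_def Union_diamond_h frontier_diamond
    using plane_diagram_dual_h by blast
qed

lemma drawn_dual_v: "drawn_dual_graph diamond_v dual_v"
proof -
  have "drawing dual_v \<subseteq> {(x, y). \<bar>x\<bar> + \<bar>y\<bar> \<le> 6}"
    by (auto simp: mem_drawing_dual_v abs_if)
  moreover have "\<forall>v\<in>\<Union>dual_v. valency dual_v v \<le> 3"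
    by (simp add: valency_dual_v)
  moreover have "\<forall>v\<in>\<Union>dual_v. (valency dual_v v = 1) = (v \<in> {(x, y). \<bar>x\<bar> + \<bar>y\<bar> = 6})"
    by (simp add: valency_dual_v Union_dual_v)
  moreover have "drawing dual_v \<inter> frontier {(x, y). \<bar>x\<bar> + \<bar>y\<bar> \<le> 6} \<subseteq> \<Union>dual_v"
    unfolding Union_dual_v unfolding drawing_insert dual_v_def Int_Un_distrib2
    by (intro Un_least; (rule order_trans[OF segment_Int_frontier[OF convex_diamond closed_diamond]])?)
      (auto simp: interior_diamond)
  moreover have "\<forall>t\<in>diamond_v. tripod_in dual_v t"
    unfolding diamond_v_def by (simp add: tripod_dual_v_1 tripod_dual_v_2)
  ultimately show ?thesis
    unfolding drawn_dual_graph_def tripod_in_def Union_diamond_v frontier_diamond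
    using plane_diagram_dual_v by blast
qed

lemma drawn_dual_1: "drawn_dual_graph triangle_1 dual_1"
proof -
  have "drawing dual_1 \<subseteq> {(x, y). y \<le> 36 \<and> 3 * \<bar>x\<bar> \<le> y + 72}"
    by (auto simp: mem_drawing_dual_1 abs_if)
  moreover have "\<forall>v\<in>\<Union>dual_1. valency dual_1 v \<le> 3"
    by (simp add: valency_dual_1)
  moreover have "\<forall>v\<in>\<Union>dual_1. (valency dual_1 v = 1) = (v \<in> {(x, y). y \<le> 36 \<and> 3 * \<bar>x\<bar> \<le> y + 72 \<and> (y = 36 \<or> 3 * \<bar>x\<bar> = y + 72)})"
    by (simp add: valency_dual_1 Union_dual_1)
  moreover have "drawing dual_1 \<inter> frontier {(x, y). y \<le> 36 \<and> 3 * \<bar>x\<bar> \<le> y + 72} \<subseteq> \<Union>dual_1"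
    unfolding Union_dual_1 unfolding drawing_insert dual_1_def Int_Un_distrib2
    by (intro Un_least; (rule order_trans[OF segment_Int_frontier[OF convex_triangle closed_triangle]])?)
      (auto simp: interior_triangle)
  moreover have "\<forall>t\<in>triangle_1. tripod_in dual_1 t"
    unfolding triangle_1_def by (simp add: tripod_dual_1_1)
  ultimately show ?thesis
    unfolding drawn_dual_graph_def tripod_in_def Union_triangle_1 frontier_triangle
    using plane_diagram_dual_1 by blast
qed

lemma drawn_dual_3: "drawn_dual_graph triangle_3 dual_3"
proof -
  have "drawing dual_3 \<subseteq> {(x, y). y \<le> 36 \<and> 3 * \<bar>x\<bar> \<le> y + 72}"
    by (auto simp: mem_drawing_dual_3 abs_if)
  moreover have "\<forall>v\<in>\<Union>dual_3. valency dual_3 v \<le> 3"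
    by (simp add: valency_dual_3)
  moreover have "\<forall>v\<in>\<Union>dual_3. (valency dual_3 v = 1) = (v \<in> {(x, y). y \<le> 36 \<and> 3 * \<bar>x\<bar> \<le> y + 72 \<and> (y = 36 \<or> 3 * \<bar>x\<bar> = y + 72)})"
    by (simp add: valency_dual_3 Union_dual_3)
  moreover have "drawing dual_3 \<inter> frontier {(x, y). y \<le> 36 \<and> 3 * \<bar>x\<bar> \<le> y + 72} \<subseteq> \<Union>dual_3"
    unfolding Union_dual_3 unfolding drawing_insert dual_3_def Int_Un_distrib2
    by (intro Un_least; (rule order_trans[OF segment_Int_frontier[OF convex_triangle closed_triangle]])?)
      (auto simp: interior_triangle)
  moreover have "\<forall>t\<in>triangle_3. tripod_in dual_3 t"
    unfolding triangle_3_def by (simp add: tripod_dual_3_1 tripod_dual_3_2 tripod_dual_3_3)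
  ultimately show ?thesis
    unfolding drawn_dual_graph_def tripod_in_def Union_triangle_3 frontier_triangle
    using plane_diagram_dual_3 by blast
qed

section \<open>Evaluation of the drawings\<close>

text \<open>Splits off the state of one edge; applied repeatedly, it turns the sum over all
  labellings of an explicit graph into nested sums over states.\<close>

lemma sum_PiE_insert:
  assumes "e \<notin> E"
  shows "(\<Sum>\<sigma>\<in>PiE (insert e E) F. f \<sigma>) = (\<Sum>y\<in>F e. \<Sum>\<sigma>\<in>PiE E F. f (\<sigma>(e := y)))"
proof -
  have "(\<Sum>\<sigma>\<in>PiE (insert e E) F. f \<sigma>) = (\<Sum>(y, \<sigma>)\<in>F e \<times> PiE E F. f (\<sigma>(e := y)))"
    unfolding PiE_insert_eq using inj_combinator[OF assms, of F]
    by (subst sum.reindex) (auto simp: case_prod_unfold)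
  then show ?thesis by (simp add: sum.cartesian_product)
qed

text \<open>The boundary condition constrains each edge separately, so it can be absorbed into the
  range of states allowed on that edge, as \<open>sum_PiE_insert\<close> demands.\<close>

lemma evaluation_eq_PiE:
  "evaluation X G \<tau> =
     (\<Sum>\<sigma>\<in>PiE G (\<lambda>e. {s \<in> states X. \<forall>v\<in>e. valency G v = 1 \<longrightarrow> s = \<tau> v}).
        \<Prod>v\<in>\<Union>G. weight X (map (\<lambda>w. \<sigma> {v, w}) (down_legs G v))
                          (map (\<lambda>w. \<sigma> {v, w}) (up_legs G v)))"
  unfolding evaluation_def by (rule sum.cong) (auto simp: PiE_def Pi_def)

section \<open>Weights of the four drawings\<close>

lemma legs_dual_h:
  "down_legs dual_h (-1,-1) = [(-1,-5), (2,-4)]"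
  "up_legs dual_h (-1,-1) = [(1,1)]"
  "down_legs dual_h (-1,-5) = []"
  "up_legs dual_h (-1,-5) = [(-1,-1)]"
  "down_legs dual_h (2,-4) = []"
  "up_legs dual_h (2,-4) = [(-1,-1)]"
  "down_legs dual_h (1,1) = [(-1,-1)]"
  "up_legs dual_h (1,1) = [(-2,4), (1,5)]"
  "down_legs dual_h (1,5) = [(1,1)]"
  "up_legs dual_h (1,5) = []"
  "down_legs dual_h (-2,4) = [(1,1)]"
  "up_legs dual_h (-2,4) = []"
  unfolding down_legs_def up_legs_def
  by (rule left_to_right_eq; auto simp: lateral_def dual_h_def doubleton_eq_iff)+

lemma legs_dual_v:
  "down_legs dual_v (-1,3) = [(-1,-5), (1,-3)]"
  "up_legs dual_v (-1,3) = [(-2,4)]"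
  "down_legs dual_v (-1,-5) = []"
  "up_legs dual_v (-1,-5) = [(-1,3)]"
  "down_legs dual_v (1,-3) = [(2,-4)]"
  "up_legs dual_v (1,-3) = [(-1,3), (1,5)]"
  "down_legs dual_v (2,-4) = []"
  "up_legs dual_v (2,-4) = [(1,-3)]"
  "down_legs dual_v (1,5) = [(1,-3)]"
  "up_legs dual_v (1,5) = []"
  "down_legs dual_v (-2,4) = [(-1,3)]"
  "up_legs dual_v (-2,4) = []"
  unfolding down_legs_def up_legs_def
  by (rule left_to_right_eq; auto simp: lateral_def dual_v_def doubleton_eq_iff)+

lemma legs_dual_1:
  "down_legs dual_1 (0,0) = [(-18,-18), (18,-18)]"
  "up_legs dual_1 (0,0) = [(0,36)]"
  "down_legs dual_1 (-18,-18) = []"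
  "up_legs dual_1 (-18,-18) = [(0,0)]"
  "down_legs dual_1 (18,-18) = []"
  "up_legs dual_1 (18,-18) = [(0,0)]"
  "down_legs dual_1 (0,36) = [(0,0)]"
  "up_legs dual_1 (0,36) = []"
  unfolding down_legs_def up_legs_def
  by (rule left_to_right_eq; auto simp: lateral_def dual_1_def doubleton_eq_iff)+

lemma legs_dual_3:
  "down_legs dual_3 (-12,-12) = [(-18,-18)]"
  "up_legs dual_3 (-12,-12) = [(0,12), (6,-6)]"
  "down_legs dual_3 (-18,-18) = []"
  "up_legs dual_3 (-18,-18) = [(-12,-12)]"
  "down_legs dual_3 (6,-6) = [(-12,-12), (18,-18)]"
  "up_legs dual_3 (6,-6) = [(0,12)]"
  "down_legs dual_3 (18,-18) = []"
  "up_legs dual_3 (18,-18) = [(6,-6)]"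
  "down_legs dual_3 (0,12) = [(-12,-12), (6,-6)]"
  "up_legs dual_3 (0,12) = [(0,36)]"
  "down_legs dual_3 (0,36) = [(0,12)]"
  "up_legs dual_3 (0,36) = []"
  unfolding down_legs_def up_legs_def
  by (rule left_to_right_eq; auto simp: lateral_def dual_3_def doubleton_eq_iff)+

text \<open>Every outer edge ends at a boundary point and therefore admits a single state, and
  points of valency 1 have weight 1; only the state \<open>y\<close> of the inner edge is
  summed.\<close>

lemma evaluation_dual_h:
  assumes "range \<tau> \<subseteq> states X"
  shows "evaluation X dual_h \<tau> =
    (\<Sum>y\<in>states X. weight X [\<tau> (-1,-5), \<tau> (2,-4)] [y] * weight X [y] [\<tau> (-2,4), \<tau> (1,5)])"
proof -
  have [simp]: "{s. s = \<tau> v \<and> s \<in> states X} = {\<tau> v}" "{s. s \<in> states X \<and> s = \<tau> v} = {\<tau> v}" for v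
    using assms by auto
  show ?thesis
    unfolding evaluation_eq_PiE Union_dual_h valency_dual_h
    by (simp add: legs_dual_h) (simp add: dual_h_def sum_PiE_insert doubleton_eq_iff algebra_simps)
qed

lemma evaluation_dual_v:
  assumes "range \<tau> \<subseteq> states X"
  shows "evaluation X dual_v \<tau> =
    (\<Sum>z\<in>states X. weight X [\<tau> (2,-4)] [z, \<tau> (1,5)] * weight X [\<tau> (-1,-5), z] [\<tau> (-2,4)])"
proof -
  have [simp]: "{s. s = \<tau> v \<and> s \<in> states X} = {\<tau> v}" "{s. s \<in> states X \<and> s = \<tau> v} = {\<tau> v}" for v
    using assms by auto
  show ?thesis
    unfolding evaluation_eq_PiE Union_dual_v valency_dual_v
    by (simp add: legs_dual_v) (simp add: dual_v_def sum_PiE_insert doubleton_eq_iff algebra_simps)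
qed

lemma evaluation_dual_1:
  assumes "range \<tau> \<subseteq> states X"
  shows "evaluation X dual_1 \<tau> =
    weight X [\<tau> (-18,-18), \<tau> (18,-18)] [\<tau> (0,36)]"
proof -
  have [simp]: "{s. s = \<tau> v \<and> s \<in> states X} = {\<tau> v}" "{s. s \<in> states X \<and> s = \<tau> v} = {\<tau> v}" for v
    using assms by auto
  show ?thesis
    unfolding evaluation_eq_PiE Union_dual_1 valency_dual_1
    by (simp add: legs_dual_1) (simp add: dual_1_def sum_PiE_insert doubleton_eq_iff algebra_simps)
qed

text \<open>The summation variables sit on the sides of the inner triangle: \<open>w\<close> joins
  the two lower vertices, \<open>u\<close> the left and the top one, \<open>z\<close> the right and
  the top one.\<close>

lemma evaluation_dual_3:
  assumes "range \<tau> \<subseteq> states X"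
  shows "evaluation X dual_3 \<tau> =
    (\<Sum>w\<in>states X. \<Sum>u\<in>states X. \<Sum>z\<in>states X.
       weight X [\<tau> (-18,-18)] [u, w] * weight X [w, \<tau> (18,-18)] [z] * weight X [u, z] [\<tau> (0,36)])"
proof -
  have [simp]: "{s. s = \<tau> v \<and> s \<in> states X} = {\<tau> v}" "{s. s \<in> states X \<and> s = \<tau> v} = {\<tau> v}" for v
    using assms by auto
  show ?thesis
    unfolding evaluation_eq_PiE Union_dual_3 valency_dual_3
    by (simp add: legs_dual_3) (simp add: dual_3_def sum_PiE_insert doubleton_eq_iff algebra_simps)
qed

section \<open>The moves as equations between weights\<close>

lemma pachner_diamond:
  "pachner_2_2 diamond_h diamond_v (convex hull {(-6,0), (0,-6), (6,0), (0,6)})"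
proof -
  have "(0,0) \<in> open_segment (-6,0) (6::real,0::real)" "(0,0) \<in> open_segment (0,-6) (0::real,6::real)"
    by (auto intro!: open_segmentI[of "1/2"])
  then have "open_segment (-6,0) (6,0) \<inter> open_segment (0,-6) (0::real,6::real) \<noteq> {}" by blast
  then show ?thesis
    unfolding pachner_2_2_def diamond_h_def diamond_v_def by blast
qed

lemma pachner_triangle: "pachner_1_3 triangle_1 triangle_3 (convex hull {(0,-72), (36,36), (-36,36)})"
proof -
  have "0 < cross (0,-72) (36,36) (-36,36)" by (simp add: cross_def)
  then have "(0,0) \<in> interior (convex hull {(0,-72), (36,36), (-36::real,36::real)})"
    by (simp add: interior_convex_hull_3 cross_def)
  then show ?thesis
    unfolding pachner_1_3_def triangle_1_def triangle_3_def 
    by (intro exI[of _ "(0,-72)"] exI[of _ "(36,36)"] exI[of _ "(-36,36)"] exI[of _ "(0,0)"]) simp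
qed

lemma same_boundary_diamond:
  "\<exists>K. closed K \<and> K \<subseteq> interior (convex hull {(-6,0), (0,-6), (6,0), (0,6)}) \<and>
     drawing dual_h - K = drawing dual_v - K"
proof (intro exI conjI)
  \<comment> \<open>The bounding box of the four trivalent vertices. Outside it only the outer legs
    remain, and these lie on the same four lines in both drawings.\<close>
  let ?K = "{-1..1::real} \<times> {-3..3::real}"
  show "closed ?K" by (intro closed_Times closed_atLeastAtMost)
  have "?K \<subseteq> interior (\<Union>diamond_h)"
    unfolding Union_diamond_h interior_diamond by (auto simp: abs_if)
  also have "\<dots> \<subseteq> interior (convex hull {(-6,0), (0,-6), (6,0), (0,6)})"
    unfolding diamond_h_def by (intro interior_mono) (auto intro: hull_mono[THEN subsetD, rotated])
  finally show "?K \<subseteq> interior (convex hull {(-6,0), (0,-6), (6,0), (0,6)})" .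
  show "drawing dual_h - ?K = drawing dual_v - ?K"
    by (auto simp: mem_drawing_dual_h mem_drawing_dual_v)
qed

lemma same_boundary_triangle:
  "\<exists>K. closed K \<and> K \<subseteq> interior (convex hull {(0,-72), (36,36), (-36,36)}) \<and>
     drawing dual_1 - K = drawing dual_3 - K"
proof (intro exI conjI)
  let ?K = "{-12..6::real} \<times> {-12..12::real}"
  have "0 < cross (0,-72) (36,36) (-36,36)" by (simp add: cross_def)
  then show "?K \<subseteq> interior (convex hull {(0,-72), (36,36), (-36,36)})"
    by (auto simp: interior_convex_hull_3 cross_def)
  show "closed ?K" by (intro closed_Times closed_atLeastAtMost)
  show "drawing dual_1 - ?K = drawing dual_3 - ?K"
    by (auto simp: mem_drawing_dual_1 mem_drawing_dual_3)
qed

lemma interior_vertices_diamond: "interior_vertices diamond_h = {}" "interior_vertices diamond_v = {}"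
  unfolding interior_vertices_def Union_diamond_h Union_diamond_v interior_diamond
  by (auto simp: diamond_h_def diamond_v_def extreme_point_of_convex_hull_3 cross_def)

text \<open>The new vertex (0,0) is the source of the factor \<open>Rc X\<close> in the 1-3
  relation.\<close>

lemma interior_vertices_triangle: "interior_vertices triangle_1 = {}" "interior_vertices triangle_3 = {(0,0)}"
  unfolding interior_vertices_def Union_triangle_1 Union_triangle_3 interior_triangle
  by (auto simp: triangle_1_def triangle_3_def extreme_point_of_convex_hull_3 cross_def)

lemma planar_ssm_2_2:
  assumes X: "planar_ssm X" and S: "a \<in> states X" "b \<in> states X" "c \<in> states X" "d \<in> states X"
  shows "(\<Sum>y\<in>states X. weight X [a, b] [y] * weight X [y] [d, c]) =
    (\<Sum>z\<in>states X. weight X [b] [z, c] * weight X [a, z] [d])"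
proof -
  \<comment> \<open>The four updates prescribe the states at the boundary end points; the default
    \<open>a\<close> keeps the range of \<open>\<tau>\<close> inside the states.\<close>
  define \<tau> :: "plane \<Rightarrow> _" where
    "\<tau> = (\<lambda>_. a)((-1,-5) := a, (2,-4) := b, (1,5) := c, (-2,4) := d)"
  have \<tau>: "range \<tau> \<subseteq> states X" using S by (auto simp: \<tau>_def)
  have "partition_function X diamond_h dual_h \<tau> = partition_function X diamond_v dual_v \<tau>"
    using X \<tau> pachner_diamond triangulated_diamond_h triangulated_diamond_v drawn_dual_h drawn_dual_v
      same_boundary_diamond unfolding planar_ssm_def by blast
  then show ?thesis
    using \<tau> by (simp add: partition_function_def interior_vertices_diamond evaluation_dual_h
        evaluation_dual_v \<tau>_def)
qed

lemma planar_ssm_1_3: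
  assumes X: "planar_ssm X" and S: "a \<in> states X" "b \<in> states X" "c \<in> states X"
  shows "weight X [a, b] [c] = Rc X * (\<Sum>w\<in>states X. \<Sum>u\<in>states X. \<Sum>z\<in>states X.
       weight X [a] [u, w] * weight X [w, b] [z] * weight X [u, z] [c])"
proof -
  define \<tau> :: "plane \<Rightarrow> _" where "\<tau> = (\<lambda>_. a)((-18,-18) := a, (18,-18) := b, (0,36) := c)"
  have \<tau>: "range \<tau> \<subseteq> states X" using S by (auto simp: \<tau>_def)
  have "partition_function X triangle_1 dual_1 \<tau> = partition_function X triangle_3 dual_3 \<tau>"
    using X \<tau> pachner_triangle triangulated_triangle_1 triangulated_triangle_3 drawn_dual_1 drawn_dual_3
      same_boundary_triangle unfolding planar_ssm_def by blast
  then show ?thesis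
    using \<tau> by (simp add: partition_function_def interior_vertices_triangle evaluation_dual_1
        evaluation_dual_3 \<tau>_def del: weight.simps)
qed

section \<open>Algebras and their corners\<close>

locale assoc_alg = vector_space scale
  for scale :: "'k::field \<Rightarrow> 'v::ab_group_add \<Rightarrow> 'v" (infixr \<open>\<star>\<close> 75) +
  fixes mult :: "'v \<Rightarrow> 'v \<Rightarrow> 'v" (infixl \<open>\<odot>\<close> 70)
  assumes add_mult: "(x + y) \<odot> z = x \<odot> z + y \<odot> z"
    and mult_add: "x \<odot> (y + z) = x \<odot> y + x \<odot> z"
    and scale_mult: "(c \<star> x) \<odot> y = c \<star> (x \<odot> y)"
    and mult_scale: "x \<odot> (c \<star> y) = c \<star> (x \<odot> y)"
    and mult_assoc: "(x \<odot> y) \<odot> z = x \<odot> (y \<odot> z)"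
begin

lemma zero_mult [simp]: "0 \<odot> x = 0" and mult_zero [simp]: "x \<odot> 0 = 0"
  using scale_mult[of 0 0 x] mult_scale[of x 0 0] by simp_all

lemma uminus_mult: "(- x) \<odot> y = - (x \<odot> y)" and mult_uminus: "x \<odot> (- y) = - (x \<odot> y)"
  using scale_mult[of "-1" x y] mult_scale[of x "-1" y] by simp_all

lemma diff_mult: "(x - y) \<odot> z = x \<odot> z - y \<odot> z" and mult_diff: "x \<odot> (y - z) = x \<odot> y - x \<odot> z"
  using add_mult[of x "-y" z] mult_add[of x y "-z"] by (simp_all add: uminus_mult mult_uminus)

lemma sum_mult: "sum f I \<odot> y = (\<Sum>i\<in>I. f i \<odot> y)"
  by (induction I rule: infinite_finite_induct) (simp_all add: add_mult)

lemma mult_sum: "y \<odot> sum f I = (\<Sum>i\<in>I. y \<odot> f i)"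
  by (induction I rule: infinite_finite_induct) (simp_all add: mult_add)

lemmas bilinear = add_mult mult_add scale_mult mult_scale uminus_mult mult_uminus diff_mult mult_diff

text \<open>For an idempotent \<open>p\<close> this is the Peirce corner \<open>p A p\<close>, a
  unital algebra with identity \<open>p\<close>. Subalgebras with different identities are thus
  handled inside one ambient product.\<close>

definition corner :: "'v \<Rightarrow> 'v set" where
  "corner p = {x. p \<odot> x = x \<and> x \<odot> p = x}"

lemma corner_closed:
  "0 \<in> corner p"
  "x \<in> corner p \<Longrightarrow> y \<in> corner p \<Longrightarrow> x + y \<in> corner p"
  "x \<in> corner p \<Longrightarrow> y \<in> corner p \<Longrightarrow> x - y \<in> corner p"
  "x \<in> corner p \<Longrightarrow> c \<star> x \<in> corner p"
  "x \<in> corner p \<Longrightarrow> y \<in> corner p \<Longrightarrow> x \<odot> y \<in> corner p"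
  by (auto simp: corner_def bilinear mult_assoc) (metis mult_assoc)

lemma corner_unit: "x \<in> corner p \<Longrightarrow> p \<odot> x = x" "x \<in> corner p \<Longrightarrow> x \<odot> p = x"
  by (simp_all add: corner_def)

definition corner_iso :: "'v \<Rightarrow> ('k \<Rightarrow> 'd::ring_1 \<Rightarrow> 'd) \<Rightarrow> 'd set \<Rightarrow> ('v \<Rightarrow> 'd) \<Rightarrow> bool" where
  "corner_iso p smul D \<psi> \<longleftrightarrow> bij_betw \<psi> (corner p) D \<and> \<psi> p = 1 \<and>
     (\<forall>x\<in>corner p. \<forall>y\<in>corner p. \<psi> (x + y) = \<psi> x + \<psi> y \<and> \<psi> (x \<odot> y) = \<psi> x * \<psi> y) \<and>
     (\<forall>c. \<forall>x\<in>corner p. \<psi> (c \<star> x) = smul c (\<psi> x))"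

text \<open>The natural maps go from the division algebra into the corner, by linear combinations of
  \<open>p\<close> and imaginary units, whereas matrix entries require the opposite
  direction.\<close>

lemma corner_iso_inverse:
  assumes bij: "bij_betw \<theta> D (corner p)" and one: "\<theta> 1 = p" "1 \<in> D"
    and hom: "\<And>q r. q \<in> D \<Longrightarrow> r \<in> D \<Longrightarrow> \<theta> (q + r) = \<theta> q + \<theta> r \<and> \<theta> (q * r) = \<theta> q \<odot> \<theta> r"
      "\<And>c q. q \<in> D \<Longrightarrow> \<theta> (smul c q) = c \<star> \<theta> q"
    and closed: "\<And>q r. q \<in> D \<Longrightarrow> r \<in> D \<Longrightarrow> q + r \<in> D \<and> q * r \<in> D" "\<And>c q. q \<in> D \<Longrightarrow> smul c q \<in> D"
  shows "corner_iso p smul D (inv_into D \<theta>)"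
  unfolding corner_iso_def
proof (intro conjI ballI allI)
  have inj: "inj_on \<theta> D" and im: "\<theta> ` D = corner p" using bij by (auto simp: bij_betw_def)
  have inv: "inv_into D \<theta> x = q" if "\<theta> q = x" "q \<in> D" for x q using that inj by auto
  show "bij_betw (inv_into D \<theta>) (corner p) D" using bij by (rule bij_betw_inv_into)
  show "inv_into D \<theta> p = 1" using one by (intro inv)
  fix x assume "x \<in> corner p"
  then obtain q where q: "q \<in> D" "x = \<theta> q" using im by blast
  show "inv_into D \<theta> (c \<star> x) = smul c (inv_into D \<theta> x)" for c
    using q inv[of q x] by (intro inv) (auto simp: hom closed)
  fix y assume "y \<in> corner p"
  then obtain r where r: "r \<in> D" "y = \<theta> r" using im by blast
  show "inv_into D \<theta> (x + y) = inv_into D \<theta> x + inv_into D \<theta> y"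
    "inv_into D \<theta> (x \<odot> y) = inv_into D \<theta> x * inv_into D \<theta> y"
    using q r inv[of q x] inv[of r y] hom(1)[of q r] closed(1)[of q r] by (auto intro!: inv)
qed

lemma subspace_corner: "subspace (corner p)"
  by (intro subspaceI) (auto intro: corner_closed)

definition division_corner :: "'v \<Rightarrow> bool" where
  "division_corner p \<longleftrightarrow> p \<noteq> 0 \<and> p \<odot> p = p \<and>
     (\<forall>x\<in>corner p. x \<noteq> 0 \<longrightarrow> (\<exists>y\<in>corner p. x \<odot> y = p \<and> y \<odot> x = p))"

lemma division_corner_unit_mem: "division_corner p \<Longrightarrow> p \<in> corner p"
  by (simp add: division_corner_def corner_def)

lemma division_corner_no_zero_divisors:
  assumes "division_corner p" "x \<in> corner p" "y \<in> corner p" "x \<odot> y = 0"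
  shows "x = 0 \<or> y = 0"
proof (rule ccontr)
  assume *: "\<not> (x = 0 \<or> y = 0)"
  then obtain z where "z \<odot> x = p" using assms unfolding division_corner_def by blast
  then have "p \<odot> y = z \<odot> (x \<odot> y)" by (simp add: mult_assoc[symmetric])
  then show False using * assms corner_unit by simp
qed

section \<open>Polynomials in an element of a corner\<close>

definition poly_at :: "'v \<Rightarrow> 'v \<Rightarrow> 'k poly \<Rightarrow> 'v" where
  "poly_at p x q = fold_coeffs (\<lambda>c v. c \<star> p + x \<odot> v) q 0"

lemma poly_at_0 [simp]: "poly_at p x 0 = 0"
  by (simp add: poly_at_def)

lemma poly_at_pCons [simp]: "poly_at p x (pCons c q) = c \<star> p + x \<odot> poly_at p x q"
  by (cases "c = 0 \<and> q = 0") (auto simp: poly_at_def)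

lemma poly_at_add: "poly_at p x (q + r) = poly_at p x q + poly_at p x r"
proof (induction q arbitrary: r)
  case (pCons a q)
  obtain b r' where "r = pCons b r'" by (cases r)
  then show ?case
    using pCons.IH[of r'] by (simp add: scale_left_distrib mult_add add_ac)
qed simp

lemma poly_at_smult: "poly_at p x (smult c q) = c \<star> poly_at p x q"
  by (induction q) (simp_all add: scale_right_distrib mult_scale)

lemma poly_at_diff: "poly_at p x (q - r) = poly_at p x q - poly_at p x r"
  using poly_at_add[of p x "q - r" r] by (simp add: algebra_simps)

lemma poly_at_sum: "poly_at p x (sum f I) = (\<Sum>i\<in>I. poly_at p x (f i))"
  by (induction I rule: infinite_finite_induct) (simp_all add: poly_at_add)

lemma poly_at_mem:
  assumes "p \<in> corner p" "x \<in> corner p" shows "poly_at p x q \<in> corner p"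
  by (induction q) (auto intro!: corner_closed assms)

text \<open>Constants are evaluated as multiples of \<open>p\<close>; membership in the corner is
  what makes \<open>p\<close> act as the identity on the values.\<close>

lemma poly_at_mult:
  assumes "p \<in> corner p" "x \<in> corner p"
  shows "poly_at p x (q * r) = poly_at p x q \<odot> poly_at p x r"
  by (induction q)
    (simp_all add: poly_at_add poly_at_smult bilinear mult_assoc poly_at_mem assms corner_unit)

text \<open>The powers of \<open>x\<close> with exponents up to \<open>card B\<close> are one more
  than the span of \<open>B\<close> allows to be independent.\<close>

lemma exists_annihilating_poly:
  assumes p: "p \<in> corner p" and x: "x \<in> corner p" and B: "finite B" "corner p \<subseteq> span B"
  shows "\<exists>q. q \<noteq> 0 \<and> poly_at p x q = 0"
proof -
  let ?f = "\<lambda>n. poly_at p x (monom 1 n)"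
  let ?I = "{..card B}"
  have sub: "?f ` ?I \<subseteq> span B" using poly_at_mem[OF p x] B by blast
  show ?thesis
  \<comment> \<open>Dependence is a notion for sets, so coinciding powers are treated apart: the
    difference of two monomials then annihilates \<open>x\<close>.\<close>
  proof (cases "inj_on ?f ?I")
    case False
    then obtain m n where "m \<noteq> n" "?f m = ?f n" unfolding inj_on_def by blast
    then have "poly_at p x (monom 1 m - monom 1 n) = 0" "monom 1 m - monom 1 n \<noteq> (0 :: 'k poly)"
      by (auto simp: poly_at_diff monom_eq_iff')
    then show ?thesis by blast
  next
    case True
    have "dependent (?f ` ?I)"
    proof (rule ccontr)
      assume "\<not> dependent (?f ` ?I)"
      then have "card (?f ` ?I) \<le> card B" using independent_span_bound[OF B(1)] sub by blast
      then show False using card_image[OF True] by simp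
    qed
    then obtain u v where u: "(\<Sum>v\<in>?f ` ?I. u v \<star> v) = 0" and v: "v \<in> ?f ` ?I" "u v \<noteq> 0"
      unfolding dependent_finite[OF finite_imageI[OF finite_atMost]] by blast
    define q where "q = (\<Sum>i\<in>?I. smult (u (?f i)) (monom 1 i))"
    have "poly_at p x q = (\<Sum>i\<in>?I. u (?f i) \<star> ?f i)"
      by (simp add: q_def poly_at_sum poly_at_smult)
    also have "\<dots> = 0" using u by (simp add: sum.reindex[OF True])
    finally have "poly_at p x q = 0" .
    moreover obtain i where "i \<in> ?I" "u (?f i) \<noteq> 0" using v by blast
    then have "coeff q i \<noteq> 0"
      by (simp add: q_def coeff_sum if_distrib cong: if_cong)
    then have "q \<noteq> 0" by auto
    ultimately show ?thesis by blast
  qed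
qed

end

section \<open>Division corners over the complex numbers\<close>

locale complex_assoc_alg = assoc_alg scale mult
  for scale :: "complex \<Rightarrow> 'v::ab_group_add \<Rightarrow> 'v" (infixr \<open>\<star>\<close> 75) and mult (infixl \<open>\<odot>\<close> 70)
begin

text \<open>A root \<open>z\<close> of \<open>q\<close> splits off the factor
  \<open>x - z p\<close>. Without zero divisors either this factor vanishes or the cofactor, of
  smaller degree, annihilates \<open>x\<close> as well.\<close>

lemma poly_at_root:
  assumes p: "division_corner p" and x: "x \<in> corner p" and q: "q \<noteq> 0" "poly_at p x q = 0"
  shows "\<exists>c. x = c \<star> p"
  using q
proof (induction "degree q" arbitrary: q rule: less_induct)
  case less
  note pc = division_corner_unit_mem[OF p]
  show ?case
  proof (cases "degree q = 0")
    case True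
    then obtain c where "q = [:c:]" by (rule degree_eq_zeroE)
    then have "c \<star> p = 0" "c \<noteq> 0" using less.prems by auto
    then show ?thesis using p by (simp add: division_corner_def)
  next
    case False
    then have "\<not> constant (poly q)" by (simp add: constant_degree)
    then obtain z where "poly q z = 0" using fundamental_theorem_of_algebra by blast
    then obtain r where r: "q = [:-z, 1:] * r" by (auto simp: poly_eq_0_iff_dvd dvd_def)
    have "(x - z \<star> p) \<odot> poly_at p x r = 0"
      using less.prems(2) unfolding r poly_at_mult[OF pc x] by (simp add: corner_unit x)
    moreover have "x - z \<star> p \<in> corner p" by (intro corner_closed x pc)
    ultimately consider "x - z \<star> p = 0" | "poly_at p x r = 0"
      using division_corner_no_zero_divisors[OF p] poly_at_mem[OF pc x] by blast
    then show ?thesis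
    proof cases
      case 2
      have "r \<noteq> 0" using r less.prems by auto
      moreover then have "degree r < degree q" unfolding r by (subst degree_mult_eq) auto
      ultimately show ?thesis using less.hyps 2 by blast
    qed auto
  qed
qed

lemma division_corner_eq:
  assumes "division_corner p" "finite B" "corner p \<subseteq> span B" "x \<in> corner p"
  shows "\<exists>c. x = c \<star> p"
  using poly_at_root[OF assms(1,4)] exists_annihilating_poly[OF division_corner_unit_mem]
    assms by blast

end

text \<open>A complex root \<open>z\<close> exists. If it is not real, the remainder of
  \<open>q\<close> modulo the quadratic with roots \<open>z\<close> and its conjugate has degree at
  most 1 and vanishes at \<open>z\<close>, so both of its real coefficients are 0. The complex
  numbers are regarded as a real algebra in order to evaluate real polynomials with
  \<open>poly_at\<close>.\<close>

lemma real_poly_root_factor: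
  fixes q :: "real poly"
  assumes "degree q \<noteq> 0"
  shows "(\<exists>a. [:-a, 1:] dvd q) \<or> (\<exists>a b. [:a\<^sup>2 + b\<^sup>2, - 2 * a, 1:] dvd q)"
proof -
  interpret cplx: assoc_alg "scaleR :: real \<Rightarrow> complex \<Rightarrow> complex" "(*)"
    by unfold_locales (simp_all add: algebra_simps)
  let ?h = "map_poly complex_of_real"
  have poly_at: "poly (?h r) z = cplx.poly_at 1 z r" for r z
    by (induction r) (simp_all add: map_poly_pCons of_real_def)
  have mem: "z \<in> cplx.corner 1" for z by (simp add: cplx.corner_def)
  have "degree (?h q) \<noteq> 0" using assms by (simp add: degree_map_poly)
  then have "\<not> constant (poly (?h q))" by (simp add: constant_degree)
  then obtain z where z: "cplx.poly_at 1 z q = 0"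
    using fundamental_theorem_of_algebra poly_at by metis
  show ?thesis
  proof (cases "Im z = 0")
    case True
    have "poly (?h r) (of_real x) = of_real (poly r x)" for r x
      by (induction r) (simp_all add: map_poly_pCons)
    moreover have "z = of_real (Re z)" using True by (simp add: complex_eq_iff)
    ultimately have "poly q (Re z) = 0" using z by (metis poly_at of_real_eq_0_iff)
    then show ?thesis by (auto simp: poly_eq_0_iff_dvd)
  next
    case False
    \<comment> \<open>The product of \<open>X - z\<close> and \<open>X - cnj z\<close>.\<close>
    define d where "d = [:(Re z)\<^sup>2 + (Im z)\<^sup>2, - 2 * Re z, 1:]"
    have d: "cplx.poly_at 1 z d = 0"
      by (simp add: d_def complex_eq_iff power2_eq_square algebra_simps)
    have "d \<noteq> 0" "degree d = 2" by (simp_all add: d_def)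
    then have "q mod d = 0 \<or> degree (q mod d) < 2" using degree_mod_less[of d q] by simp
    then have "degree (q mod d) \<le> 1" by auto
    then have q: "q mod d = [:coeff (q mod d) 0, coeff (q mod d) 1:]"
      by (intro poly_eqI) (auto simp: coeff_pCons coeff_eq_0 split: nat.split)
    have "cplx.poly_at 1 z (d * (q div d) + q mod d) = 0" using z by simp
    then have "cplx.poly_at 1 z (q mod d) = 0"
      unfolding cplx.poly_at_add cplx.poly_at_mult[OF mem mem] d by simp
    then have "coeff (q mod d) 0 = 0 \<and> coeff (q mod d) 1 = 0"
      using False by (subst (asm) q) (auto simp: complex_eq_iff)
    then have "d dvd q" using q by (simp add: dvd_eq_mod_eq_0)
    then show ?thesis unfolding d_def by blast
  qed
qed


section \<open>Division corners over the reals and Frobenius' theorem\<close>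

locale real_assoc_alg = assoc_alg scale mult
  for scale :: "real \<Rightarrow> 'v::ab_group_add \<Rightarrow> 'v" (infixr \<open>\<star>\<close> 75) and mult (infixl \<open>\<odot>\<close> 70)
begin

text \<open>Real factors of the annihilating polynomial are cancelled until one of them annihilates
  \<open>x\<close>. A linear factor gives the equation with \<open>b = 0\<close>; a quadratic one
  has the form \<open>(X - a)^2 + b^2\<close>.\<close>

lemma poly_at_quadratic:
  assumes p: "division_corner p" and x: "x \<in> corner p" and q: "q \<noteq> 0" "poly_at p x q = 0"
  shows "\<exists>a b. (x - a \<star> p) \<odot> (x - a \<star> p) = - b\<^sup>2 \<star> p"
  using q
proof (induction "degree q" arbitrary: q rule: less_induct)
  case less
  note pc = division_corner_unit_mem[OF p]
  \<comment> \<open>A factor that does not annihilate \<open>x\<close> can be cancelled, because the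
    corner has no zero divisors.\<close>
  have descend: ?case if q: "q = d * r" and d: "poly_at p x d \<noteq> 0" "degree d > 0" for d r
  proof -
    have "poly_at p x d \<odot> poly_at p x r = 0"
      using less.prems(2) unfolding q poly_at_mult[OF pc x] .
    then have "poly_at p x r = 0"
      using division_corner_no_zero_divisors[OF p] poly_at_mem[OF pc x] d by blast
    moreover have "r \<noteq> 0" "d \<noteq> 0" using q less.prems by auto
    moreover then have "degree r < degree q" unfolding q using d by (subst degree_mult_eq) auto
    ultimately show ?thesis using less.hyps by blast
  qed
  have xx: "(x - a \<star> p) \<odot> (x - a \<star> p) = x \<odot> x - (2 * a) \<star> x + a\<^sup>2 \<star> p" for a
    using p x by (simp add: bilinear corner_def division_corner_def algebra_simps power2_eq_square
        flip: scale_left_distrib)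
  show ?case
  proof (cases "degree q = 0")
    case True
    then obtain c where "q = [:c:]" by (rule degree_eq_zeroE)
    then have "c \<star> p = 0" "c \<noteq> 0" using less.prems by auto
    then show ?thesis using p by (simp add: division_corner_def)
  next
    case False
    consider a r where "q = [:-a, 1:] * r" | a b r where "q = [:a\<^sup>2 + b\<^sup>2, - 2 * a, 1:] * r"
      using real_poly_root_factor[OF False] by (auto simp: dvd_def)
    then show ?thesis
    proof cases
      case (1 a r)
      have "poly_at p x [:-a, 1:] = x - a \<star> p" using x by (simp add: corner_unit)
      moreover have ?thesis if "x - a \<star> p = 0"
        by (intro exI[of _ a] exI[of _ 0]) (simp only: that, simp)
      ultimately show ?thesis using descend[OF 1] by fastforce
    next
      case (2 a b r)
      have "poly_at p x [:a\<^sup>2 + b\<^sup>2, - 2 * a, 1:] = (x - a \<star> p) \<odot> (x - a \<star> p) + b\<^sup>2 \<star> p"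
        unfolding xx using x by (simp add: corner_unit mult_diff mult_add mult_scale mult_uminus
            scale_left_distrib algebra_simps)
      then show ?thesis
        using descend[OF 2] by (cases "(x - a \<star> p) \<odot> (x - a \<star> p) + b\<^sup>2 \<star> p = 0")
          (auto simp: eq_neg_iff_add_eq_0)
    qed
  qed
qed

lemma division_corner_quadratic:
  assumes "division_corner p" "finite B" "corner p \<subseteq> span B" "x \<in> corner p"
  shows "\<exists>a b. (x - a \<star> p) \<odot> (x - a \<star> p) = - b\<^sup>2 \<star> p"
  using poly_at_quadratic[OF assms(1,4)] exists_annihilating_poly[OF division_corner_unit_mem]
    assms by blast

text \<open>The linear map sending the quaternion units to \<open>p\<close>, \<open>i\<close>,
  \<open>j\<close> and \<open>i \<odot> j\<close>. With \<open>i = j = 0\<close> or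
  \<open>j = 0\<close> it also serves the copies of the reals and the complex numbers in the
  quaternions.\<close>

definition of_quat :: "'v \<Rightarrow> 'v \<Rightarrow> 'v \<Rightarrow> quat \<Rightarrow> 'v" where
  "of_quat p i j q = Qre q \<star> p + Qi q \<star> i + Qj q \<star> j + Qk q \<star> (i \<odot> j)"

lemma of_quat_linear:
  "of_quat p i j (q + r) = of_quat p i j q + of_quat p i j r"
  "of_quat p i j (c *\<^sub>R q) = c \<star> of_quat p i j q"
  by (simp_all add: of_quat_def plus_quat_def scaleR_quat_def scale_left_distrib
      scale_right_distrib algebra_simps)

text \<open>The three relations determine the whole multiplication table of \<open>i\<close>,
  \<open>j\<close> and \<open>k = i \<odot> j\<close>, which is derived before comparing
  coefficients.\<close>

lemma of_quat_mult:
  assumes mem: "p \<odot> p = p" "i \<in> corner p" "j \<in> corner p"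
    and rel: "i \<odot> i = - p" "j \<odot> j = - p" "j \<odot> i = - (i \<odot> j)"
  shows "of_quat p i j (q * r) = of_quat p i j q \<odot> of_quat p i j r"
proof -
  define k where "k = i \<odot> j"
  have k: "k \<in> corner p" unfolding k_def by (intro corner_closed mem)
  have ik: "i \<odot> k = - j"
    using mem rel by (simp add: k_def uminus_mult corner_unit flip: mult_assoc)
  have jk: "j \<odot> k = i"
    using mem rel by (simp add: k_def uminus_mult corner_unit mult_uminus mult_assoc flip: mult_assoc[of j])
  have ki: "k \<odot> i = j" using ik rel by (simp add: k_def mult_assoc mult_uminus)
  have kj: "k \<odot> j = - i" using mem rel by (simp add: k_def mult_assoc mult_uminus corner_unit)
  have kk: "k \<odot> k = - p" using jk rel by (simp add: k_def mult_assoc)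
  note units = mem(1) corner_unit[OF mem(2)] corner_unit[OF mem(3)] corner_unit[OF k]
  show ?thesis
    unfolding of_quat_def k_def[symmetric]
    by (simp add: times_quat_def bilinear units rel ik jk ki kj kk k_def[symmetric]
        scale_left_distrib scale_left_diff_distrib scale_right_distrib scale_right_diff_distrib algebra_simps)
qed

text \<open>A nonzero quaternion is invertible, so if one were sent to 0, multiplicativity would
  give \<open>p = 0\<close>.\<close>

lemma inj_of_quat:
  assumes mem: "p \<noteq> 0" "p \<odot> p = p" "i \<in> corner p" "j \<in> corner p"
    and rel: "i \<odot> i = - p" "j \<odot> j = - p" "j \<odot> i = - (i \<odot> j)"
  shows "inj (of_quat p i j)"
proof (rule injI)
  fix q r assume "of_quat p i j q = of_quat p i j r"
  then have 0: "of_quat p i j (q - r) = 0"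
    using of_quat_linear(1)[of p i j "q - r" r] by simp
  show "q = r"
  proof (rule ccontr)
    assume "q \<noteq> r"
    then have "of_quat p i j 1 = of_quat p i j (q - r) \<odot> of_quat p i j (inverse (q - r))"
      using of_quat_mult[OF mem(2-) rel, of "q - r" "inverse (q - r)"] by simp
    then show False using mem(1) 0 by (simp add: of_quat_def one_quat_def)
  qed
qed

text \<open>The element \<open>y = x - a p\<close> commutes with \<open>i\<close>, and
  \<open>y^2 = - b^2 p\<close> is the square of \<open>b i\<close>. Hence
  \<open>(y - b i) (y + b i) = 0\<close>, and one factor vanishes.\<close>

lemma commutes_with_imaginary_unit:
  assumes p: "division_corner p" "finite B" "corner p \<subseteq> span B"
    and i: "i \<in> corner p" "i \<odot> i = - p" and x: "x \<in> corner p" "x \<odot> i = i \<odot> x"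
  shows "\<exists>s t. x = s \<star> p + t \<star> i"
proof -
  obtain a b where ab: "(x - a \<star> p) \<odot> (x - a \<star> p) = - b\<^sup>2 \<star> p"
    using division_corner_quadratic[OF p x(1)] by blast
  note pc = division_corner_unit_mem[OF p(1)]
  let ?y = "x - a \<star> p"
  have yi: "?y \<odot> i = i \<odot> ?y" using x i by (simp add: bilinear corner_unit)
  have "(y - b \<star> i) \<odot> (y + b \<star> i) = y \<odot> y + b \<star> (y \<odot> i) - b \<star> (i \<odot> y) - (b * b) \<star> (i \<odot> i)"
    for y by (simp add: bilinear algebra_simps)
  from this[of ?y] have "(?y - b \<star> i) \<odot> (?y + b \<star> i) = ?y \<odot> ?y - (b * b) \<star> (i \<odot> i)"
    unfolding yi by simp
  also have "\<dots> = 0" unfolding ab i by (simp add: power2_eq_square)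
  finally have "(?y - b \<star> i) \<odot> (?y + b \<star> i) = 0" .
  moreover have "?y - b \<star> i \<in> corner p" "?y + b \<star> i \<in> corner p"
    by (intro corner_closed x i pc)+
  ultimately consider "?y - b \<star> i = 0" | "?y + b \<star> i = 0"
    using division_corner_no_zero_divisors[OF p(1)] by blast
  then show ?thesis
  proof cases
    case 1
    then have "x = a \<star> p + b \<star> i" by (simp add: algebra_simps)
    then show ?thesis by blast
  next
    case 2
    then have "x = a \<star> p + (- b) \<star> i" by (simp add: algebra_simps eq_neg_iff_add_eq_0)
    then show ?thesis by blast
  qed
qed

text \<open>If \<open>b\<close> were 0, then \<open>x - a p\<close> would have square 0 and hence
  vanish, making \<open>x\<close> a multiple of \<open>p\<close>.\<close>

lemma exists_imaginary_unit:
  assumes p: "division_corner p" and x: "x \<in> corner p" "\<And>a. x \<noteq> a \<star> p"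
    and q: "(x - a \<star> p) \<odot> (x - a \<star> p) = - b\<^sup>2 \<star> p"
  shows "b \<noteq> 0" "(inverse b \<star> (x - a \<star> p)) \<odot> (inverse b \<star> (x - a \<star> p)) = - p"
proof -
  have mem: "x - a \<star> p \<in> corner p" by (intro corner_closed x division_corner_unit_mem[OF p])
  show "b \<noteq> 0"
  proof
    assume "b = 0"
    then have "x - a \<star> p = 0" using division_corner_no_zero_divisors[OF p mem mem] q by auto
    then show False using x(2)[of a] by simp
  qed
  then show "(inverse b \<star> (x - a \<star> p)) \<odot> (inverse b \<star> (x - a \<star> p)) = - p"
    by (simp only: scale_mult mult_scale q) (simp add: power2_eq_square field_simps)
qed

text \<open>
  Frobenius: once \<open>i\<^sup>2 = -1\<close> in \<open>D\<close>, the elements commuting with \<open>i\<close> form \<open>\<real> + \<real>i\<close>; if some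
  \<open>j\<close> anticommutes with \<open>i\<close>, then it may be scaled to satisfy \<open>j\<^sup>2 = -1\<close>, and
  right multiplication by \<open>j\<close> takes the anticommuting elements into the commuting ones.
\<close>

theorem division_corner_classification:
  assumes p: "division_corner p" "finite B" "corner p \<subseteq> span B"
  shows "\<exists>c \<psi>. corner_iso p (*\<^sub>R) (division_ring_of c) \<psi>"
proof -
  note pc = division_corner_unit_mem[OF p(1)]
  have p0: "p \<noteq> 0" and pp: "p \<odot> p = p" using p(1) by (auto simp: division_corner_def)
  note quadratic = division_corner_quadratic[OF p]
  show ?thesis
  proof (cases "\<forall>x\<in>corner p. \<exists>a. x = a \<star> p")
    case True
    have "bij_betw (of_quat p 0 0) (division_ring_of RealD) (corner p)"
    proof (rule bij_betw_imageI)
      show "inj_on (of_quat p 0 0) (division_ring_of RealD)"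
        using p0 by (auto simp: inj_on_def of_quat_def of_real_def scaleR_quat_def one_quat_def)
      show "of_quat p 0 0 ` division_ring_of RealD = corner p"
        using True by (force simp: image_image of_quat_def of_real_def scaleR_quat_def one_quat_def
            intro: corner_closed pc)
    qed
    then have "corner_iso p (*\<^sub>R) (division_ring_of RealD) (inv_into (division_ring_of RealD) (of_quat p 0 0))"
      by (rule corner_iso_inverse)
        (auto simp: of_quat_linear, auto simp: of_quat_def of_real_def scaleR_quat_def one_quat_def
          times_quat_def plus_quat_def bilinear pp image_iff)
    then show ?thesis by blast
  next
    case False
    then obtain x where x: "x \<in> corner p" "\<And>a. x \<noteq> a \<star> p" by blast
    obtain a b where ab: "(x - a \<star> p) \<odot> (x - a \<star> p) = - b\<^sup>2 \<star> p" using quadratic[OF x(1)] by blast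
    define i where "i = inverse b \<star> (x - a \<star> p)"
    have i: "i \<in> corner p" "i \<odot> i = - p"
      using exists_imaginary_unit[OF p(1) x ab] by (auto simp: i_def intro!: corner_closed x pc)
    note commuting = commutes_with_imaginary_unit[OF p i]
    have i_i: "i \<odot> (i \<odot> y) = - y" "y \<odot> i \<odot> i = - y" if "y \<in> corner p" for y
      using that i by (simp_all add: uminus_mult mult_uminus corner_unit mult_assoc flip: mult_assoc[of i i])
    show ?thesis
    proof (cases "\<forall>y\<in>corner p. y \<odot> i = - (i \<odot> y) \<longrightarrow> y = 0")
      case True
      have all: "\<exists>s t. y = s \<star> p + t \<star> i" if y: "y \<in> corner p" for y
      proof -
        \<comment> \<open>Up to the factor 2 this is the part of \<open>y\<close> anticommuting with
          \<open>i\<close>. It vanishes by assumption, and multiplying by \<open>i\<close> from the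
          left shows that \<open>y\<close> commutes with \<open>i\<close>.\<close>
        have "y + i \<odot> y \<odot> i \<in> corner p" by (intro corner_closed y i)
        moreover have "(y + i \<odot> y \<odot> i) \<odot> i = - (i \<odot> (y + i \<odot> y \<odot> i))"
          using y i by (simp add: bilinear corner_unit i_i corner_closed mult_assoc)
        ultimately have "y + i \<odot> y \<odot> i = 0" using True by blast
        then have "i \<odot> (y + i \<odot> y \<odot> i) = 0" by simp
        then have "y \<odot> i = i \<odot> y" using y i by (simp add: bilinear i_i corner_closed corner_unit mult_assoc)
        then show ?thesis by (rule commuting[OF y])
      qed
      let ?\<theta> = "of_quat p i 0"
      have indep: "s = 0 \<and> t = 0" if "s \<star> p + t \<star> i = 0" for s t
      proof -
        have "s \<star> p = - (t \<star> i)" using that by (simp add: eq_neg_iff_add_eq_0)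
        then have "(s \<star> p) \<odot> (s \<star> p) = (t \<star> i) \<odot> (t \<star> i)" by (simp add: bilinear)
        then have "(s * s + t * t) \<star> p = 0" by (simp add: bilinear pp i scale_left_distrib)
        then show ?thesis using p0 by (simp add: sum_squares_eq_zero_iff)
      qed
      have "bij_betw ?\<theta> (division_ring_of ComplexD) (corner p)"
      proof (rule bij_betw_imageI)
        show "inj_on ?\<theta> (division_ring_of ComplexD)"
        proof (rule inj_onI)
          fix q r assume "q \<in> division_ring_of ComplexD" "r \<in> division_ring_of ComplexD" "?\<theta> q = ?\<theta> r"
          then show "q = r" using indep[of "Qre q - Qre r" "Qi q - Qi r"]
            by (auto simp: of_quat_def quat_of_complex_def scale_left_diff_distrib algebra_simps complex_eq_iff)
        qed
        show "?\<theta> ` division_ring_of ComplexD = corner p"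
        proof (intro equalityI subsetI)
          fix y assume "y \<in> corner p"
          then obtain s t where "y = s \<star> p + t \<star> i" using all by blast
          then have "y = ?\<theta> (quat_of_complex (Complex s t))"
            by (simp add: of_quat_def quat_of_complex_def)
          then show "y \<in> ?\<theta> ` division_ring_of ComplexD" by simp
        qed (auto simp: of_quat_def quat_of_complex_def intro!: corner_closed pc i)
      qed
      then have "corner_iso p (*\<^sub>R) (division_ring_of ComplexD) (inv_into (division_ring_of ComplexD) ?\<theta>)"
      proof (rule corner_iso_inverse)
        show "?\<theta> 1 = p" by (simp add: of_quat_def one_quat_def)
        show "1 \<in> division_ring_of ComplexD" using quat_of_complex_hom(4) by (auto simp: image_iff)
      next
        fix c q r assume "q \<in> division_ring_of ComplexD" "r \<in> division_ring_of ComplexD"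
        then obtain z w where zw: "q = quat_of_complex z" "r = quat_of_complex w" by auto
        show "?\<theta> (q + r) = ?\<theta> q + ?\<theta> r \<and> ?\<theta> (q * r) = ?\<theta> q \<odot> ?\<theta> r"
          unfolding of_quat_linear
          by (simp add: zw of_quat_def quat_of_complex_def times_quat_def bilinear pp i
              corner_unit scale_left_distrib scale_left_diff_distrib scale_right_distrib algebra_simps)
        show "q + r \<in> division_ring_of ComplexD \<and> q * r \<in> division_ring_of ComplexD"
          unfolding zw by (simp flip: quat_of_complex_hom)
      next
        fix c q assume "q \<in> division_ring_of ComplexD"
        then show "c *\<^sub>R q \<in> division_ring_of ComplexD" by (auto simp flip: quat_of_complex_hom)
      qed (rule of_quat_linear)
      then show ?thesis by blast
    next
      case False
      then obtain y where y: "y \<in> corner p" "y \<odot> i = - (i \<odot> y)" "y \<noteq> 0" by blast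
      obtain a b where ab: "(y - a \<star> p) \<odot> (y - a \<star> p) = - b\<^sup>2 \<star> p" using quadratic[OF y(1)] by blast
      have yyi: "y \<odot> y \<odot> i = i \<odot> (y \<odot> y)"
        by (simp add: mult_assoc y mult_uminus) (simp add: y uminus_mult flip: mult_assoc)
      \<comment> \<open>The right-hand side commutes with \<open>i\<close>, while \<open>y\<close>
        anticommutes with it; therefore \<open>a = 0\<close>, and \<open>y\<close> is purely
        imaginary.\<close>
      have "(2 * a) \<star> y = y \<odot> y + (a\<^sup>2 + b\<^sup>2) \<star> p"
        using ab y pp by (simp add: bilinear corner_unit power2_eq_square scale_left_distrib algebra_simps
          flip: scale_left_distrib)
      then have "((2 * a) \<star> y) \<odot> i = i \<odot> ((2 * a) \<star> y)"
        using yyi i by (simp only:) (simp add: bilinear corner_unit)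
      then have "(2 * a) \<star> (y \<odot> i) = (2 * a) \<star> (i \<odot> y)"
        by (simp only: scale_mult mult_scale)
      then have "(2 * a + 2 * a) \<star> (i \<odot> y) = 0"
        unfolding scale_left_distrib by (simp only: y scale_minus_right) (simp add: neg_eq_iff_add_eq_0)
      then have "a \<star> (i \<odot> y) = 0" by simp
      moreover have "i \<noteq> 0" using i p0 by auto
      ultimately have "a = 0"
        using division_corner_no_zero_divisors[OF p(1) i(1) y(1)] y(3) by auto
      then have yy: "y \<odot> y = - b\<^sup>2 \<star> p" using ab by simp
      have "b \<noteq> 0" using yy y division_corner_no_zero_divisors[OF p(1) y(1) y(1)] by auto
      define j where "j = inverse b \<star> y"
      have j: "j \<in> corner p" "j \<odot> j = - p" "j \<odot> i = - (i \<odot> j)"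
        using y yy \<open>b \<noteq> 0\<close> by (auto simp: j_def bilinear power2_eq_square field_simps intro: corner_closed)
      have "bij_betw (of_quat p i j) (division_ring_of QuaternionD) (corner p)"
      proof (rule bij_betw_imageI)
        show "inj_on (of_quat p i j) (division_ring_of QuaternionD)"
          using inj_of_quat[OF p0 pp i(1) j(1) i(2) j(2,3)] by simp
        show "of_quat p i j ` division_ring_of QuaternionD = corner p"
        proof (intro equalityI subsetI)
          fix d assume d: "d \<in> corner p"
          \<comment> \<open>Conjugation by \<open>i\<close> has order 2; \<open>e\<close> and
            \<open>f\<close> are the components of \<open>d\<close> commuting and anticommuting with
            \<open>i\<close>.\<close>
          define e where "e = (1/2) \<star> (d - i \<odot> d \<odot> i)"
          define f where "f = (1/2) \<star> (d + i \<odot> d \<odot> i)"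
          have "e \<in> corner p" "e \<odot> i = i \<odot> e"
            unfolding e_def using d i by (auto simp: bilinear corner_unit i_i corner_closed mult_assoc intro!: corner_closed)
          then obtain s t where e: "e = s \<star> p + t \<star> i" using commuting by blast
          have f: "f \<in> corner p" "f \<odot> i = - (i \<odot> f)"
            unfolding f_def using d i by (auto simp: bilinear corner_unit scale_right_diff_distrib i_i corner_closed mult_assoc intro!: corner_closed)
          have "f \<odot> j \<odot> i = i \<odot> (f \<odot> j)"
            by (simp add: mult_assoc j mult_uminus) (simp add: f uminus_mult flip: mult_assoc)
          then obtain s' t' where "f \<odot> j = s' \<star> p + t' \<star> i"
            using commuting[OF corner_closed(5)[OF f(1) j(1)]] by blast
          then have "f \<odot> j \<odot> j = s' \<star> j + t' \<star> (i \<odot> j)"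
            using j by (simp add: bilinear corner_unit)
          then have "f = - s' \<star> j - t' \<star> (i \<odot> j)"
            using j f by (simp add: mult_assoc mult_uminus corner_unit) (metis minus_equation_iff minus_add_distrib uminus_add_conv_diff diff_conv_add_uminus)
          moreover have "d = e + f"
            by (simp add: e_def f_def flip: scale_right_distrib)
              (simp add: scale_right_distrib flip: scale_left_distrib)
          ultimately have "d = of_quat p i j (Quat s t (- s') (- t'))"
            by (simp add: of_quat_def e)
          then show "d \<in> of_quat p i j ` division_ring_of QuaternionD" by simp
        qed (auto simp: of_quat_def intro!: corner_closed pc i j)
      qed
      then have "corner_iso p (*\<^sub>R) (division_ring_of QuaternionD) (inv_into (division_ring_of QuaternionD) (of_quat p i j))"
        by (rule corner_iso_inverse)
          (simp_all add: of_quat_linear of_quat_mult[OF pp i(1) j(1) i(2) j(2,3)],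
            simp add: of_quat_def one_quat_def)
      then show ?thesis by blast
    qed
  qed
qed

end

section \<open>Frobenius algebras with separability element\<close>

text \<open>
  The families \<open>e\<close> and \<open>f\<close> are dual bases of \<open>corner one\<close> for the form \<open>\<epsilon>\<close>; the product is
  defined and bilinear on the whole ambient space, in which the algebra is the corner of its identity.
\<close>

locale frob_alg = assoc_alg scale mult
  for scale :: "'k::field \<Rightarrow> 'v::ab_group_add \<Rightarrow> 'v" (infixr \<open>\<star>\<close> 75) and mult (infixl \<open>\<odot>\<close> 70) +
  fixes one :: 'v and \<epsilon> :: "'v \<Rightarrow> 'k" and I :: "'i set" and e f :: "'i \<Rightarrow> 'v" and R :: 'k
  assumes finite_I: "finite I"
    and one_idem: "one \<odot> one = one"
    and e_mem: "i \<in> I \<Longrightarrow> e i \<in> corner one"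
    and f_mem: "i \<in> I \<Longrightarrow> f i \<in> corner one"
    and form_add: "\<epsilon> (x + y) = \<epsilon> x + \<epsilon> y"
    and form_scale: "\<epsilon> (c \<star> x) = c * \<epsilon> x"
    and expand_e: "x \<in> corner one \<Longrightarrow> x = (\<Sum>i\<in>I. \<epsilon> (x \<odot> f i) \<star> e i)"
    and expand_f: "x \<in> corner one \<Longrightarrow> x = (\<Sum>i\<in>I. \<epsilon> (e i \<odot> x) \<star> f i)"
    and one_eq: "one = R \<star> (\<Sum>i\<in>I. f i \<odot> e i)"
begin

section \<open>Dual bases and averaging\<close>

lemma one_mem: "one \<in> corner one"
  using one_idem by (simp add: corner_def)

lemma form_zero [simp]: "\<epsilon> 0 = 0"
  using form_scale[of 0 0] by simp

lemma form_sum: "\<epsilon> (sum g J) = (\<Sum>j\<in>J. \<epsilon> (g j))"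
  by (induction J rule: infinite_finite_induct) (simp_all add: form_add)

lemma corner_subset_span: "corner one \<subseteq> span (e ` I)"
proof
  fix x assume "x \<in> corner one"
  then have "x = (\<Sum>i\<in>I. \<epsilon> (x \<odot> f i) \<star> e i)" by (rule expand_e)
  also have "\<dots> \<in> span (e ` I)" by (intro span_sum span_scale span_base) simp
  finally show "x \<in> span (e ` I)" .
qed

lemma form_nondegenerate:
  assumes "x \<in> corner one"
  shows "(\<And>y. y \<in> corner one \<Longrightarrow> \<epsilon> (x \<odot> y) = 0) \<Longrightarrow> x = 0"
    "(\<And>y. y \<in> corner one \<Longrightarrow> \<epsilon> (y \<odot> x) = 0) \<Longrightarrow> x = 0"
  using expand_e[OF assms] expand_f[OF assms] e_mem f_mem by (simp_all cong: sum.cong)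

text \<open>Expanding \<open>e i\<close> in the family \<open>E\<close> produces the coefficients
  \<open>\<epsilon> (e i \<odot> F j)\<close>, which are exactly those of \<open>F j\<close> in the
  family \<open>f\<close>.\<close>

lemma sum_dual_bases:
  assumes F: "\<And>j. j \<in> J \<Longrightarrow> F j \<in> corner one"
    and E: "\<And>x. x \<in> corner one \<Longrightarrow> x = (\<Sum>j\<in>J. \<epsilon> (x \<odot> F j) \<star> E j)"
  shows "(\<Sum>i\<in>I. f i \<odot> e i) = (\<Sum>j\<in>J. F j \<odot> E j)"
proof -
  have "(\<Sum>i\<in>I. f i \<odot> e i) = (\<Sum>i\<in>I. \<Sum>j\<in>J. \<epsilon> (e i \<odot> F j) \<star> (f i \<odot> E j))"
  proof (rule sum.cong[OF refl])
    fix i assume "i \<in> I"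
    then have "f i \<odot> e i = f i \<odot> (\<Sum>j\<in>J. \<epsilon> (e i \<odot> F j) \<star> E j)" using E[OF e_mem] by simp
    then show "f i \<odot> e i = (\<Sum>j\<in>J. \<epsilon> (e i \<odot> F j) \<star> (f i \<odot> E j))"
      by (simp add: mult_sum mult_scale)
  qed
  also have "\<dots> = (\<Sum>j\<in>J. (\<Sum>i\<in>I. \<epsilon> (e i \<odot> F j) \<star> f i) \<odot> E j)"
    by (subst sum.swap) (simp add: sum_mult scale_mult)
  also have "\<dots> = (\<Sum>j\<in>J. F j \<odot> E j)"
    using expand_f[OF F] by (intro sum.cong) simp_all
  finally show ?thesis .
qed

text \<open>This is \<open>\<Sum> x f_i \<otimes> e_i = \<Sum> f_i \<otimes> e_i x\<close>, with the
  tensor replaced by products after an arbitrary linear map \<open>g\<close> on the second factor.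
  The numbers \<open>\<epsilon> (e j \<odot> x \<odot> f i)\<close> are at once the coefficients of
  \<open>x f_i\<close> in the \<open>f_j\<close> and of \<open>e_j x\<close> in the
  \<open>e_i\<close>.\<close>

lemma casimir:
  assumes x: "x \<in> corner one" and g: "\<And>a b. g (a + b) = g a + g b" "\<And>c a. g (c \<star> a) = c \<star> g a"
  shows "(\<Sum>i\<in>I. (x \<odot> f i) \<odot> g (e i)) = (\<Sum>i\<in>I. f i \<odot> g (e i \<odot> x))"
proof -
  have g0: "g 0 = 0" using g(2)[of 0 0] by simp
  have gs: "g (sum h J) = (\<Sum>j\<in>J. g (h j))" for h :: "'i \<Rightarrow> 'v" and J
    by (induction J rule: infinite_finite_induct) (simp_all add: g g0)
  have "(\<Sum>i\<in>I. (x \<odot> f i) \<odot> g (e i)) = (\<Sum>i\<in>I. \<Sum>j\<in>I. \<epsilon> (e j \<odot> x \<odot> f i) \<star> (f j \<odot> g (e i)))"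
  proof (rule sum.cong[OF refl])
    fix i assume "i \<in> I"
    then have "x \<odot> f i = (\<Sum>j\<in>I. \<epsilon> (e j \<odot> (x \<odot> f i)) \<star> f j)"
      by (intro expand_f corner_closed x f_mem)
    then have "(x \<odot> f i) \<odot> g (e i) = (\<Sum>j\<in>I. \<epsilon> (e j \<odot> (x \<odot> f i)) \<star> f j) \<odot> g (e i)" by simp
    then show "(x \<odot> f i) \<odot> g (e i) = (\<Sum>j\<in>I. \<epsilon> (e j \<odot> x \<odot> f i) \<star> (f j \<odot> g (e i)))"
      by (simp only: sum_mult scale_mult mult_assoc)
  qed
  also have "\<dots> = (\<Sum>j\<in>I. f j \<odot> g (\<Sum>i\<in>I. \<epsilon> (e j \<odot> x \<odot> f i) \<star> e i))"
    by (subst sum.swap) (simp add: gs g mult_sum mult_scale)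
  also have "\<dots> = (\<Sum>i\<in>I. f i \<odot> g (e i \<odot> x))"
  proof (rule sum.cong[OF refl])
    fix j assume "j \<in> I"
    then have "e j \<odot> x = (\<Sum>i\<in>I. \<epsilon> (e j \<odot> x \<odot> f i) \<star> e i)"
      by (intro expand_e corner_closed x e_mem)
    then show "f j \<odot> g (\<Sum>i\<in>I. \<epsilon> (e j \<odot> x \<odot> f i) \<star> e i) = f j \<odot> g (e j \<odot> x)" by simp
  qed
  finally show ?thesis .
qed

text \<open>
  Maschke's averaging: a linear pseudo-inverse \<open>g\<close> of \<open>m \<mapsto> m x\<close> becomes left \<open>A\<close>-linear, hence a
  right multiplication, after averaging with the separability element \<open>R \<Sum> f\<^sub>i \<otimes> e\<^sub>i\<close>.
\<close>

lemma von_neumann_regular: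
  assumes x: "x \<in> corner one"
  shows "\<exists>y\<in>corner one. x \<odot> y \<odot> x = x"
proof -
  interpret vector_space_pair scale scale by unfold_locales
  have "Vector_Spaces.linear scale scale (\<lambda>m. m \<odot> x)"
    by unfold_locales (simp_all add: bilinear)
  from linear_exists_right_inverse_on[OF this subspace_corner[of one]]
  obtain g where g: "range g \<subseteq> corner one" "Vector_Spaces.linear scale scale g"
    "\<And>m. m \<in> corner one \<Longrightarrow> g (m \<odot> x) \<odot> x = m \<odot> x" by auto
  note g_linear = linear_add[OF g(2)] linear_scale[OF g(2)]
  \<comment> \<open>The value at \<open>one\<close> of the averaged map
    \<open>m \<mapsto> R \<Sum> f_i g (e_i m)\<close>.\<close>
  let ?y = "R \<star> (\<Sum>i\<in>I. f i \<odot> g (e i))"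
  have "x \<odot> ?y \<odot> x = R \<star> ((\<Sum>i\<in>I. (x \<odot> f i) \<odot> g (e i)) \<odot> x)"
    by (simp add: mult_sum bilinear mult_assoc)
  also have "\<dots> = R \<star> (\<Sum>i\<in>I. f i \<odot> (g (e i \<odot> x) \<odot> x))"
    using casimir[OF x, of g] g_linear by (simp add: sum_mult mult_assoc)
  also have "\<dots> = R \<star> (\<Sum>i\<in>I. f i \<odot> e i) \<odot> x"
    by (simp add: g(3) e_mem sum_mult scale_mult mult_assoc)
  also have "\<dots> = x" using x one_eq by (simp add: corner_unit)
  finally have "x \<odot> ?y \<odot> x = x" .
  moreover have "?y \<in> corner one"
    using g(1) f_mem by (intro corner_closed subspace_sum[OF subspace_corner]) auto
  ultimately show ?thesis by blast
qed

section \<open>Orthogonal idempotents and matrix units\<close>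

definition orthogonal_idempotents :: "'v set \<Rightarrow> bool" where
  "orthogonal_idempotents E \<longleftrightarrow> finite E \<and> sum id E = one \<and>
     (\<forall>p\<in>E. p \<noteq> 0 \<and> p \<odot> p = p) \<and> (\<forall>p\<in>E. \<forall>q\<in>E. p \<noteq> q \<longrightarrow> p \<odot> q = 0)"

lemma orthogonal_sum_mult:
  assumes E: "orthogonal_idempotents E" and p: "p \<in> E"
  shows "(\<Sum>q\<in>E. c q \<star> q) \<odot> p = c p \<star> p" "p \<odot> (\<Sum>q\<in>E. c q \<star> q) = c p \<star> p"
proof -
  have fin: "finite E" using E by (simp add: orthogonal_idempotents_def)
  have "(\<Sum>q\<in>E. c q \<star> q) \<odot> p = (\<Sum>q\<in>E. if q = p then c p \<star> p else 0)"
    unfolding sum_mult scale_mult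
    using E p by (intro sum.cong) (auto simp: orthogonal_idempotents_def)
  then show "(\<Sum>q\<in>E. c q \<star> q) \<odot> p = c p \<star> p" using fin p by simp
  have "p \<odot> (\<Sum>q\<in>E. c q \<star> q) = (\<Sum>q\<in>E. if q = p then c p \<star> p else 0)"
    unfolding mult_sum mult_scale
    using E p by (intro sum.cong) (auto simp: orthogonal_idempotents_def)
  then show "p \<odot> (\<Sum>q\<in>E. c q \<star> q) = c p \<star> p" using fin p by simp
qed

lemma orthogonal_idempotents_subset:
  assumes E: "orthogonal_idempotents E" shows "E \<subseteq> corner one"
proof
  fix p assume "p \<in> E"
  moreover have "one = (\<Sum>q\<in>E. 1 \<star> q)" using E by (simp add: orthogonal_idempotents_def)
  ultimately show "p \<in> corner one" using orthogonal_sum_mult[OF E, of p "\<lambda>_. 1"] by (simp add: corner_def)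
qed

text \<open>Multiplying a linear relation by one member isolates its coefficient, so the family is
  independent; this bound makes a largest family exist.\<close>

lemma card_orthogonal_idempotents:
  assumes E: "orthogonal_idempotents E" shows "card E \<le> card I"
proof -
  have fin: "finite E" using E by (simp add: orthogonal_idempotents_def)
  have "\<not> dependent E"
  proof (rule independent_if_scalars_zero[OF fin])
    fix c p assume "(\<Sum>x\<in>E. c x \<star> x) = 0" "p \<in> E"
    then have "c p \<star> p = 0" using orthogonal_sum_mult(1)[OF E, of p c] by simp
    then show "c p = 0" using E \<open>p \<in> E\<close> by (simp add: orthogonal_idempotents_def)
  qed
  moreover have "E \<subseteq> span (e ` I)" using orthogonal_idempotents_subset[OF E] corner_subset_span by blast
  ultimately have "card E \<le> card (e ` I)" using independent_span_bound finite_I by blast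
  then show ?thesis using card_image_le[OF finite_I, of e] by simp
qed

text \<open>Since \<open>q\<close> lies in \<open>corner p\<close>, the idempotents \<open>q\<close>
  and \<open>p - q\<close> are orthogonal, and they inherit orthogonality to the rest of the family
  from \<open>p\<close>. The count grows because both are new and different.\<close>

lemma split_idempotent:
  assumes E: "orthogonal_idempotents E" and p: "p \<in> E"
    and q: "q \<in> corner p" "q \<odot> q = q" "q \<noteq> 0" "q \<noteq> p"
  shows "\<exists>E'. orthogonal_idempotents E' \<and> card E' = Suc (card E)"
proof -
  let ?F = "E - {p}" and ?E = "insert q (insert (p - q) (E - {p}))"
  have fin: "finite E" and pp: "p \<odot> p = p" and F: "\<And>r. r \<in> ?F \<Longrightarrow> r \<odot> p = 0 \<and> p \<odot> r = 0"
    using E p by (auto simp: orthogonal_idempotents_def)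
  have Fq: "r \<odot> q = 0" "q \<odot> r = 0" if "r \<in> ?F" for r
    using F[OF that] corner_unit[OF q(1)] mult_assoc[of r p q] mult_assoc[of q p r] by simp_all
  have ne: "p - q \<noteq> q"
  proof
    assume "p - q = q"
    then have "q \<odot> (p - q) = q \<odot> q" by simp
    then show False using q by (simp add: mult_diff corner_unit)
  qed
  \<comment> \<open>A member of the rest annihilates \<open>p\<close> and \<open>q\<close>: the
    first claim would otherwise give \<open>q = q \<odot> q = 0\<close>, the second
    \<open>p = q\<close>.\<close>
  have nF: "q \<notin> ?F" "p - q \<notin> ?F"
    using Fq(1)[of q] F[of "p - q"] q pp by (auto simp: diff_mult corner_unit)
  have "sum id ?E = one"
    using E p fin ne nF by (simp add: orthogonal_idempotents_def sum.remove[of E p])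
  moreover have "(p - q) \<odot> (p - q) = p - q" "q \<odot> (p - q) = 0" "(p - q) \<odot> q = 0"
    using q pp by (simp_all add: bilinear corner_unit)
  moreover have "r \<odot> (p - q) = 0" "(p - q) \<odot> r = 0" if "r \<in> ?F" for r
    using F[OF that] Fq[OF that] by (simp_all add: bilinear)
  ultimately have "orthogonal_idempotents ?E"
    using E q Fq fin unfolding orthogonal_idempotents_def by auto
  moreover have "card ?E = Suc (card E)"
    using fin ne nF p card_Suc_Diff1[OF fin p] by simp
  ultimately show ?thesis by blast
qed

text \<open>In a family of largest size no \<open>p\<close> splits, so \<open>p\<close> is the only
  nonzero idempotent of its corner. If \<open>x z x = x\<close>, then \<open>x z\<close> and
  \<open>z x\<close> are such idempotents, and \<open>z\<close> inverts \<open>x\<close>.\<close>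

lemma exists_division_idempotents:
  "\<exists>E. orthogonal_idempotents E \<and> (\<forall>p\<in>E. division_corner p)"
proof -
  \<comment> \<open>The zero algebra has the empty family, as members must be nonzero.\<close>
  have "orthogonal_idempotents (if one = 0 then {} else {one})"
    using one_idem by (simp add: orthogonal_idempotents_def)
  moreover have "\<forall>F. orthogonal_idempotents F \<longrightarrow> card F < Suc (card I)"
    using card_orthogonal_idempotents by (simp add: less_Suc_eq_le)
  ultimately have "\<exists>E. orthogonal_idempotents E \<and> (\<forall>F. orthogonal_idempotents F \<longrightarrow> card F \<le> card E)"
    by (rule ex_has_greatest_nat)
  then obtain E where E: "orthogonal_idempotents E"
    and max: "\<And>F. orthogonal_idempotents F \<Longrightarrow> card F \<le> card E" by blast
  have "division_corner p" if p: "p \<in> E" for p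
    unfolding division_corner_def
  proof (intro conjI ballI impI)
    show "p \<noteq> 0" and pp: "p \<odot> p = p" using E p by (auto simp: orthogonal_idempotents_def)
    have primitive: "q = p" if "q \<in> corner p" "q \<odot> q = q" "q \<noteq> 0" for q
      using split_idempotent[OF E p that] max by fastforce
    have p1: "p \<in> corner one" using orthogonal_idempotents_subset[OF E] p by blast
    fix x assume x: "x \<in> corner p" "x \<noteq> 0"
    then have "one \<odot> x = x" "x \<odot> one = x"
      using p1 corner_unit[OF x(1)] corner_unit[OF p1] by (metis mult_assoc)+
    then obtain y where y: "x \<odot> y \<odot> x = x"
      using von_neumann_regular[of x] by (auto simp: corner_def)
    \<comment> \<open>Compressing the inner inverse \<open>y\<close> to the corner keeps
      \<open>x z x = x\<close>, because \<open>x\<close> absorbs \<open>p\<close> on both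
      sides.\<close>
    define z where "z = p \<odot> y \<odot> p"
    have z: "z \<in> corner p" by (simp add: corner_def z_def mult_assoc pp) (simp add: pp flip: mult_assoc)
    have xzx: "x \<odot> z \<odot> x = x"
      using y corner_unit[OF x(1)] by (simp add: z_def mult_assoc) (metis mult_assoc)
    have "x \<odot> z = p"
      using xzx x(2) by (intro primitive corner_closed x z) (auto simp flip: mult_assoc)
    moreover have "z \<odot> x = p"
      using xzx x(2) by (intro primitive corner_closed x z) (auto simp: mult_assoc)
    ultimately show "\<exists>y\<in>corner p. x \<odot> y = p \<and> y \<odot> x = p" using z by blast
  qed
  then show ?thesis using E by blast
qed

text \<open>With \<open>u = p x q\<close> and \<open>u v u = u\<close> for a suitable
  \<open>v\<close> in \<open>q A p\<close>, the products \<open>u v\<close> and \<open>v u\<close>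
  are nonzero idempotents of division corners, hence their identities \<open>p\<close> and
  \<open>q\<close>.\<close>

lemma linked_idempotents:
  assumes p: "division_corner p" "p \<in> corner one" and q: "division_corner q" "q \<in> corner one"
    and x: "p \<odot> x \<odot> q \<noteq> 0"
  shows "\<exists>u v. p \<odot> u = u \<and> u \<odot> q = u \<and> q \<odot> v = v \<and> v \<odot> p = v \<and> u \<odot> v = p \<and> v \<odot> u = q"
proof -
  have pp: "p \<odot> p = p" and qq: "q \<odot> q = q" using p q by (auto simp: division_corner_def)
  define u where "u = p \<odot> x \<odot> q"
  have u: "p \<odot> u = u" "u \<odot> q = u" "u \<noteq> 0"
    using x pp qq by (simp_all add: u_def mult_assoc) (metis mult_assoc)
  then have "u \<in> corner one"
    using p(2) q(2) unfolding corner_def by (metis (mono_tags, lifting) mem_Collect_eq mult_assoc)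
  then obtain y where y: "u \<odot> y \<odot> u = u" using von_neumann_regular by blast
  define v where "v = q \<odot> y \<odot> p"
  have v: "q \<odot> v = v" "v \<odot> p = v" using pp qq by (simp_all add: v_def mult_assoc) (metis mult_assoc)
  have uvu: "u \<odot> v \<odot> u = u" using y u by (simp add: v_def mult_assoc) (metis mult_assoc)
  have idem: "z = r" if r: "division_corner r" and z: "z \<in> corner r" "z \<odot> z = z" "z \<noteq> 0" for z r
  proof -
    have "z \<odot> (r - z) = 0" using z by (simp add: mult_diff corner_unit)
    then show ?thesis
      using division_corner_no_zero_divisors[OF r z(1) corner_closed(3)[OF division_corner_unit_mem[OF r] z(1)]] z
      by auto
  qed
  have uv: "(u \<odot> v) \<odot> (u \<odot> v) = u \<odot> v" "(v \<odot> u) \<odot> (v \<odot> u) = v \<odot> u"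
    using uvu by (metis mult_assoc)+
  have "u \<odot> v = p"
  proof (rule idem[OF p(1) _ uv(1)])
    show "u \<odot> v \<in> corner p" using u v by (simp add: corner_def mult_assoc) (metis mult_assoc)
    show "u \<odot> v \<noteq> 0" using uvu u(3) by auto
  qed
  moreover have "v \<odot> u = q"
  proof (rule idem[OF q(1) _ uv(2)])
    show "v \<odot> u \<in> corner q" using u v by (simp add: corner_def mult_assoc) (metis mult_assoc)
    show "v \<odot> u \<noteq> 0" using uvu u(3) by (auto simp: mult_assoc)
  qed
  ultimately show ?thesis using u v by blast
qed

text \<open>The relation \<open>p A q \<noteq> 0\<close> is an equivalence on the family, and its
  classes are the blocks. For a representative \<open>P i\<close> of a class, \<open>u i r\<close>
  and \<open>v i r\<close> link \<open>P i\<close> with the \<open>r\<close>-th member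
  \<open>\<eta> i r\<close>, so that \<open>v i r \<odot> u i s\<close> are matrix units.\<close>

lemma exists_matrix_units:
  obtains N :: nat and n :: "nat \<Rightarrow> nat" and P u v where
    "\<And>i. i < N \<Longrightarrow> 0 < n i \<and> division_corner (P i) \<and> P i \<in> corner one"
    "\<And>i r. i < N \<Longrightarrow> r < n i \<Longrightarrow> P i \<odot> u i r = u i r \<and> v i r \<odot> P i = v i r"
    "\<And>i r s. i < N \<Longrightarrow> r < n i \<Longrightarrow> s < n i \<Longrightarrow> u i r \<odot> v i s = (if r = s then P i else 0)"
    "\<And>i j r s a. i < N \<Longrightarrow> j < N \<Longrightarrow> r < n i \<Longrightarrow> s < n j \<Longrightarrow> i \<noteq> j \<Longrightarrow> u i r \<odot> a \<odot> v j s = 0"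
    "\<And>i r. i < N \<Longrightarrow> r < n i \<Longrightarrow> one \<odot> v i r = v i r \<and> u i r \<odot> one = u i r"
    "one = (\<Sum>i<N. \<Sum>r<n i. v i r \<odot> u i r)"
proof -
  obtain E where E: "orthogonal_idempotents E" and div: "\<And>p. p \<in> E \<Longrightarrow> division_corner p"
    using exists_division_idempotents by blast
  have fin: "finite E" and one_sum: "one = sum id E" and orth: "\<And>p q. p \<in> E \<Longrightarrow> q \<in> E \<Longrightarrow> p \<noteq> q \<Longrightarrow> p \<odot> q = 0"
    and idem: "\<And>p. p \<in> E \<Longrightarrow> p \<odot> p = p" and nz: "\<And>p. p \<in> E \<Longrightarrow> p \<noteq> 0"
    using E by (auto simp: orthogonal_idempotents_def)
  have mem: "p \<in> corner one" if "p \<in> E" for p using orthogonal_idempotents_subset[OF E] that by blast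
  define rel where "rel = {(p, q). p \<in> E \<and> q \<in> E \<and> (\<exists>x. p \<odot> x \<odot> q \<noteq> 0)}"
  have units: "\<exists>u v. p \<odot> u = u \<and> u \<odot> q = u \<and> q \<odot> v = v \<and> v \<odot> p = v \<and> u \<odot> v = p \<and> v \<odot> u = q"
    if "(p, q) \<in> rel" for p q
    using that linked_idempotents[of p q] div mem by (auto simp: rel_def)
  have "equiv E rel"
  proof (rule equivI)
    show "rel \<subseteq> E \<times> E" by (auto simp: rel_def)
    have "p \<odot> p \<odot> p \<noteq> 0" if "p \<in> E" for p using idem nz that by simp
    then show "refl_on E rel" by (auto simp: refl_on_def rel_def)
    show "sym rel"
    proof (rule symI)
      fix p q assume pq: "(p, q) \<in> rel"
      then obtain v u where "q \<odot> v = v" "v \<odot> p = v" "v \<odot> u = q" using units by blast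
      then have "q \<odot> v \<odot> p \<noteq> 0" using pq nz by (auto simp: rel_def)
      then show "(q, p) \<in> rel" using pq by (auto simp: rel_def)
    qed
    show "trans rel"
    proof (rule transI)
      fix p q r assume pq: "(p, q) \<in> rel" and qr: "(q, r) \<in> rel"
      obtain u v where u: "p \<odot> u = u" "u \<odot> q = u" "u \<odot> v = p" "v \<odot> p = v" using units[OF pq] by blast
      obtain u' v' where u': "u' \<odot> r = u'" "u' \<odot> v' = q" using units[OF qr] by blast
      \<comment> \<open>The product \<open>u u'\<close> leads from \<open>p\<close> to
        \<open>r\<close>; it is nonzero because \<open>v' v\<close> multiplies it back to
        \<open>p\<close>.\<close>
      have "p \<odot> (u \<odot> u') \<odot> r \<odot> (v' \<odot> v) = u \<odot> (u' \<odot> v') \<odot> v"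
        using u u' by (simp add: mult_assoc) (metis mult_assoc)
      also have "\<dots> = p" using u u' by simp
      finally have "p \<odot> (u \<odot> u') \<odot> r \<noteq> 0" using nz pq by (auto simp: rel_def)
      then show "(p, r) \<in> rel" using pq qr by (auto simp: rel_def)
    qed
  qed
  have finQ: "finite (E // rel)" using fin by (rule finite_quotient) (auto simp: rel_def)
  then obtain \<kappa> where \<kappa>: "bij_betw \<kappa> {..<card (E // rel)} (E // rel)"
    using ex_bij_betw_nat_finite[of "E // rel"] by (auto simp: atLeast0LessThan)
  define N where "N = card (E // rel)"
  define n where "n i = card (\<kappa> i)" for i
  have K: "\<kappa> i \<in> E // rel" if "i < N" for i using \<kappa> that by (auto simp: N_def bij_betw_def)
  have KE: "\<kappa> i \<subseteq> E" if "i < N" for i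
    using K[OF that] in_quotient_imp_subset[OF \<open>equiv E rel\<close>] by blast
  then have finK: "finite (\<kappa> i)" if "i < N" for i using fin that finite_subset by blast
  have "\<exists>h. bij_betw h {..<n i} (\<kappa> i)" if "i < N" for i
    using ex_bij_betw_nat_finite[OF finK[OF that]] by (simp add: n_def atLeast0LessThan)
  then obtain \<eta> where \<eta>: "\<And>i. i < N \<Longrightarrow> bij_betw (\<eta> i) {..<n i} (\<kappa> i)" by metis
  have \<eta>K: "\<eta> i r \<in> \<kappa> i" if "i < N" "r < n i" for i r
    using \<eta>[OF that(1)] that(2) by (auto simp: bij_betw_def)
  have pos: "0 < n i" if "i < N" for i
    using in_quotient_imp_non_empty[OF \<open>equiv E rel\<close> K[OF that]] finK[OF that] by (simp add: n_def card_gt_0_iff)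
  define P where "P i = \<eta> i 0" for i
  have PK: "P i \<in> \<kappa> i" if "i < N" for i using \<eta>K[OF that pos[OF that]] by (simp add: P_def)
  have PE: "division_corner (P i) \<and> P i \<in> corner one" if "i < N" for i
    using PK KE div mem that by blast
  have "\<exists>u v. i < N \<and> r < n i \<longrightarrow> P i \<odot> u = u \<and> u \<odot> \<eta> i r = u \<and> \<eta> i r \<odot> v = v \<and> v \<odot> P i = v \<and>
      u \<odot> v = P i \<and> v \<odot> u = \<eta> i r" for i r
  proof (cases "i < N \<and> r < n i")
    case True
    then have "(P i, \<eta> i r) \<in> rel"
      using in_quotient_imp_in_rel[OF \<open>equiv E rel\<close> K] PK \<eta>K by blast
    then show ?thesis using units by blast
  qed auto
  then obtain u v where uv: "\<And>i r. i < N \<Longrightarrow> r < n i \<Longrightarrow> P i \<odot> u i r = u i r \<and> u i r \<odot> \<eta> i r = u i r \<and>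
      \<eta> i r \<odot> v i r = v i r \<and> v i r \<odot> P i = v i r \<and> u i r \<odot> v i r = P i \<and> v i r \<odot> u i r = \<eta> i r"
    by metis
  have orth_uv: "u i r \<odot> v i s = 0" if "i < N" "r < n i" "s < n i" "r \<noteq> s" for i r s
  proof -
    have "\<eta> i r \<noteq> \<eta> i s" using \<eta>[OF that(1)] that by (auto simp: bij_betw_def inj_on_def)
    then have "\<eta> i r \<odot> \<eta> i s = 0" using orth KE \<eta>K that by blast
    then have "(u i r \<odot> \<eta> i r) \<odot> (\<eta> i s \<odot> v i s) = 0" by (metis mult_assoc mult_zero zero_mult)
    then show ?thesis using uv that by simp
  qed
  have unlinked: "u i r \<odot> a \<odot> v j s = 0" if "i < N" "j < N" "r < n i" "s < n j" "i \<noteq> j" for i j r s a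
  proof -
    have "\<kappa> i \<noteq> \<kappa> j" using \<kappa> that by (auto simp: bij_betw_def inj_on_def N_def)
    then have "(\<eta> i r, \<eta> j s) \<notin> rel"
      using quotient_eqI[OF \<open>equiv E rel\<close> K K] \<eta>K that by blast
    then have "\<eta> i r \<odot> a \<odot> \<eta> j s = 0" using KE \<eta>K that by (auto simp: rel_def)
    then have "(u i r \<odot> \<eta> i r) \<odot> a \<odot> (\<eta> j s \<odot> v j s) = 0" by (metis mult_assoc mult_zero zero_mult)
    then show ?thesis using uv that by simp
  qed
  have units_one: "one \<odot> v i r = v i r \<and> u i r \<odot> one = u i r" if "i < N" "r < n i" for i r
  proof -
    have "\<eta> i r \<in> corner one" using mem KE \<eta>K that by blast
    then show ?thesis using uv[OF that] corner_unit by (metis mult_assoc)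
  qed
  have "\<forall>K\<in>E // rel. finite K" "\<forall>K\<in>E // rel. \<forall>L\<in>E // rel. K \<noteq> L \<longrightarrow> K \<inter> L = {}"
    using fin in_quotient_imp_subset[OF \<open>equiv E rel\<close>] quotient_disj[OF \<open>equiv E rel\<close>]
    by (blast intro: finite_subset)+
  then have "one = (\<Sum>K\<in>E // rel. sum id K)"
    unfolding one_sum by (subst Union_quotient[OF \<open>equiv E rel\<close>, symmetric]) (simp add: sum.Union_disjoint)
  also have "\<dots> = (\<Sum>i<N. sum id (\<kappa> i))"
    using sum.reindex_bij_betw[OF \<kappa>, of "sum id"] by (simp add: N_def)
  also have "\<dots> = (\<Sum>i<N. \<Sum>r<n i. v i r \<odot> u i r)"
  proof (rule sum.cong[OF refl])
    fix i assume i: "i \<in> {..<N}"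
    then have "sum id (\<kappa> i) = (\<Sum>r<n i. \<eta> i r)"
      using sum.reindex_bij_betw[OF \<eta>, of i id] by simp
    also have "\<dots> = (\<Sum>r<n i. v i r \<odot> u i r)"
      using uv i by (intro sum.cong) auto
    finally show "sum id (\<kappa> i) = (\<Sum>r<n i. v i r \<odot> u i r)" .
  qed
  finally have one_uv: "one = (\<Sum>i<N. \<Sum>r<n i. v i r \<odot> u i r)" .
  show thesis
    by (rule that[of N n P u v]) (use pos PE uv orth_uv unlinked units_one one_uv in auto)
qed

end

section \<open>Direct sums of matrix algebras\<close>

lemma sum_fun_apply: "sum f A x = (\<Sum>a\<in>A. f a x)"
  by (induction A rule: infinite_finite_induct) simp_all

lemma sum_if_const: "(\<Sum>a\<in>A. if P then f a else 0) = (if P then sum f A else 0)"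
  by simp

text \<open>
  The possible coefficient algebras \<open>Dom c\<close> lie in one ambient ring. The form \<open>\<rho>\<close> is the real part (the
  identity over the complex numbers), and \<open>Q c\<close> is a basis whose dual basis for \<open>\<rho> (a * b)\<close> is its image under
  the conjugation \<open>bar\<close>.
\<close>

locale coefficients =
  fixes smul :: "'k::field \<Rightarrow> 'd::ring_1 \<Rightarrow> 'd" and \<rho> :: "'d \<Rightarrow> 'k"
    and Dom :: "'c \<Rightarrow> 'd set" and Q :: "'c \<Rightarrow> 'd set" and bar :: "'d \<Rightarrow> 'd"
  assumes smul_vector_space: "vector_space smul"
    and smul_mult: "smul c a * b = smul c (a * b)" "a * smul c b = smul c (a * b)"
    and re_add: "\<rho> (a + b) = \<rho> a + \<rho> b"
    and re_smul: "\<rho> (smul c a) = c * \<rho> a"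
    and re_commute: "\<rho> (a * b) = \<rho> (b * a)"
    and Dom_one: "1 \<in> Dom d"
    and Dom_add: "a \<in> Dom d \<Longrightarrow> b \<in> Dom d \<Longrightarrow> a + b \<in> Dom d"
    and Dom_mult: "a \<in> Dom d \<Longrightarrow> b \<in> Dom d \<Longrightarrow> a * b \<in> Dom d"
    and Dom_smul: "a \<in> Dom d \<Longrightarrow> smul c a \<in> Dom d"
    and finite_Q: "finite (Q d)"
    and Q_mem: "q \<in> Q d \<Longrightarrow> q \<in> Dom d" "q \<in> Q d \<Longrightarrow> bar q \<in> Dom d"
    and Q_expand: "a \<in> Dom d \<Longrightarrow> a = (\<Sum>q\<in>Q d. smul (\<rho> (a * bar q)) q)"
begin

section \<open>Block matrices and their trace form\<close>

sublocale smul: vector_space smul by (rule smul_vector_space)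

lemma re_zero [simp]: "\<rho> 0 = 0"
  using re_smul[of 0 0] by simp

lemma re_sum: "\<rho> (sum f A) = (\<Sum>a\<in>A. \<rho> (f a))"
  by (induction A rule: infinite_finite_induct) (simp_all add: re_add)

lemma Dom_zero: "0 \<in> Dom d"
  using Dom_smul[OF Dom_one, of 0] by simp

lemma Dom_sum: "(\<And>a. a \<in> A \<Longrightarrow> f a \<in> Dom d) \<Longrightarrow> sum f A \<in> Dom d"
  by (induction A rule: infinite_finite_induct) (auto intro: Dom_zero Dom_add)

abbreviation bsmul :: "'k \<Rightarrow> 'd blocks \<Rightarrow> 'd blocks" where
  "bsmul \<equiv> \<lambda>c a i r s. smul c (a i r s)"

sublocale blocks: assoc_alg bsmul "blocks_mult n" for n
proof
  fix a b c :: "'d blocks"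
  show "blocks_mult n (blocks_mult n a b) c = blocks_mult n a (blocks_mult n b c)"
    unfolding blocks_mult_def
    by (intro ext) (simp add: sum_distrib_left sum_distrib_right mult.assoc, rule sum.swap)
qed (simp_all add: fun_eq_iff blocks_mult_def smul.scale_right_distrib smul.scale_left_distrib
    distrib_left distrib_right sum.distrib smul_mult smul.scale_sum_right)

definition trace_form :: "nat \<Rightarrow> (nat \<Rightarrow> nat) \<Rightarrow> 'd blocks \<Rightarrow> 'k" where
  "trace_form N n a = (\<Sum>i<N. \<rho> (Tr n a i))"

lemma trace_form_eq: "trace_form N n (blocks_mult n a b) = (\<Sum>i<N. \<Sum>r<n i. \<Sum>s<n i. \<rho> (a i r s * b i s r))"
  by (simp add: trace_form_def Tr_def blocks_mult_def re_sum)

text \<open>The trace itself is not cyclic over a noncommutative coefficient ring; applying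
  \<open>\<rho>\<close> restores the symmetry.\<close>

lemma trace_form_commute: "trace_form N n (blocks_mult n a b) = trace_form N n (blocks_mult n b a)"
  unfolding trace_form_eq by (rule sum.cong[OF refl], subst sum.swap) (simp add: re_commute)

abbreviation matrices :: "nat \<Rightarrow> (nat \<Rightarrow> nat) \<Rightarrow> (nat \<Rightarrow> 'c) \<Rightarrow> 'd blocks set" where
  "matrices N n D \<equiv> matrix_sum N n (\<lambda>i. Dom (D i))"

lemma blocks_one_mem: "blocks_one N n \<in> matrices N n D"
  by (auto simp: matrix_sum_def blocks_one_def Dom_one Dom_zero)

lemma blocks_mult_mem:
  "a \<in> matrices N n D \<Longrightarrow> b \<in> matrices N n D \<Longrightarrow> blocks_mult n a b \<in> matrices N n D"
  by (auto simp: matrix_sum_def blocks_mult_def intro!: Dom_sum Dom_mult sum.neutral)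

lemma blocks_mult_one:
  assumes "a \<in> matrices N n D"
  shows "blocks_mult n a (blocks_one N n) = a" "blocks_mult n (blocks_one N n) a = a"
proof -
  have "if i < N \<and> r < n i \<and> s < n i then a i r s \<in> Dom (D i) else a i r s = 0" for i r s
    using assms unfolding matrix_sum_def by blast
  then have a: "a i r s = 0" if "\<not> (i < N \<and> r < n i \<and> s < n i)" for i r s
    using that by presburger
  have "blocks_mult n a (blocks_one N n) i r s = (\<Sum>t<n i. if t = s then a i r s else 0)"
    "blocks_mult n (blocks_one N n) a i r s = (\<Sum>t<n i. if t = r then a i r s else 0)" for i r s
    unfolding blocks_mult_def blocks_one_def by (auto intro!: sum.cong simp: a simp del: sum.delta sum.delta')
  then show "blocks_mult n a (blocks_one N n) = a" "blocks_mult n (blocks_one N n) a = a"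
    by (auto simp: fun_eq_iff a)
qed

lemma distrib_ifs:
  "a * (if P then b else 0) = (if P then a * b else 0)"
  "(if P then b else 0) * a = (if P then b * a else 0)"
  "\<rho> (if P then b else 0) = (if P then \<rho> b else 0)"
  "smul c (if P then b else 0) = (if P then smul c b else 0)"
  by simp_all

text \<open>The matrix unit \<open>q E_rs\<close> in block \<open>i\<close>. Nested conditionals let
  sums over the indices collapse one index at a time.\<close>

definition unit_block :: "'d \<Rightarrow> nat \<Rightarrow> nat \<Rightarrow> nat \<Rightarrow> 'd blocks" where
  "unit_block q i r s = (\<lambda>i' r' s'. if i' = i then if r' = r then if s' = s then q else 0 else 0 else 0)"

lemma unit_block_mem:
  "q \<in> Dom (D i) \<Longrightarrow> i < N \<Longrightarrow> r < n i \<Longrightarrow> s < n i \<Longrightarrow> unit_block q i r s \<in> matrices N n D"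
  by (auto simp: matrix_sum_def unit_block_def Dom_zero)

lemma trace_form_unit_block:
  assumes "i < N" "r < n i" "s < n i"
  shows "trace_form N n (blocks_mult n a (unit_block q i r s)) = \<rho> (a i s r * q)"
  using assms by (simp add: trace_form_eq unit_block_def distrib_ifs sum_if_const cong: if_cong)

lemma blocks_expand:
  assumes "a \<in> matrices N n D"
  shows "a = (\<Sum>i<N. \<Sum>r<n i. \<Sum>s<n i. \<Sum>q\<in>Q (D i). bsmul (\<rho> (a i r s * bar q)) (unit_block q i r s))"
proof (intro ext)
  fix i r s
  show "a i r s = (\<Sum>i<N. \<Sum>r<n i. \<Sum>s<n i. \<Sum>q\<in>Q (D i). bsmul (\<rho> (a i r s * bar q)) (unit_block q i r s)) i r s"
    using assms Q_expand[of "a i r s" "D i"]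
    by (auto simp: sum_fun_apply unit_block_def distrib_ifs sum_if_const matrix_sum_def cong: if_cong)
qed

text \<open>In terms of matrix units, \<open>(p E_sr) y (q E_rs) = (p y_rr q) E_ss\<close>; summed
  over \<open>r\<close>, it produces the trace of \<open>y\<close>.\<close>

lemma sandwich_unit_blocks:
  assumes "i < N" "r < n i" "s < n i" 
  shows "blocks_mult n (blocks_mult n (unit_block p i s r) y) (unit_block q i r s) = unit_block (p * y i r r * q) i s s"
  using assms by (simp add: blocks_mult_def unit_block_def fun_eq_iff distrib_ifs sum_if_const cong: if_cong)

end

section \<open>The trace condition\<close>

locale frob_alg_matrix = coefficients smul \<rho> Dom Q bar +
    frob_alg bsmul mult one \<epsilon> I e f R
  for smul :: "'k::field \<Rightarrow> 'd::ring_1 \<Rightarrow> 'd" and \<rho> and Dom :: "'c \<Rightarrow> 'd set" and Q bar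
    and mult :: "'d blocks \<Rightarrow> 'd blocks \<Rightarrow> 'd blocks" (infixl \<open>\<odot>\<close> 70)
    and one \<epsilon> and I :: "'i set" and e f R +
  fixes N n D x y
  assumes carrier: "corner one = matrices N n D"
    and mult_eq: "a \<in> matrices N n D \<Longrightarrow> b \<in> matrices N n D \<Longrightarrow> a \<odot> b = blocks_mult n a b"
    and inverse: "mutually_inverse N n (\<lambda>i. Dom (D i)) x y"
    and form_eq: "a \<in> matrices N n D \<Longrightarrow> \<epsilon> a = trace_form N n (blocks_mult n x a)"
begin

lemma one_eq_blocks_one: "one = blocks_one N n"
proof -
  have "one \<odot> blocks_one N n = blocks_one N n"
    using carrier blocks_one_mem corner_unit by metis
  then show ?thesis using carrier one_mem mult_eq[OF _ blocks_one_mem] blocks_mult_one(1) by metis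
qed

text \<open>The families \<open>E = q E_rs\<close> and \<open>F = bar q E_sr y\<close> are dual: by
  cyclicity the form of \<open>a F\<close> is the trace form of \<open>a bar q E_sr y x\<close>, in
  which \<open>y x = 1\<close>. Hence
  \<open>\<beta> = \<Sum> F E = \<Sum> bar q y_rr q E_ss\<close>, to be compared with
  \<open>one = R \<beta>\<close>.\<close>

lemma trace_condition:
  assumes i: "i < N" "0 < n i"
  shows "smul R (\<Sum>q\<in>Q (D i). bar q * Tr n y i * q) = 1"
proof -
  let ?M = "matrices N n D"
  define J where "J = (SIGMA i:{..<N}. {..<n i} \<times> {..<n i} \<times> Q (D i))"
  define F where "F = (\<lambda>(i, r, s, q). blocks_mult n (unit_block (bar q) i s r) y)"
  define E where "E = (\<lambda>(i, r, s, q). unit_block q i r s :: 'd blocks)"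
  have sum_J: "sum g J = (\<Sum>i<N. \<Sum>r<n i. \<Sum>s<n i. \<Sum>q\<in>Q (D i). g (i, r, s, q))" for g :: "_ \<Rightarrow> 'd blocks"
    unfolding J_def by (simp add: sum.Sigma finite_Q sum.cartesian_product case_prod_unfold)
  have xy: "x \<in> ?M" "y \<in> ?M" "blocks_mult n y x = blocks_one N n"
    using inverse by (auto simp: mutually_inverse_def)
  have F: "F j \<in> ?M" and E: "E j \<in> ?M" if "j \<in> J" for j
    using that xy by (auto simp: J_def F_def E_def intro!: blocks_mult_mem unit_block_mem Q_mem)
  have "(\<Sum>i\<in>I. f i \<odot> e i) = (\<Sum>j\<in>J. F j \<odot> E j)"
  proof (rule sum_dual_bases)
    fix a assume "a \<in> corner one"
    then have a: "a \<in> ?M" by (simp add: carrier)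
    have "\<epsilon> (a \<odot> F (i, r, s, q)) = \<rho> (a i r s * bar q)" if j: "(i, r, s, q) \<in> J" for i r s q
    proof -
      have "\<epsilon> (a \<odot> F (i, r, s, q)) = trace_form N n (blocks_mult n x (blocks_mult n a (F (i, r, s, q))))"
        using a F[OF j] by (simp add: mult_eq form_eq blocks_mult_mem)
      also have "\<dots> = trace_form N n (blocks_mult n (blocks_mult n a (F (i, r, s, q))) x)"
        by (rule trace_form_commute)
      also have "\<dots> = trace_form N n (blocks_mult n a (blocks_mult n (unit_block (bar q) i s r) (blocks_one N n)))"
        by (simp add: F_def blocks.mult_assoc xy)
      also have "\<dots> = trace_form N n (blocks_mult n a (unit_block (bar q) i s r))"
        using j by (subst blocks_mult_one(1)[OF unit_block_mem]) (auto simp: J_def intro: Q_mem)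
      also have "\<dots> = \<rho> (a i r s * bar q)"
        using j by (intro trace_form_unit_block) (auto simp: J_def)
      finally show ?thesis .
    qed
    then have "(\<Sum>j\<in>J. bsmul (\<epsilon> (a \<odot> F j)) (E j)) =
        (\<Sum>j\<in>J. case j of (i, r, s, q) \<Rightarrow> bsmul (\<rho> (a i r s * bar q)) (unit_block q i r s))"
      by (intro sum.cong) (auto simp: E_def)
    also have "\<dots> = a" unfolding sum_J using blocks_expand[OF a] by simp
    finally show "a = (\<Sum>j\<in>J. bsmul (\<epsilon> (a \<odot> F j)) (E j))" by simp
  qed (use F carrier in auto)
  also have "\<dots> = (\<Sum>j\<in>J. case j of (i, r, s, q) \<Rightarrow> unit_block (bar q * y i r r * q) i s s)"
    using F E by (intro sum.cong) (auto simp: mult_eq F_def E_def J_def intro!: sandwich_unit_blocks)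
  finally have "one = bsmul R (\<Sum>j\<in>J. case j of (i, r, s, q) \<Rightarrow> unit_block (bar q * y i r r * q) i s s)"
    using one_eq by simp
  \<comment> \<open>The entry (0,0) of block \<open>i\<close>, which exists since
    \<open>0 < n i\<close>, retains the terms with \<open>s = 0\<close>, leaving the sum over
    \<open>r\<close> and \<open>q\<close>.\<close>
  then have "one i 0 0 = smul R ((\<Sum>j\<in>J. case j of (i, r, s, q) \<Rightarrow> unit_block (bar q * y i r r * q) i s s) i 0 0)"
    by metis
  moreover have "one i 0 0 = 1" using i by (simp add: one_eq_blocks_one blocks_one_def)
  moreover have "(\<Sum>j\<in>J. case j of (i, r, s, q) \<Rightarrow> unit_block (bar q * y i r r * q) i s s) i 0 0 =
      (\<Sum>r<n i. \<Sum>q\<in>Q (D i). bar q * y i r r * q)"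
    unfolding sum_J using i by (simp add: sum_fun_apply unit_block_def distrib_ifs sum_if_const cong: if_cong)
  moreover have "\<dots> = (\<Sum>q\<in>Q (D i). bar q * Tr n y i * q)"
    by (subst sum.swap) (simp add: Tr_def sum_distrib_left sum_distrib_right)
  ultimately show ?thesis by simp
qed

end

section \<open>The isomorphism with a direct sum of matrix algebras\<close>

locale frob_alg_coefficients = coefficients smul \<rho> Dom Q bar + frob_alg scale mult one \<epsilon> I e f R
  for smul :: "'k::field \<Rightarrow> 'd::ring_1 \<Rightarrow> 'd" and \<rho> and Dom :: "'c \<Rightarrow> 'd set" and Q bar
    and scale :: "'k \<Rightarrow> 'v::ab_group_add \<Rightarrow> 'v" (infixr \<open>\<star>\<close> 75) and mult (infixl \<open>\<odot>\<close> 70)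
    and one \<epsilon> and I :: "'i set" and e f R +
  assumes classification:
    "division_corner p \<Longrightarrow> p \<in> corner one \<Longrightarrow> \<exists>c \<psi>. corner_iso p smul (Dom c) \<psi>"
begin

text \<open>
  The isomorphism sends \<open>a\<close> to the matrices with entries \<open>u\<^sub>i\<^sub>r a v\<^sub>i\<^sub>s\<close> in the division algebras \<open>P\<^sub>i A P\<^sub>i\<close>.
\<close>

lemma exists_matrix_iso:
  obtains N n D \<phi> where "\<forall>i<N. 0 < n i" "bij_betw \<phi> (corner one) (matrices N n D)" "\<phi> one = blocks_one N n"
    "\<And>a b. \<phi> (a + b) = \<phi> a + \<phi> b" "\<And>c a. \<phi> (c \<star> a) = bsmul c (\<phi> a)"
    "\<And>a b. a \<in> corner one \<Longrightarrow> \<phi> (a \<odot> b) = blocks_mult n (\<phi> a) (\<phi> b)"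
proof -
  obtain N :: nat and n :: "nat \<Rightarrow> nat" and P u v where
    P: "\<And>i. i < N \<Longrightarrow> 0 < n i \<and> division_corner (P i) \<and> P i \<in> corner one"
    and uP: "\<And>i r. i < N \<Longrightarrow> r < n i \<Longrightarrow> P i \<odot> u i r = u i r \<and> v i r \<odot> P i = v i r"
    and uv: "\<And>i r s. i < N \<Longrightarrow> r < n i \<Longrightarrow> s < n i \<Longrightarrow> u i r \<odot> v i s = (if r = s then P i else 0)"
    and uav: "\<And>i j r s a. i < N \<Longrightarrow> j < N \<Longrightarrow> r < n i \<Longrightarrow> s < n j \<Longrightarrow> i \<noteq> j \<Longrightarrow> u i r \<odot> a \<odot> v j s = 0"
    and u1: "\<And>i r. i < N \<Longrightarrow> r < n i \<Longrightarrow> one \<odot> v i r = v i r \<and> u i r \<odot> one = u i r"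
    and one_uv: "one = (\<Sum>i<N. \<Sum>r<n i. v i r \<odot> u i r)"
    by (rule exists_matrix_units, rule that)
  have "\<forall>i. \<exists>c \<psi>. i < N \<longrightarrow> corner_iso (P i) smul (Dom c) \<psi>" using classification P by blast
  then obtain D \<psi> where iso: "\<And>i. i < N \<Longrightarrow> corner_iso (P i) smul (Dom (D i)) (\<psi> i)" by metis
  have bij: "bij_betw (\<psi> i) (corner (P i)) (Dom (D i))" and \<psi>P: "\<psi> i (P i) = 1"
    and \<psi>_hom: "\<And>a b. a \<in> corner (P i) \<Longrightarrow> b \<in> corner (P i) \<Longrightarrow> \<psi> i (a + b) = \<psi> i a + \<psi> i b \<and> \<psi> i (a \<odot> b) = \<psi> i a * \<psi> i b"
    and \<psi>_scale: "\<And>c a. a \<in> corner (P i) \<Longrightarrow> \<psi> i (c \<star> a) = smul c (\<psi> i a)" if "i < N" for i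
    using iso[OF that] by (auto simp: corner_iso_def)
  have \<psi>0: "\<psi> i 0 = 0" if "i < N" for i
    using \<psi>_scale[OF that corner_closed(1), of 0] by simp
  have \<psi>_sum: "\<psi> i (\<Sum>t\<in>T. g t) = (\<Sum>t\<in>T. \<psi> i (g t))"
    if "i < N" "\<And>t. t \<in> T \<Longrightarrow> g t \<in> corner (P i)" for i T and g :: "nat \<Rightarrow> 'v"
    using that(2)
    by (induction T rule: infinite_finite_induct)
      (auto simp: \<psi>0 \<psi>_hom that(1) subspace_sum[OF subspace_corner])
  have mem: "u i r \<odot> a \<odot> v i s \<in> corner (P i)" if "i < N" "r < n i" "s < n i" for i r s a
  proof -
    have "P i \<odot> (u i r \<odot> a \<odot> v i s) = (P i \<odot> u i r) \<odot> a \<odot> v i s" by (simp only: mult_assoc)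
    moreover have "(u i r \<odot> a \<odot> v i s) \<odot> P i = u i r \<odot> a \<odot> (v i s \<odot> P i)" by (simp only: mult_assoc)
    ultimately show ?thesis using that uP by (simp add: corner_def)
  qed
  define \<phi> where "\<phi> a = (\<lambda>i r s. if i < N \<and> r < n i \<and> s < n i then \<psi> i (u i r \<odot> a \<odot> v i s) else 0)" for a
  define \<theta> where "\<theta> i = inv_into (corner (P i)) (\<psi> i)" for i
  \<comment> \<open>The inverse of \<open>\<phi>\<close>: an entry \<open>d\<close> at position
    \<open>r\<close>, \<open>s\<close> goes back to \<open>v_r d u_s\<close>.\<close>
  define \<Psi> where "\<Psi> m = (\<Sum>i<N. \<Sum>r<n i. \<Sum>s<n i. v i r \<odot> \<theta> i (m i r s) \<odot> u i s)" for m
  have \<theta>_mem: "\<theta> i d \<in> corner (P i)" and \<psi>\<theta>: "\<psi> i (\<theta> i d) = d" if "i < N" "d \<in> Dom (D i)" for i d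
    using bij[OF that(1)] that(2) unfolding \<theta>_def
    by (auto simp: bij_betw_def f_inv_into_f inv_into_into)
  have \<theta>\<psi>: "\<theta> i (\<psi> i a) = a" if "i < N" "a \<in> corner (P i)" for i a
    using bij[OF that(1)] that(2) unfolding \<theta>_def by (simp add: bij_betw_inv_into_left)
  have diag: "a = (\<Sum>i<N. \<Sum>r<n i. \<Sum>s<n i. v i r \<odot> (u i r \<odot> a \<odot> v i s) \<odot> u i s)" if "a \<in> corner one" for a
  proof -
    \<comment> \<open>Both factors \<open>one\<close> are expanded as \<open>\<Sum> v u\<close>;
      terms between different blocks vanish by \<open>uav\<close>.\<close>
    have "a = one \<odot> (a \<odot> one)" using that by (simp add: corner_unit)
    also have "\<dots> = (\<Sum>i<N. \<Sum>r<n i. v i r \<odot> (u i r \<odot> a \<odot> one))"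
      by (subst one_uv) (simp add: sum_mult mult_assoc)
    also have "\<dots> = (\<Sum>i<N. \<Sum>r<n i. \<Sum>j<N. \<Sum>s<n j. v i r \<odot> (u i r \<odot> a \<odot> v j s) \<odot> u j s)"
      by (subst one_uv) (simp add: mult_sum mult_assoc)
    also have "\<dots> = (\<Sum>i<N. \<Sum>r<n i. \<Sum>j<N. if j = i then (\<Sum>s<n i. v i r \<odot> (u i r \<odot> a \<odot> v i s) \<odot> u i s) else 0)"
      by (intro sum.cong refl) (auto simp: uav)
    finally show ?thesis by simp
  qed
  have \<Psi>\<phi>: "\<Psi> (\<phi> a) = a" if "a \<in> corner one" for a
  proof -
    have "\<Psi> (\<phi> a) = (\<Sum>i<N. \<Sum>r<n i. \<Sum>s<n i. v i r \<odot> (u i r \<odot> a \<odot> v i s) \<odot> u i s)"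
      unfolding \<Psi>_def \<phi>_def by (intro sum.cong refl) (auto simp: \<theta>\<psi> mem)
    then show ?thesis using diag[OF that] by simp
  qed
  have \<phi>_mem: "\<phi> a \<in> matrices N n D" for a
    using bij_betwE[OF bij] mem by (auto simp: matrix_sum_def \<phi>_def)
  have \<Psi>_mem: "\<Psi> m \<in> corner one" for m
  proof -
    have "v i r \<odot> d \<odot> u i s \<in> corner one" if "i < N" "r < n i" "s < n i" for i r s d
      using u1 uP P that unfolding corner_def
      by (simp add: mult_assoc[of _ "u i s" one]) (metis mult_assoc)
    then show ?thesis unfolding \<Psi>_def by (intro subspace_sum[OF subspace_corner]) auto
  qed
  have \<phi>\<Psi>: "\<phi> (\<Psi> m) = m" if m: "m \<in> matrices N n D" for m
  proof (intro ext)
    fix i r s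
    have m0: "if i < N \<and> r < n i \<and> s < n i then m i r s \<in> Dom (D i) else m i r s = 0" for i r s
      using m unfolding matrix_sum_def by blast
    show "\<phi> (\<Psi> m) i r s = m i r s"
    proof (cases "i < N \<and> r < n i \<and> s < n i")
      case True
      then have irs: "i < N" "r < n i" "s < n i" and md: "m i r s \<in> Dom (D i)" using m0[of i r s] by auto
      have orth: "u i r \<odot> v j t = 0" if "j < N" "t < n j" "j \<noteq> i" for j t
        using uav[OF irs(1) that(1) irs(2) that(2), of one] u1 irs that by simp
      have "u i r \<odot> \<Psi> m \<odot> v i s =
        (\<Sum>j<N. \<Sum>r'<n j. \<Sum>s'<n j. (u i r \<odot> v j r') \<odot> \<theta> j (m j r' s') \<odot> (u j s' \<odot> v i s))"
        unfolding \<Psi>_def by (simp add: sum_mult mult_sum mult_assoc)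
      also have "\<dots> = (\<Sum>j<N. if j = i then
          (\<Sum>r'<n i. if r' = r then (\<Sum>s'<n i. if s' = s then P i \<odot> \<theta> i (m i r s) \<odot> P i else 0) else 0) else 0)"
        using irs by (intro sum.cong refl) (auto simp: uv orth intro!: sum.cong sum.neutral simp del: sum.delta sum.delta')
      also have "\<dots> = P i \<odot> \<theta> i (m i r s) \<odot> P i" using irs by simp
      also have "\<dots> = \<theta> i (m i r s)" using \<theta>_mem[OF irs(1) md] by (simp add: corner_unit)
      finally show ?thesis using irs md by (simp add: \<phi>_def \<psi>\<theta>)
    next
      case False
      then show ?thesis using m0[of i r s] unfolding \<phi>_def by (simp only: if_False)
    qed
  qed
  have "bij_betw \<phi> (corner one) (matrices N n D)"
    using \<Psi>\<phi> \<phi>\<Psi> \<phi>_mem \<Psi>_mem by (intro bij_betw_byWitness[of _ \<Psi>]) auto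
  moreover have "\<phi> one = blocks_one N n"
    by (intro ext) (auto simp: \<phi>_def blocks_one_def uv u1 \<psi>0 \<psi>P)
  moreover have "\<phi> (a + b) = \<phi> a + \<phi> b" for a b
    by (intro ext) (auto simp: \<phi>_def bilinear \<psi>_hom mem)
  moreover have "\<phi> (c \<star> a) = bsmul c (\<phi> a)" for c a
    by (intro ext) (auto simp: \<phi>_def bilinear \<psi>_scale mem)
  moreover have "\<phi> (a \<odot> b) = blocks_mult n (\<phi> a) (\<phi> b)" if a: "a \<in> corner one" for a b
  proof (intro ext)
    fix i r s
    show "\<phi> (a \<odot> b) i r s = blocks_mult n (\<phi> a) (\<phi> b) i r s"
    proof (cases "i < N \<and> r < n i \<and> s < n i")
      case True
      then have irs: "i < N" "r < n i" "s < n i" by auto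
      \<comment> \<open>Inserting \<open>one = \<Sum> v u\<close> between \<open>a\<close> and
        \<open>b\<close> turns the product into matrix multiplication of entries.\<close>
      have "u i r \<odot> (a \<odot> b) \<odot> v i s = u i r \<odot> (a \<odot> one) \<odot> b \<odot> v i s"
        using a by (simp add: corner_unit mult_assoc)
      also have "\<dots> = (\<Sum>j<N. \<Sum>t<n j. (u i r \<odot> a \<odot> v j t) \<odot> (u j t \<odot> b \<odot> v i s))"
        unfolding one_uv by (simp add: sum_mult mult_sum mult_assoc)
      also have "\<dots> = (\<Sum>j<N. if j = i then (\<Sum>t<n i. (u i r \<odot> a \<odot> v i t) \<odot> (u i t \<odot> b \<odot> v i s)) else 0)"
        using irs by (intro sum.cong refl) (auto simp: uav)
      also have "\<dots> = (\<Sum>t<n i. (u i r \<odot> a \<odot> v i t) \<odot> (u i t \<odot> b \<odot> v i s))" using irs by simp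
      finally have "u i r \<odot> (a \<odot> b) \<odot> v i s = (\<Sum>t<n i. (u i r \<odot> a \<odot> v i t) \<odot> (u i t \<odot> b \<odot> v i s))" .
      then have "\<psi> i (u i r \<odot> (a \<odot> b) \<odot> v i s) = (\<Sum>t<n i. \<psi> i (u i r \<odot> a \<odot> v i t) * \<psi> i (u i t \<odot> b \<odot> v i s))"
        using irs by (simp only:) (subst \<psi>_sum; auto simp: mem corner_closed \<psi>_hom intro!: sum.cong)
      then show ?thesis using irs by (auto simp: \<phi>_def blocks_mult_def intro!: sum.cong)
    qed (auto simp: \<phi>_def blocks_mult_def intro!: sum.neutral[symmetric])
  qed
  ultimately show thesis using P by (intro that[of N n \<phi> D]) auto
qed

theorem exists_matrix_model:
  obtains N n D \<phi> x y where "\<forall>i<N. 0 < n i" "bij_betw \<phi> (corner one) (matrices N n D)"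
    "\<And>a b. \<phi> (a + b) = \<phi> a + \<phi> b" "\<And>c a. \<phi> (c \<star> a) = bsmul c (\<phi> a)"
    "\<And>a b. a \<in> corner one \<Longrightarrow> \<phi> (a \<odot> b) = blocks_mult n (\<phi> a) (\<phi> b)"
    "mutually_inverse N n (\<lambda>i. Dom (D i)) x y"
    "\<And>a. a \<in> corner one \<Longrightarrow> \<epsilon> a = trace_form N n (blocks_mult n x (\<phi> a))"
proof -
  obtain N n D \<phi> where pos: "\<forall>i<N. 0 < n i" and bij: "bij_betw \<phi> (corner one) (matrices N n D)"
    and \<phi>_one: "\<phi> one = blocks_one N n" and \<phi>_add: "\<And>a b. \<phi> (a + b) = \<phi> a + \<phi> b"
    and \<phi>_scale: "\<And>c a. \<phi> (c \<star> a) = bsmul c (\<phi> a)"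
    and \<phi>_mult: "\<And>a b. a \<in> corner one \<Longrightarrow> \<phi> (a \<odot> b) = blocks_mult n (\<phi> a) (\<phi> b)"
    by (rule exists_matrix_iso, rule that)
  have \<phi>0: "\<phi> 0 = 0" using \<phi>_add[of 0 0] by simp
  have \<phi>_sum: "\<phi> (sum g T) = (\<Sum>t\<in>T. \<phi> (g t))" for g and T :: "'z set"
    by (induction T rule: infinite_finite_induct) (simp_all add: \<phi>0 \<phi>_add)
  define \<Psi> where "\<Psi> = inv_into (corner one) \<phi>"
  have \<phi>_mem: "\<phi> a \<in> matrices N n D" and \<Psi>\<phi>: "\<Psi> (\<phi> a) = a" if "a \<in> corner one" for a
    using bij that unfolding \<Psi>_def by (auto simp: bij_betw_def)
  have \<Psi>_mem: "\<Psi> m \<in> corner one" and \<phi>\<Psi>: "\<phi> (\<Psi> m) = m" if "m \<in> matrices N n D" for m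
    using bij that unfolding \<Psi>_def by (auto simp: bij_betw_def f_inv_into_f inv_into_into)
  \<comment> \<open>The values of the form on the basis \<open>q E_rs\<close> are the coefficients
    of \<open>x\<close> with respect to the dual elements \<open>bar q\<close>; the indices are
    transposed, as the trace form pairs position \<open>s\<close>, \<open>r\<close> with
    \<open>r\<close>, \<open>s\<close>.\<close>
  define x where "x = (\<lambda>i s r. if i < N \<and> s < n i \<and> r < n i then
      \<Sum>q\<in>Q (D i). smul (\<epsilon> (\<Psi> (unit_block q i r s))) (bar q) else 0)"
  have x: "x \<in> matrices N n D"
    by (auto simp: matrix_sum_def x_def intro!: Dom_sum Dom_smul Q_mem(2))
  have form: "\<epsilon> a = trace_form N n (blocks_mult n x (\<phi> a))" if a: "a \<in> corner one" for a
  proof -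
    let ?b = "\<Sum>i<N. \<Sum>r<n i. \<Sum>s<n i. \<Sum>q\<in>Q (D i). \<rho> (\<phi> a i r s * bar q) \<star> \<Psi> (unit_block q i r s)"
    have U: "unit_block q i r s \<in> matrices N n D" if "i < N" "r < n i" "s < n i" "q \<in> Q (D i)" for i r s q
      using that Q_mem by (intro unit_block_mem) auto
    have "\<phi> ?b = (\<Sum>i<N. \<Sum>r<n i. \<Sum>s<n i. \<Sum>q\<in>Q (D i). bsmul (\<rho> (\<phi> a i r s * bar q)) (unit_block q i r s))"
      unfolding \<phi>_sum \<phi>_scale by (intro sum.cong refl) (simp add: \<phi>\<Psi> U)
    also have "\<dots> = \<phi> a" using blocks_expand[OF \<phi>_mem[OF a]] by simp
    finally have "\<phi> ?b = \<phi> a" .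
    moreover have "?b \<in> corner one"
      by (intro subspace_sum[OF subspace_corner] corner_closed \<Psi>_mem U) auto
    ultimately have "?b = a" using \<Psi>\<phi>[of ?b] \<Psi>\<phi>[OF a] by simp
    then have "\<epsilon> a = \<epsilon> ?b" by simp
    also have "\<dots> = trace_form N n (blocks_mult n x (\<phi> a))"
      unfolding trace_form_eq form_sum form_scale
      by (rule sum.cong[OF refl], subst sum.swap, intro sum.cong refl)
        (simp add: x_def sum_distrib_right re_sum smul_mult re_smul re_commute[of "bar _"] mult.commute)
    finally show ?thesis .
  qed
  define X where "X = \<Psi> x"
  have X: "X \<in> corner one" "\<phi> X = x" using x by (auto simp: X_def \<Psi>_mem \<phi>\<Psi>)
  have form': "\<epsilon> a = trace_form N n (\<phi> (X \<odot> a))" if "a \<in> corner one" for a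
    using form[OF that] by (simp add: \<phi>_mult X)
  obtain Y where Y: "Y \<in> corner one" "X \<odot> Y \<odot> X = X" using von_neumann_regular[OF X(1)] by blast
  \<comment> \<open>Regularity gives \<open>X (Y X - 1) = 0\<close>. As the form of \<open>a\<close>
    is the trace form of \<open>X a\<close>, it vanishes on \<open>(Y X - 1) b\<close> for all
    \<open>b\<close>, and non-degeneracy applies.\<close>
  have YX: "Y \<odot> X = one"
  proof -
    have "Y \<odot> X - one = 0"
    proof (rule form_nondegenerate(1))
      show "Y \<odot> X - one \<in> corner one" by (intro corner_closed X Y one_mem)
      fix b assume b: "b \<in> corner one"
      have "X \<odot> ((Y \<odot> X - one) \<odot> b) = (X \<odot> Y \<odot> X - X) \<odot> b"
        using X b by (simp add: bilinear mult_assoc corner_unit)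
      then show "\<epsilon> ((Y \<odot> X - one) \<odot> b) = 0"
        using form'[of "(Y \<odot> X - one) \<odot> b"] b X Y
        by (simp add: corner_closed one_mem \<phi>0 trace_form_def Tr_def)
    qed
    then show ?thesis by simp
  qed
  \<comment> \<open>Now \<open>(X Y - 1) X = 0\<close>, and cyclicity of the trace form moves the
    leading \<open>X\<close> to the right end.\<close>
  have XY: "X \<odot> Y = one"
  proof -
    have "X \<odot> Y - one = 0"
    proof (rule form_nondegenerate(2))
      show mem: "X \<odot> Y - one \<in> corner one" by (intro corner_closed X Y one_mem)
      fix b assume b: "b \<in> corner one"
      have "\<epsilon> (b \<odot> (X \<odot> Y - one)) = trace_form N n (\<phi> (X \<odot> (b \<odot> (X \<odot> Y - one))))"
        by (rule form'[OF corner_closed(5)[OF b mem]])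
      also have "\<dots> = trace_form N n (\<phi> ((b \<odot> (X \<odot> Y - one)) \<odot> X))"
        using X b mem by (simp only: \<phi>_mult corner_closed) (rule trace_form_commute)
      also have "(b \<odot> (X \<odot> Y - one)) \<odot> X = b \<odot> (X \<odot> Y \<odot> X - X)"
        using X by (simp add: bilinear mult_assoc corner_unit)
      finally show "\<epsilon> (b \<odot> (X \<odot> Y - one)) = 0"
        using Y by (simp add: \<phi>0 trace_form_def Tr_def)
    qed
    then show ?thesis by simp
  qed
  have "mutually_inverse N n (\<lambda>i. Dom (D i)) x (\<phi> Y)"
    unfolding mutually_inverse_def using x \<phi>_mem[OF Y(1)] \<phi>_one XY YX \<phi>_mult X Y(1) by metis
  with pos bij \<phi>_add \<phi>_scale \<phi>_mult show thesis using form by (rule that)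
qed

end

section \<open>The algebra of a planar state sum model\<close>

text \<open>By \<open>A B = 1\<close> the rows of \<open>B\<close> span all unit vectors, so
  counting makes them independent. Each row of \<open>B A - 1\<close> is a relation between them,
  because \<open>(B A - 1) B = 0\<close>.\<close>

lemma left_inverse_imp_right_inverse:
  fixes A B :: "'s \<Rightarrow> 's \<Rightarrow> 'k::field"
  assumes fin: "finite S"
    and inv: "\<And>i j. i \<in> S \<Longrightarrow> j \<in> S \<Longrightarrow> (\<Sum>k\<in>S. A i k * B k j) = (if i = j then 1 else 0)"
    and ij: "i \<in> S" "j \<in> S"
  shows "(\<Sum>k\<in>S. B i k * A k j) = (if i = j then 1 else 0)"
proof -
  interpret fs: vector_space "\<lambda>(c::'k) f (x::'s). c * f x"
    by unfold_locales (simp_all add: fun_eq_iff algebra_simps)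
  define r where "r k = (\<lambda>j. if j \<in> S then B k j else 0)" for k
  define \<delta> where "\<delta> i = (\<lambda>j::'s. if j = i then 1 else 0 :: 'k)" for i
  have \<delta>: "\<delta> i = (\<Sum>k\<in>S. (\<lambda>x. A i k * r k x))" if "i \<in> S" for i
  proof
    fix x show "\<delta> i x = (\<Sum>k\<in>S. (\<lambda>x. A i k * r k x)) x"
      using inv[OF that] that by (cases "x \<in> S") (auto simp: \<delta>_def r_def sum_fun_apply)
  qed
  have inj: "inj_on \<delta> S" by (auto simp: inj_on_def \<delta>_def fun_eq_iff split: if_splits)
  have indep: "\<not> fs.dependent (\<delta> ` S)"
  proof (rule fs.independent_if_scalars_zero)
    show "finite (\<delta> ` S)" using fin by simp
    fix c x assume "(\<Sum>x\<in>\<delta> ` S. (\<lambda>y. c x * x y)) = 0" and x: "x \<in> \<delta> ` S"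
    then have 0: "(\<Sum>i\<in>S. (\<lambda>y. c (\<delta> i) * \<delta> i y)) = 0" by (simp add: sum.reindex[OF inj])
    obtain i where i: "i \<in> S" "x = \<delta> i" using x by blast
    have "(\<Sum>k\<in>S. (\<lambda>y. c (\<delta> k) * \<delta> k y)) i = c (\<delta> i)"
      using i fin by (simp add: sum_fun_apply \<delta>_def if_distrib cong: if_cong)
    then show "c x = 0" using 0 i by simp
  qed
  have rows_indep: "x i = 0" if x: "\<And>j. j \<in> S \<Longrightarrow> (\<Sum>k\<in>S. x k * B k j) = 0" and i: "i \<in> S" for x i
  proof (rule ccontr)
    assume xi: "x i \<noteq> 0"
    let ?V = "fs.span (r ` (S - {i}))"
    have "x i * r i y + (\<Sum>k\<in>S - {i}. x k * r k y) = 0" for y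
      using x[of y] sum.remove[OF fin i, of "\<lambda>k. x k * B k y"] by (simp add: r_def)
    then have "x i * r i y = - (\<Sum>k\<in>S - {i}. x k * r k y)" for y
      by (simp add: eq_neg_iff_add_eq_0)
    then have "inverse (x i) * (x i * r i y) = inverse (x i) * - (\<Sum>k\<in>S - {i}. x k * r k y)" for y
      by simp
    then have "r i y = (\<Sum>k\<in>S - {i}. (- inverse (x i) * x k) * r k y)" for y
      using xi by (simp add: sum_distrib_left sum_negf mult.assoc flip: mult.assoc[of "inverse (x i)" "x i"])
    then have "r i = (\<Sum>k\<in>S - {i}. (\<lambda>y. (- inverse (x i) * x k) * r k y))"
      by (simp add: fun_eq_iff sum_fun_apply)
    also have "\<dots> \<in> ?V" by (intro fs.span_sum fs.span_scale fs.span_base) auto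
    finally have "r k \<in> ?V" if "k \<in> S" for k
      using that by (cases "k = i") (auto intro: fs.span_base)
    then have "\<delta> ` S \<subseteq> ?V" using \<delta> by (auto intro!: fs.span_sum fs.span_scale)
    moreover have "finite (r ` (S - {i}))" using fin by simp
    ultimately have "card (\<delta> ` S) \<le> card (r ` (S - {i}))"
      using fs.independent_span_bound[OF _ indep, of "r ` (S - {i})"] by simp
    also have "\<dots> \<le> card (S - {i})" using fin by (intro card_image_le) simp
    also have "\<dots> < card S" using fin i by (rule card_Diff1_less)
    finally show False using card_image[OF inj] by simp
  qed
  have "(\<Sum>k\<in>S. ((\<Sum>l\<in>S. B i l * A l k) - (if i = k then 1 else 0)) * B k j) = 0" if j: "j \<in> S" for j
  proof -
    have "(\<Sum>k\<in>S. (\<Sum>l\<in>S. B i l * A l k) * B k j) = (\<Sum>l\<in>S. B i l * (\<Sum>k\<in>S. A l k * B k j))"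
      by (simp add: sum_distrib_left sum_distrib_right mult.assoc) (rule sum.swap)
    also have "\<dots> = B i j" using fin j by (simp add: inv if_distrib cong: if_cong sum.cong)
    also have "\<dots> = (\<Sum>k\<in>S. (if i = k then 1 else 0) * B k j)"
      using fin ij by (simp add: if_distribR if_distrib cong: if_cong)
    finally show ?thesis by (simp only: left_diff_distrib sum_subtractf) simp
  qed
  from rows_indep[OF this ij(2)] show ?thesis by simp
qed

section \<open>Tensor identities from invariance\<close>

locale planar_model =
  fixes X :: "('s, 'v::ab_group_add, 'k::field) ssm"
  assumes planar: "planar_ssm X"
begin

abbreviation S where "S \<equiv> states X"
abbreviation B where "B \<equiv> Bc X"
abbreviation C where "C \<equiv> Cc X"

lemma nondegenerate: "nondegenerate_data X"
  using planar by (simp add: planar_ssm_def)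

lemma diagrammatic: "diagrammatic_data X"
  using nondegenerate by (simp add: nondegenerate_data_def)

sublocale vector_space "scl X"
  using diagrammatic by (simp add: diagrammatic_data_def)

lemma finite_states: "finite S"
  and inj_bas: "inj_on (bas X) S"
  and independent_bas: "\<not> dependent (bas X ` S)"
  using diagrammatic by (auto simp: diagrammatic_data_def)

definition structure_constant :: "'s \<Rightarrow> 's \<Rightarrow> 's \<Rightarrow> 'k" ("\<mu>") where
  "\<mu> a b c = (\<Sum>d\<in>S. C a b d * B d c)"

lemma cyclic: "a \<in> S \<Longrightarrow> b \<in> S \<Longrightarrow> d \<in> S \<Longrightarrow> \<mu> a b d = (\<Sum>e\<in>S. B d e * C e a b)"
  using diagrammatic by (simp add: diagrammatic_data_def structure_constant_def)

lemma Binv_B: "a \<in> S \<Longrightarrow> d \<in> S \<Longrightarrow> (\<Sum>c\<in>S. Binv X a c * B c d) = (if a = d then 1 else 0)"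
proof -
  have "\<exists>b. is_inverse_B X b" using nondegenerate unfolding nondegenerate_data_def by blast
  then have "is_inverse_B X (Binv X)" unfolding Binv_def by (rule someI_ex)
  then show "a \<in> S \<Longrightarrow> d \<in> S \<Longrightarrow> (\<Sum>c\<in>S. Binv X a c * B c d) = (if a = d then 1 else 0)"
    by (simp add: is_inverse_B_def)
qed

lemma B_Binv: "a \<in> S \<Longrightarrow> d \<in> S \<Longrightarrow> (\<Sum>c\<in>S. B a c * Binv X c d) = (if a = d then 1 else 0)"
  using left_inverse_imp_right_inverse[OF finite_states Binv_B] by blast

lemma sum_delta: "a \<in> S \<Longrightarrow> (\<Sum>c\<in>S. (if c = a then 1 else 0) * f c) = f a"
  "a \<in> S \<Longrightarrow> (\<Sum>c\<in>S. (if a = c then 1 else 0) * f c) = (f a :: 'k)"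
  using finite_states by (simp_all add: if_distribR if_distrib cong: if_cong)

text \<open>Straightens a bent leg: contraction with \<open>Binv\<close> undoes contraction with
  \<open>B\<close>. The companion below does this for the other index of \<open>B\<close>.\<close>

lemma B_cancel_left:
  assumes T: "\<And>c. c \<in> S \<Longrightarrow> (\<Sum>g\<in>S. B g c * T g) = 0" and a: "a \<in> S"
  shows "T a = 0"
proof -
  have "T a = (\<Sum>g\<in>S. (\<Sum>c\<in>S. B g c * Binv X c a) * T g)"
    using sum_delta(1)[OF a, of T] a by (simp add: B_Binv cong: sum.cong)
  also have "\<dots> = (\<Sum>c\<in>S. Binv X c a * (\<Sum>g\<in>S. B g c * T g))"
    by (simp add: sum_distrib_left sum_distrib_right ac_simps) (rule sum.swap)
  also have "\<dots> = 0" by (simp add: T)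
  finally show ?thesis .
qed

lemma B_cancel_right:
  assumes T: "\<And>d. d \<in> S \<Longrightarrow> (\<Sum>e\<in>S. B d e * T e) = 0" and a: "a \<in> S"
  shows "T a = 0"
proof -
  have "T a = (\<Sum>e\<in>S. (\<Sum>d\<in>S. Binv X a d * B d e) * T e)"
    using sum_delta(2)[OF a, of T] a by (simp add: Binv_B cong: sum.cong)
  also have "\<dots> = (\<Sum>d\<in>S. Binv X a d * (\<Sum>e\<in>S. B d e * T e))"
    by (simp add: sum_distrib_left sum_distrib_right ac_simps) (rule sum.swap)
  also have "\<dots> = 0" by (simp add: T)
  finally show ?thesis .
qed

text \<open>A vertex with two upward legs is the product with its second input bent upwards to
  become the right-hand output.\<close>

lemma weight_fork: "weight X [a] [d, c] = (\<Sum>g\<in>S. B g c * \<mu> a g d)"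
  by (simp add: structure_constant_def sum_distrib_left ac_simps)

lemma weight_join: "weight X [a, b] [c] = \<mu> a b c"
  by (simp add: structure_constant_def)

text \<open>The 2-2 relation is this identity with the third input contracted with
  \<open>B g e\<close>; the bent leg is straightened by \<open>B_cancel_left\<close>.\<close>

lemma structure_constant_assoc:
  assumes S: "a \<in> S" "b \<in> S" "c \<in> S" "d \<in> S"
  shows "(\<Sum>y\<in>S. \<mu> a b y * \<mu> y c d) = (\<Sum>z\<in>S. \<mu> b c z * \<mu> a z d)"
proof -
  have "(\<Sum>y\<in>S. \<mu> a b y * \<mu> y c d) - (\<Sum>z\<in>S. \<mu> b c z * \<mu> a z d) = 0"
  proof (rule B_cancel_left[OF _ S(3)])
    fix e assume "e \<in> S"
    then have eq: "(\<Sum>y\<in>S. \<mu> a b y * (\<Sum>g\<in>S. B g e * \<mu> y g d)) = (\<Sum>z\<in>S. (\<Sum>g\<in>S. B g e * \<mu> b g z) * \<mu> a z d)"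
      using planar_ssm_2_2[OF planar S(1,2) _ S(4)] by (simp only: weight_fork weight_join)
    have "(\<Sum>y\<in>S. \<mu> a b y * (\<Sum>g\<in>S. B g e * \<mu> y g d)) = (\<Sum>g\<in>S. B g e * (\<Sum>y\<in>S. \<mu> a b y * \<mu> y g d))"
      by (simp add: sum_distrib_left ac_simps) (rule sum.swap)
    moreover have "(\<Sum>z\<in>S. (\<Sum>g\<in>S. B g e * \<mu> b g z) * \<mu> a z d) = (\<Sum>g\<in>S. B g e * (\<Sum>z\<in>S. \<mu> b g z * \<mu> a z d))"
      by (simp add: sum_distrib_left sum_distrib_right ac_simps) (rule sum.swap)
    ultimately show "(\<Sum>g\<in>S. B g e * ((\<Sum>y\<in>S. \<mu> a b y * \<mu> y g d) - (\<Sum>z\<in>S. \<mu> b g z * \<mu> a z d))) = 0"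
      using eq by (simp add: right_diff_distrib sum_subtractf)
  qed
  then show ?thesis by simp
qed

text \<open>The fork of the inner triangle becomes \<open>B g w\<close> and a product, so the
  right-hand side is the component \<open>c\<close> of \<open>R B^{gw} (a e_g) (e_w b)\<close>, in a
  shape ready for associativity.\<close>

lemma structure_constant_1_3:
  assumes S: "a \<in> S" "b \<in> S" "c \<in> S"
  shows "\<mu> a b c = Rc X * (\<Sum>g\<in>S. \<Sum>w\<in>S. B g w * (\<Sum>u\<in>S. \<Sum>z\<in>S. \<mu> a g u * \<mu> w b z * \<mu> u z c))"
proof -
  have "(\<Sum>w\<in>S. \<Sum>u\<in>S. \<Sum>z\<in>S. (\<Sum>g\<in>S. B g w * \<mu> a g u) * \<mu> w b z * \<mu> u z c) =
      (\<Sum>w\<in>S. \<Sum>u\<in>S. \<Sum>z\<in>S. \<Sum>g\<in>S. B g w * (\<mu> a g u * \<mu> w b z * \<mu> u z c))"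
    by (simp add: sum_distrib_left sum_distrib_right ac_simps)
  also have "\<dots> = (\<Sum>w\<in>S. \<Sum>u\<in>S. \<Sum>g\<in>S. \<Sum>z\<in>S. B g w * (\<mu> a g u * \<mu> w b z * \<mu> u z c))"
    by (rule sum.cong[OF refl], rule sum.cong[OF refl], rule sum.swap)
  also have "\<dots> = (\<Sum>w\<in>S. \<Sum>g\<in>S. \<Sum>u\<in>S. \<Sum>z\<in>S. B g w * (\<mu> a g u * \<mu> w b z * \<mu> u z c))"
    by (rule sum.cong[OF refl], rule sum.swap)
  also have "\<dots> = (\<Sum>g\<in>S. \<Sum>w\<in>S. \<Sum>u\<in>S. \<Sum>z\<in>S. B g w * (\<mu> a g u * \<mu> w b z * \<mu> u z c))"
    by (rule sum.swap)
  finally show ?thesis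
    using planar_ssm_1_3[OF planar S] by (simp add: weight_fork weight_join sum_distrib_left del: weight.simps)
qed

end

lemma sum_push:
  "(\<Sum>e\<in>E. \<Sum>b\<in>F. \<Sum>c\<in>G. g e b c) = (\<Sum>b\<in>F. \<Sum>c\<in>G. \<Sum>e\<in>E. g e b c)"
  by (subst sum.swap) (rule sum.cong[OF refl], rule sum.swap)

section \<open>The product on the space of the model\<close>

context planar_model
begin

text \<open>
  Coordinates are extended linearly from the space of the model to the ambient type, and with them the
  product and the form, so that bilinearity and associativity hold without membership conditions.
\<close>

definition cf :: "'s \<Rightarrow> 'v \<Rightarrow> 'k" where
  "cf a v = representation (extend_basis (bas X ` S)) v (bas X a)"

definition vec :: "('s \<Rightarrow> 'k) \<Rightarrow> 'v" where
  "vec h = (\<Sum>a\<in>S. scl X (h a) (bas X a))"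

lemma cf_add: "cf a (x + y) = cf a x + cf a y"
  and cf_scale: "cf a (scl X c x) = c * cf a x"
  using independent_extend_basis[OF independent_bas] span_extend_basis[OF independent_bas]
  by (simp_all add: cf_def representation_add representation_scale)

lemma cf_zero [simp]: "cf a 0 = 0"
  using cf_scale[of a 0 0] by simp

lemma cf_sum: "cf a (sum g T) = (\<Sum>t\<in>T. cf a (g t))"
  by (induction T rule: infinite_finite_induct) (simp_all add: cf_add)

lemma cf_bas: "a \<in> S \<Longrightarrow> b \<in> S \<Longrightarrow> cf a (bas X b) = (if a = b then 1 else 0)"
  using representation_basis[OF independent_extend_basis[OF independent_bas], of "bas X b"]
    extend_basis_superset[OF independent_bas] inj_on_eq_iff[OF inj_bas]
  by (auto simp: cf_def)

lemma cf_vec: "a \<in> S \<Longrightarrow> cf a (vec h) = h a"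
  using finite_states by (simp add: vec_def cf_sum cf_scale cf_bas if_distrib cong: if_cong sum.cong)

lemma sum_cf_bas: "a \<in> S \<Longrightarrow> (\<Sum>c\<in>S. cf c (bas X a) * f c) = f a"
  using sum_delta(1)[of a f] by (simp add: cf_bas cong: sum.cong)

lemma vec_cong: "(\<And>a. a \<in> S \<Longrightarrow> h a = k a) \<Longrightarrow> vec h = vec k"
  by (simp add: vec_def cong: sum.cong)

lemma vec_add: "vec h + vec k = vec (\<lambda>a. h a + k a)"
  by (simp add: vec_def scale_left_distrib sum.distrib)

lemma vec_scale: "scl X c (vec h) = vec (\<lambda>a. c * h a)"
  by (simp add: vec_def scale_sum_right)

lemma vec_sum: "(\<Sum>t\<in>T. vec (h t)) = vec (\<lambda>a. \<Sum>t\<in>T. h t a)"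
  unfolding vec_def by (subst sum.swap) (simp add: scale_sum_left)

lemma vec_mem: "vec h \<in> space_of X"
  unfolding vec_def space_of_def by (intro span_sum span_scale span_base) simp

lemma coord_eq: "v \<in> space_of X \<Longrightarrow> coord X v a = cf a v"
  using representation_extend[OF independent_extend_basis[OF independent_bas]]
    extend_basis_superset[OF independent_bas]
  by (simp add: coord_def cf_def space_of_def)

lemma vec_cf: "v \<in> space_of X \<Longrightarrow> vec (\<lambda>a. cf a v) = v"
proof -
  assume v: "v \<in> space_of X"
  have "v = (\<Sum>b\<in>bas X ` S. scl X (representation (bas X ` S) v b) b)"
    by (rule sum_representation_eq[symmetric])
      (use v finite_states independent_bas in \<open>auto simp: space_of_def\<close>)
  also have "\<dots> = (\<Sum>a\<in>S. scl X (coord X v a) (bas X a))"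
    by (simp add: sum.reindex[OF inj_bas] coord_def)
  finally show ?thesis by (simp add: vec_def coord_eq[OF v])
qed

definition mult :: "'v \<Rightarrow> 'v \<Rightarrow> 'v" (infixl \<open>\<odot>\<close> 70) where
  "x \<odot> y = vec (\<lambda>c. \<Sum>a\<in>S. \<Sum>b\<in>S. cf a x * cf b y * \<mu> a b c)"

lemma cf_mult: "c \<in> S \<Longrightarrow> cf c (x \<odot> y) = (\<Sum>a\<in>S. \<Sum>b\<in>S. cf a x * cf b y * \<mu> a b c)"
  by (simp add: mult_def cf_vec)

lemma mult_of_eq:
  assumes "x \<in> space_of X" "y \<in> space_of X"
  shows "mult_of X x y = x \<odot> y"
proof -
  have "mult_of X x y = (\<Sum>a\<in>S. \<Sum>b\<in>S. vec (\<lambda>c. cf a x * cf b y * \<mu> a b c))"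
    using assms
    by (simp add: mult_of_def coord_eq structure_constant_def vec_def sum_distrib_left scale_sum_left mult.assoc)
  then show ?thesis by (simp add: vec_sum mult_def)
qed

sublocale assoc_alg "scl X" mult
proof
  fix x y z c
  show "(x + y) \<odot> z = x \<odot> z + y \<odot> z" "x \<odot> (y + z) = x \<odot> y + x \<odot> z"
    by (simp_all add: mult_def vec_add cf_add distrib_left distrib_right sum.distrib)
  show "scl X c x \<odot> y = scl X c (x \<odot> y)" "x \<odot> scl X c y = scl X c (x \<odot> y)"
    by (simp_all add: mult_def vec_scale cf_scale sum_distrib_left ac_simps)
  show "x \<odot> y \<odot> z = x \<odot> (y \<odot> z)"
    unfolding mult_def[of "x \<odot> y"] mult_def[of x "y \<odot> z"]
  proof (rule vec_cong)
    fix d assume d: "d \<in> S"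
    \<comment> \<open>The sums are reordered to bring the intermediate state \<open>e\<close>
      innermost, where associativity of the structure constants applies.\<close>
    have "(\<Sum>e\<in>S. \<Sum>c\<in>S. cf e (x \<odot> y) * cf c z * \<mu> e c d) =
        (\<Sum>e\<in>S. \<Sum>c\<in>S. \<Sum>a\<in>S. \<Sum>b\<in>S. cf a x * cf b y * cf c z * (\<mu> a b e * \<mu> e c d))"
      by (simp add: cf_mult sum_distrib_right sum_distrib_left ac_simps)
    also have "\<dots> = (\<Sum>c\<in>S. \<Sum>a\<in>S. \<Sum>b\<in>S. \<Sum>e\<in>S. cf a x * cf b y * cf c z * (\<mu> a b e * \<mu> e c d))"
      by (subst sum.swap) (intro sum.cong[OF refl] sum_push)
    also have "\<dots> = (\<Sum>c\<in>S. \<Sum>a\<in>S. \<Sum>b\<in>S. cf a x * cf b y * cf c z * (\<Sum>e\<in>S. \<mu> b c e * \<mu> a e d))"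
      using d by (simp add: structure_constant_assoc flip: sum_distrib_left)
    also have "\<dots> = (\<Sum>a\<in>S. \<Sum>b\<in>S. \<Sum>c\<in>S. \<Sum>e\<in>S. cf a x * cf b y * cf c z * (\<mu> b c e * \<mu> a e d))"
      unfolding sum_distrib_left by (rule sum_push)
    also have "\<dots> = (\<Sum>a\<in>S. \<Sum>e\<in>S. \<Sum>b\<in>S. \<Sum>c\<in>S. cf a x * cf b y * cf c z * (\<mu> b c e * \<mu> a e d))"
      by (intro sum.cong[OF refl] sum_push[symmetric])
    also have "\<dots> = (\<Sum>a\<in>S. \<Sum>e\<in>S. cf a x * cf e (y \<odot> z) * \<mu> a e d)"
      by (simp add: cf_mult sum_distrib_right sum_distrib_left ac_simps)
    finally show "(\<Sum>e\<in>S. \<Sum>c\<in>S. cf e (x \<odot> y) * cf c z * \<mu> e c d) =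
        (\<Sum>a\<in>S. \<Sum>e\<in>S. cf a x * cf e (y \<odot> z) * \<mu> a e d)" .
  qed
qed

section \<open>The identity element\<close>

lemma bas_mem: "a \<in> S \<Longrightarrow> bas X a \<in> space_of X"
  unfolding space_of_def by (intro span_base) simp

lemma mult_mem: "x \<odot> y \<in> space_of X"
  unfolding mult_def by (rule vec_mem)

lemma bas_mult_bas: "a \<in> S \<Longrightarrow> b \<in> S \<Longrightarrow> bas X a \<odot> bas X b = vec (\<mu> a b)"
  unfolding mult_def by (intro vec_cong) (simp add: mult.assoc sum_cf_bas flip: sum_distrib_left)

definition one :: 'v where "one = unit_of X"

lemma one_eq: "one = scl X (Rc X) (\<Sum>a\<in>S. \<Sum>b\<in>S. scl X (B a b) (bas X a \<odot> bas X b))"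
  by (simp add: one_def unit_of_def beta_of_def mult_of_eq bas_mem)

lemma one_mem_space: "one \<in> space_of X"
  unfolding one_eq using mult_mem unfolding space_of_def by (intro span_scale span_sum) blast

lemma space_eqI: "x \<in> space_of X \<Longrightarrow> y \<in> space_of X \<Longrightarrow> (\<And>a. a \<in> S \<Longrightarrow> cf a x = cf a y) \<Longrightarrow> x = y"
  using vec_cong[of "\<lambda>a. cf a x" "\<lambda>a. cf a y"] vec_cf[of x] vec_cf[of y] by simp

lemma bas_one_bas:
  assumes "a \<in> S" "b \<in> S" shows "bas X a \<odot> one \<odot> bas X b = bas X a \<odot> bas X b"
proof -
  have "bas X a \<odot> one \<odot> bas X b =
      scl X (Rc X) (\<Sum>g\<in>S. \<Sum>w\<in>S. scl X (B g w) ((bas X a \<odot> bas X g) \<odot> (bas X w \<odot> bas X b)))"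
    by (simp add: one_eq mult_sum sum_mult bilinear mult_assoc)
  also have "\<dots> = vec (\<lambda>c. Rc X * (\<Sum>g\<in>S. \<Sum>w\<in>S. B g w * (\<Sum>u\<in>S. \<Sum>z\<in>S. \<mu> a g u * \<mu> w b z * \<mu> u z c)))"
    using assms by (simp add: bas_mult_bas mult_def[of "vec _"] cf_vec vec_scale vec_sum cong: sum.cong)
  also have "\<dots> = vec (\<mu> a b)"
    using assms by (intro vec_cong) (simp add: structure_constant_1_3[symmetric])
  finally show ?thesis using assms by (simp add: bas_mult_bas)
qed

lemma third_slot_zero:
  assumes x: "x \<in> space_of X" and z: "\<And>a b. a \<in> S \<Longrightarrow> b \<in> S \<Longrightarrow> (\<Sum>c\<in>S. cf c x * C a b c) = 0"
  shows "x = 0"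
proof -
  have "C_form X y z x = 0" if "y \<in> space_of X" "z \<in> space_of X" for y z
  proof -
    have "C_form X y z x = (\<Sum>a\<in>S. \<Sum>b\<in>S. cf a y * cf b z * (\<Sum>c\<in>S. cf c x * C a b c))"
      using that x by (simp add: C_form_def coord_eq sum_distrib_left mult.assoc)
    then show ?thesis by (simp add: assms)
  qed
  then show ?thesis using nondegenerate x unfolding nondegenerate_data_def by blast
qed

text \<open>Cancels the factor \<open>B\<close> that cyclicity puts in front of
  \<open>C\<close>.\<close>

lemma middle_slot:
  assumes z: "\<And>d. d \<in> S \<Longrightarrow> (\<Sum>b\<in>S. h b * (\<Sum>e\<in>S. B d e * K e b)) = 0" and e: "e \<in> S"
  shows "(\<Sum>b\<in>S. h b * K e b) = 0"
proof (rule B_cancel_right[OF _ e])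
  fix d assume d: "d \<in> S"
  have "(\<Sum>e\<in>S. B d e * (\<Sum>b\<in>S. h b * K e b)) = (\<Sum>b\<in>S. h b * (\<Sum>e\<in>S. B d e * K e b))"
    by (simp add: sum_distrib_left ac_simps) (rule sum.swap)
  then show "(\<Sum>e\<in>S. B d e * (\<Sum>b\<in>S. h b * K e b)) = 0" using z[OF d] by simp
qed

lemma cf_bas_mult: "a \<in> S \<Longrightarrow> d \<in> S \<Longrightarrow> cf d (bas X a \<odot> x) = (\<Sum>b\<in>S. cf b x * \<mu> a b d)"
  and cf_mult_bas: "b \<in> S \<Longrightarrow> d \<in> S \<Longrightarrow> cf d (x \<odot> bas X b) = (\<Sum>a\<in>S. cf a x * \<mu> a b d)"
  by (simp_all add: cf_mult mult.assoc sum_cf_bas flip: sum_distrib_left)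

text \<open>By cyclicity the component \<open>d\<close> of \<open>a x\<close> is
  \<open>B^{de} C (e, a, x)\<close>. Cancelling \<open>B\<close> leaves
  \<open>C (\<cdot>, \<cdot>, x) = 0\<close>, the hypothesis of non-degeneracy.\<close>

lemma left_annihilated:
  assumes x: "x \<in> space_of X" and z: "\<And>a. a \<in> S \<Longrightarrow> bas X a \<odot> x = 0"
  shows "x = 0"
proof (rule third_slot_zero[OF x])
  fix e a assume ea: "e \<in> S" "a \<in> S"
  show "(\<Sum>b\<in>S. cf b x * C e a b) = 0"
  proof (rule middle_slot[OF _ ea(1)])
    fix d assume "d \<in> S"
    then show "(\<Sum>b\<in>S. cf b x * (\<Sum>e\<in>S. B d e * C e a b)) = 0"
      using cf_bas_mult[OF ea(2), of d x] z[OF ea(2)] ea by (simp add: cyclic[symmetric])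
  qed
qed

text \<open>Non-degeneracy is assumed for the third slot of \<open>C\<close> only. Here cyclicity
  gives \<open>C (e, x, b) = 0\<close>, hence \<open>e x = 0\<close> for all \<open>e\<close> by
  definition of the product, which is the previous situation.\<close>

lemma right_annihilated:
  assumes x: "x \<in> space_of X" and z: "\<And>b. b \<in> S \<Longrightarrow> x \<odot> bas X b = 0"
  shows "x = 0"
proof (rule left_annihilated[OF x])
  fix e assume e: "e \<in> S"
  have 0: "(\<Sum>a\<in>S. cf a x * C e a b) = 0" if b: "b \<in> S" for b
  proof (rule middle_slot[OF _ e])
    fix d assume "d \<in> S"
    then show "(\<Sum>a\<in>S. cf a x * (\<Sum>e\<in>S. B d e * C e a b)) = 0"
      using cf_mult_bas[OF b, of d x] z[OF b] b by (simp add: cyclic[symmetric])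
  qed
  show "bas X e \<odot> x = 0"
  proof (rule space_eqI[OF mult_mem])
    show "0 \<in> space_of X" by (simp add: space_of_def span_zero)
    fix d assume d: "d \<in> S"
    have "cf d (bas X e \<odot> x) = (\<Sum>b\<in>S. (\<Sum>a\<in>S. cf a x * C e a b) * B b d)"
      using d e by (simp add: cf_bas_mult structure_constant_def sum_distrib_left sum_distrib_right ac_simps)
        (rule sum.swap)
    then show "cf d (bas X e \<odot> x) = cf d 0" by (simp add: 0)
  qed
qed

lemma mult_eq_sum:
  assumes x: "x \<in> space_of X"
  shows "x \<odot> y = (\<Sum>a\<in>S. scl X (cf a x) (bas X a \<odot> y))"
    "y \<odot> x = (\<Sum>a\<in>S. scl X (cf a x) (y \<odot> bas X a))"
proof -
  have eq: "x = (\<Sum>a\<in>S. scl X (cf a x) (bas X a))" using vec_cf[OF x] by (simp add: vec_def)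
  show "x \<odot> y = (\<Sum>a\<in>S. scl X (cf a x) (bas X a \<odot> y))"
    by (subst eq) (simp only: sum_mult scale_mult)
  show "y \<odot> x = (\<Sum>a\<in>S. scl X (cf a x) (y \<odot> bas X a))"
    by (subst eq) (simp only: mult_sum mult_scale)
qed

text \<open>The 1-3 relation says \<open>a (1 b) = a b\<close>, so \<open>1 b - b\<close> is
  annihilated from the left by every basis vector.\<close>

lemma one_mult: "x \<in> space_of X \<Longrightarrow> one \<odot> x = x"
proof -
  have bas: "one \<odot> bas X b = bas X b" if b: "b \<in> S" for b
  proof -
    have "one \<odot> bas X b - bas X b = 0"
    proof (rule left_annihilated)
      show "one \<odot> bas X b - bas X b \<in> space_of X"
        using mult_mem bas_mem[OF b] unfolding space_of_def by (intro span_diff) auto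
      show "bas X a \<odot> (one \<odot> bas X b - bas X b) = 0" if "a \<in> S" for a
        using bas_one_bas[OF that b] by (simp add: mult_diff mult_assoc)
    qed
    then show ?thesis by simp
  qed
  assume x: "x \<in> space_of X"
  show ?thesis using mult_eq_sum(2)[OF x, of one] vec_cf[OF x] bas by (simp add: vec_def cong: sum.cong)
qed

lemma mult_one: "x \<in> space_of X \<Longrightarrow> x \<odot> one = x"
proof -
  have bas: "bas X a \<odot> one = bas X a" if a: "a \<in> S" for a
  proof -
    have "bas X a \<odot> one - bas X a = 0"
    proof (rule right_annihilated)
      show "bas X a \<odot> one - bas X a \<in> space_of X"
        using mult_mem bas_mem[OF a] unfolding space_of_def by (intro span_diff) auto
      show "(bas X a \<odot> one - bas X a) \<odot> bas X b = 0" if "b \<in> S" for b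
        using bas_one_bas[OF a that] by (simp add: diff_mult)
    qed
    then show ?thesis by simp
  qed
  assume x: "x \<in> space_of X"
  show ?thesis using mult_eq_sum(1)[OF x, of one] vec_cf[OF x] bas by (simp add: vec_def cong: sum.cong)
qed

lemma corner_one: "corner one = space_of X"
proof (intro equalityI subsetI)
  fix x assume "x \<in> corner one"
  then have "x = one \<odot> x" by (simp add: corner_unit)
  then show "x \<in> space_of X" using mult_mem by metis
qed (simp add: corner_def one_mult mult_one)

section \<open>The Frobenius form and its dual bases\<close>

definition binv :: "'v \<Rightarrow> 'v \<Rightarrow> 'k" where
  "binv x y = (\<Sum>a\<in>S. \<Sum>b\<in>S. cf a x * cf b y * Binv X a b)"

lemma Binv_C: "a \<in> S \<Longrightarrow> b \<in> S \<Longrightarrow> d \<in> S \<Longrightarrow> (\<Sum>c\<in>S. \<mu> a b c * Binv X c d) = C a b d"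
proof -
  assume abd: "a \<in> S" "b \<in> S" "d \<in> S"
  have "(\<Sum>c\<in>S. \<mu> a b c * Binv X c d) = (\<Sum>e\<in>S. (\<Sum>c\<in>S. B e c * Binv X c d) * C a b e)"
    by (simp add: structure_constant_def sum_distrib_left sum_distrib_right ac_simps) (rule sum.swap)
  then show ?thesis using abd sum_delta(1)[of d "C a b"] by (simp add: B_Binv cong: sum.cong)
qed

lemma C_Binv: "a \<in> S \<Longrightarrow> b \<in> S \<Longrightarrow> d \<in> S \<Longrightarrow> (\<Sum>c\<in>S. Binv X a c * \<mu> b d c) = C a b d"
proof -
  assume abd: "a \<in> S" "b \<in> S" "d \<in> S"
  have "(\<Sum>c\<in>S. Binv X a c * \<mu> b d c) = (\<Sum>e\<in>S. (\<Sum>c\<in>S. Binv X a c * B c e) * C e b d)"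
    using abd by (simp add: cyclic sum_distrib_left sum_distrib_right ac_simps) (rule sum.swap)
  then show ?thesis using abd sum_delta(2)[of a "\<lambda>e. C e b d"] by (simp add: Binv_B cong: sum.cong)
qed

text \<open>Both sides equal \<open>C (x, y, z)\<close>: the inverse of \<open>B\<close> cancels the
  \<open>B\<close> inside the product, on the left by definition of the structure constants, on the
  right after cyclicity.\<close>

lemma binv_mult: "binv (x \<odot> y) z = binv x (y \<odot> z)"
proof -
  have "binv (x \<odot> y) z = (\<Sum>c\<in>S. \<Sum>d\<in>S. \<Sum>a\<in>S. \<Sum>b\<in>S. cf a x * cf b y * cf d z * (\<mu> a b c * Binv X c d))"
    by (simp add: binv_def cf_mult sum_distrib_right sum_distrib_left ac_simps)
  also have "\<dots> = (\<Sum>d\<in>S. \<Sum>a\<in>S. \<Sum>b\<in>S. \<Sum>c\<in>S. cf a x * cf b y * cf d z * (\<mu> a b c * Binv X c d))"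
    by (subst sum.swap) (intro sum.cong[OF refl] sum_push)
  also have "\<dots> = (\<Sum>d\<in>S. \<Sum>a\<in>S. \<Sum>b\<in>S. cf a x * cf b y * cf d z * C a b d)"
    by (simp add: Binv_C flip: sum_distrib_left)
  also have "\<dots> = (\<Sum>a\<in>S. \<Sum>b\<in>S. \<Sum>d\<in>S. cf a x * cf b y * cf d z * C a b d)"
    by (rule sum_push)
  also have "\<dots> = (\<Sum>a\<in>S. \<Sum>b\<in>S. \<Sum>d\<in>S. \<Sum>c\<in>S. cf a x * cf b y * cf d z * (Binv X a c * \<mu> b d c))"
    by (simp add: C_Binv flip: sum_distrib_left)
  also have "\<dots> = (\<Sum>a\<in>S. \<Sum>c\<in>S. \<Sum>b\<in>S. \<Sum>d\<in>S. cf a x * cf b y * cf d z * (Binv X a c * \<mu> b d c))"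
    by (intro sum.cong[OF refl] sum_push[symmetric])
  also have "\<dots> = binv x (y \<odot> z)"
    by (simp add: binv_def cf_mult sum_distrib_right sum_distrib_left ac_simps)
  finally show ?thesis .
qed

definition \<epsilon> :: "'v \<Rightarrow> 'k" where "\<epsilon> x = binv x one"

lemma frobenius_form_eq: "x \<in> space_of X \<Longrightarrow> frobenius_form X x = \<epsilon> x"
  using one_mem_space by (simp add: frobenius_form_def Binv_form_def \<epsilon>_def binv_def coord_eq one_def)

lemma form_mult: "y \<in> space_of X \<Longrightarrow> \<epsilon> (x \<odot> y) = binv x y"
  by (simp add: \<epsilon>_def binv_mult mult_one)

text \<open>Keeps the first tensor factor of \<open>B\<close>, so that
  \<open>B = \<Sum> dual i \<otimes> bas X i\<close> and
  \<open>\<beta> = \<Sum> dual i \<odot> bas X i\<close>.\<close>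

definition dual :: "'s \<Rightarrow> 'v" where "dual i = vec (\<lambda>a. B a i)"

text \<open>Expansion in the basis uses that \<open>Binv\<close> is a left inverse of
  \<open>B\<close>, expansion in the dual family that it is a right inverse.\<close>

sublocale frob_alg "scl X" mult one \<epsilon> S "bas X" dual "Rc X"
proof unfold_locales
  show "finite S" by (rule finite_states)
  show "one \<odot> one = one" by (rule one_mult[OF one_mem_space])
  show "bas X i \<in> corner one" if "i \<in> S" for i using that by (simp add: corner_one bas_mem)
  show "dual i \<in> corner one" if "i \<in> S" for i by (simp add: corner_one dual_def vec_mem)
  show "\<epsilon> (x + y) = \<epsilon> x + \<epsilon> y" "\<epsilon> (scl X c x) = c * \<epsilon> x" for x y c
    by (simp_all add: \<epsilon>_def binv_def cf_add cf_scale distrib_right sum.distrib sum_distrib_left mult.assoc)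
  show "x = (\<Sum>i\<in>S. scl X (\<epsilon> (x \<odot> dual i)) (bas X i))" if "x \<in> corner one" for x
  proof -
    have "\<epsilon> (x \<odot> dual i) = cf i x" if i: "i \<in> S" for i
    proof -
      have "\<epsilon> (x \<odot> dual i) = (\<Sum>a\<in>S. cf a x * (\<Sum>b\<in>S. Binv X a b * B b i))"
        by (simp add: form_mult dual_def vec_mem binv_def cf_vec sum_distrib_left ac_simps cong: sum.cong)
      then show ?thesis
        using i sum_delta(1)[OF i, of "\<lambda>a. cf a x"] by (simp add: Binv_B mult.commute cong: sum.cong)
    qed
    then show ?thesis using vec_cf[of x] that by (simp add: vec_def corner_one cong: sum.cong)
  qed
  show "x = (\<Sum>i\<in>S. scl X (\<epsilon> (bas X i \<odot> x)) (dual i))" if x: "x \<in> corner one" for x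
  proof -
    have form: "\<epsilon> (bas X i \<odot> x) = (\<Sum>c\<in>S. Binv X i c * cf c x)" if i: "i \<in> S" for i
      using x i by (simp add: corner_one form_mult binv_def mult.assoc sum_cf_bas flip: sum_distrib_left)
        (simp add: mult.commute)
    have "(\<Sum>i\<in>S. scl X (\<epsilon> (bas X i \<odot> x)) (dual i)) = vec (\<lambda>a. \<Sum>i\<in>S. (\<Sum>c\<in>S. Binv X i c * cf c x) * B a i)"
      by (simp add: form dual_def vec_scale vec_sum cong: sum.cong)
    also have "\<dots> = vec (\<lambda>a. cf a x)"
    proof (rule vec_cong)
      fix a assume a: "a \<in> S"
      have "(\<Sum>i\<in>S. (\<Sum>c\<in>S. Binv X i c * cf c x) * B a i) = (\<Sum>c\<in>S. (\<Sum>i\<in>S. B a i * Binv X i c) * cf c x)"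
        by (simp add: sum_distrib_left sum_distrib_right ac_simps) (rule sum.swap)
      then show "(\<Sum>i\<in>S. (\<Sum>c\<in>S. Binv X i c * cf c x) * B a i) = cf a x"
        using a sum_delta(2)[OF a, of "\<lambda>a. cf a x"] by (simp add: B_Binv cong: sum.cong)
    qed
    finally show ?thesis using vec_cf[of x] x by (simp add: corner_one)
  qed
  show "one = scl X (Rc X) (\<Sum>i\<in>S. dual i \<odot> bas X i)"
  proof -
    have "dual i \<odot> bas X i = (\<Sum>a\<in>S. scl X (B a i) (bas X a \<odot> bas X i))" for i
      by (simp add: dual_def vec_def sum_mult scale_mult)
    then show ?thesis unfolding one_eq by (subst sum.swap) simp
  qed
qed

end

section \<open>Change of basis\<close>

text \<open>
  Transporting only the basis vectors keeps states, \<open>C\<close>, \<open>B\<close> and \<open>R\<close>, hence all partition functions.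
\<close>

definition rebase :: "('k \<Rightarrow> 'w \<Rightarrow> 'w) \<Rightarrow> ('v \<Rightarrow> 'w) \<Rightarrow> ('s, 'v, 'k) ssm \<Rightarrow> ('s, 'w, 'k) ssm" where
  "rebase sc \<phi> X = \<lparr>states = states X, scl = sc, bas = \<phi> \<circ> bas X, Cc = Cc X, Bc = Bc X, Rc = Rc X\<rparr>"

lemma rebase_simps [simp]:
  "states (rebase sc \<phi> X) = states X" "scl (rebase sc \<phi> X) = sc" "bas (rebase sc \<phi> X) = \<phi> \<circ> bas X"
  "Cc (rebase sc \<phi> X) = Cc X" "Bc (rebase sc \<phi> X) = Bc X" "Rc (rebase sc \<phi> X) = Rc X"
  by (simp_all add: rebase_def)

lemma Binv_rebase [simp]: "Binv (rebase sc \<phi> X) = Binv X"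
  by (simp add: Binv_def is_inverse_B_def)

lemma weight_rebase: "weight (rebase sc \<phi> X) ds us = weight X ds us"
  by (cases "(X, ds, us)" rule: weight.cases) simp_all

lemma partition_function_rebase: "partition_function (rebase sc \<phi> X) \<T> G \<tau> = partition_function X \<T> G \<tau>"
  by (simp add: partition_function_def evaluation_def weight_rebase)

locale planar_rebase = planar_model X + Vector_Spaces.linear "scl X" sc \<phi>
  for X :: "('s, 'v::ab_group_add, 'k::field) ssm" and sc :: "'k \<Rightarrow> 'w::ab_group_add \<Rightarrow> 'w" and \<phi> +
  assumes inj: "inj_on \<phi> (space_of X)"
begin

abbreviation X' where "X' \<equiv> rebase sc \<phi> X"

lemma image_bas: "bas X' ` S = \<phi> ` bas X ` S"
  by (simp add: image_comp)

lemma independent_rebase: "\<not> vs2.dependent (bas X' ` S)"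
  unfolding image_bas using independent_injective_image[OF independent_bas] inj by (simp add: space_of_def)

lemma inj_bas_rebase: "inj_on (bas X') S"
  using inj_bas inj bas_mem by (auto simp: inj_on_def)

lemma space_of_rebase: "space_of X' = \<phi> ` space_of X"
  unfolding space_of_def rebase_simps(1,2) image_bas by (rule span_image)

lemma coord_rebase:
  assumes v: "v \<in> space_of X" and a: "a \<in> S"
  shows "coord X' (\<phi> v) a = coord X v a"
proof -
  have "\<phi> v = \<phi> (\<Sum>b\<in>S. scl X (cf b v) (bas X b))" using vec_cf[OF v] by (simp add: vec_def)
  also have "\<dots> = (\<Sum>b\<in>S. sc (cf b v) (bas X' b))" by (simp add: sum scale)
  finally have v_eq: "\<phi> v = (\<Sum>b\<in>S. sc (cf b v) (bas X' b))" .
  have span: "bas X' b \<in> vs2.span (bas X' ` S)" if "b \<in> S" for b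
    using that by (intro vs2.span_base) simp
  have "coord X' (\<phi> v) a = (\<Sum>b\<in>S. cf b v * vs2.representation (bas X' ` S) (bas X' b) (bas X' a))"
    unfolding coord_def rebase_simps(1,2) v_eq
    by (subst vs2.representation_sum[OF independent_rebase])
      (auto intro!: vs2.span_scale span sum.cong simp: vs2.representation_scale[OF independent_rebase span] simp del: rebase_simps)
  also have "\<dots> = (\<Sum>b\<in>S. (if b = a then 1 else 0) * cf b v)"
  proof (rule sum.cong[OF refl])
    fix b assume b: "b \<in> S"
    have "vs2.representation (bas X' ` S) (bas X' b) (bas X' a) = (if b = a then 1 else 0)"
      using vs2.representation_basis[OF independent_rebase imageI[OF b]] inj_on_eq_iff[OF inj_bas_rebase a b]
      by auto
    then show "cf b v * vs2.representation (bas X' ` S) (bas X' b) (bas X' a) = (if b = a then 1 else 0) * cf b v"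
      by (simp only: mult.commute)
  qed
  also have "\<dots> = cf a v" by (rule sum_delta(1)[OF a])
  finally show ?thesis using coord_eq[OF v] by simp
qed

lemma C_form_rebase:
  "x \<in> space_of X \<Longrightarrow> y \<in> space_of X \<Longrightarrow> z \<in> space_of X \<Longrightarrow> C_form X' (\<phi> x) (\<phi> y) (\<phi> z) = C_form X x y z"
  by (simp add: C_form_def coord_rebase)

lemma mult_of_rebase:
  "x \<in> space_of X \<Longrightarrow> y \<in> space_of X \<Longrightarrow> mult_of X' (\<phi> x) (\<phi> y) = \<phi> (mult_of X x y)"
  by (simp add: mult_of_def coord_rebase sum scale)

lemma unit_of_rebase: "unit_of X' = \<phi> (unit_of X)"
  using mult_of_rebase by (simp add: unit_of_def beta_of_def sum scale bas_mem)

lemma frobenius_form_rebase: "x \<in> space_of X \<Longrightarrow> frobenius_form X' (\<phi> x) = frobenius_form X x"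
  using one_mem_space
  by (simp add: frobenius_form_def Binv_form_def unit_of_rebase coord_rebase flip: one_def)

lemma nondegenerate_rebase: "nondegenerate_data X'"
proof -
  have "diagrammatic_data X'"
    using diagrammatic independent_rebase inj_bas_rebase vs2.vector_space_axioms
    by (simp add: diagrammatic_data_def)
  moreover have "x = 0" if x: "x \<in> space_of X'" and z: "\<forall>y\<in>space_of X'. \<forall>z\<in>space_of X'. C_form X' y z x = 0" for x
  proof -
    obtain v where v: "v \<in> space_of X" "x = \<phi> v" using x by (auto simp: space_of_rebase)
    have "\<forall>y\<in>space_of X. \<forall>z\<in>space_of X. C_form X y z v = 0"
      using z v by (auto simp: space_of_rebase C_form_rebase)
    then have "v = 0" using nondegenerate v(1) unfolding nondegenerate_data_def by blast
    then show "x = 0" using v(2) by simp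
  qed
  ultimately show ?thesis
    using nondegenerate by (auto simp: nondegenerate_data_def is_inverse_B_def)
qed

lemma planar_ssm_rebase: "planar_ssm X'"
  unfolding planar_ssm_def partition_function_rebase
  using nondegenerate_rebase planar by (simp add: planar_ssm_def)

lemma isomorphic_rebase: "isomorphic_ssm X X'"
proof -
  have "B c d = (\<Sum>a\<in>S. \<Sum>b\<in>S. B a b * coord X' (\<phi> (bas X a)) c * coord X' (\<phi> (bas X b)) d)"
    if c: "c \<in> S" and d: "d \<in> S" for c d
  proof -
    have "(\<Sum>a\<in>S. \<Sum>b\<in>S. B a b * coord X' (\<phi> (bas X a)) c * coord X' (\<phi> (bas X b)) d) =
        (\<Sum>a\<in>S. (if a = c then 1 else 0) * (\<Sum>b\<in>S. (if b = d then 1 else 0) * B a b))"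
      using c d by (simp add: coord_rebase bas_mem coord_eq cf_bas sum_distrib_left ac_simps eq_commute cong: sum.cong)
    also have "\<dots> = B c d" by (simp only: sum_delta(1)[OF c] sum_delta(1)[OF d])
    finally show ?thesis by simp
  qed
  moreover have "bij_betw \<phi> (space_of X) (space_of X')"
    using inj by (simp add: bij_betw_def space_of_rebase)
  ultimately show ?thesis
    unfolding isomorphic_ssm_def by (intro exI[of _ \<phi>]) (simp add: add scale C_form_rebase)
qed

end

section \<open>Matrix models over general coefficients\<close>

context coefficients
begin

text \<open>Any planar model whose algebra is a matrix sum falls under
  \<open>frob_alg_matrix\<close>, so the condition is necessary for all such models and not just for
  the one constructed below.\<close>

lemma planar_trace_condition:
  fixes X :: "('s, 'd blocks, 'k) ssm"
  assumes X: "planar_ssm X" "has_matrix_algebra smul N n (\<lambda>i. Dom (D i)) X"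
    and inv: "mutually_inverse N n (\<lambda>i. Dom (D i)) x y"
    and form: "\<And>a. a \<in> space_of X \<Longrightarrow> frobenius_form X a = trace_form N n (blocks_mult n x a)"
    and i: "i < N"
  shows "smul (Rc X) (\<Sum>q\<in>Q (D i). bar q * Tr n y i * q) = 1"
proof -
  interpret pm: planar_model X by unfold_locales (rule X)
  have sc: "scl X = bsmul" and sp: "space_of X = matrices N n D" and pos: "0 < n i"
    and mult: "\<And>a b. a \<in> space_of X \<Longrightarrow> b \<in> space_of X \<Longrightarrow> mult_of X a b = blocks_mult n a b"
    using X(2) i by (auto simp: has_matrix_algebra_def)
  interpret frob_alg_matrix smul \<rho> Dom Q bar pm.mult pm.one pm.\<epsilon> "states X" "bas X" pm.dual "Rc X" N n D x y
  proof (intro frob_alg_matrix.intro frob_alg_matrix_axioms.intro)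
    show "coefficients smul \<rho> Dom Q bar" by (rule coefficients_axioms)
    show "frob_alg bsmul pm.mult pm.one pm.\<epsilon> (states X) (bas X) pm.dual (Rc X)"
      using pm.frob_alg_axioms by (simp only: sc)
    show "assoc_alg.corner pm.mult pm.one = matrices N n D" using pm.corner_one sp by simp
    show "mutually_inverse N n (\<lambda>i. Dom (D i)) x y" by (rule inv)
    fix a assume a: "a \<in> matrices N n D"
    then show "pm.\<epsilon> a = trace_form N n (blocks_mult n x a)"
      using form pm.frobenius_form_eq sp by simp
    fix b assume "b \<in> matrices N n D"
    then show "pm.mult a b = blocks_mult n a b" using a mult pm.mult_of_eq sp by simp
  qed
  show ?thesis by (rule trace_condition[OF i pos])
qed

text \<open>Common to both fields: the classification of finite-dimensional division corners is
  passed as a hypothesis, and the model is transported along the isomorphism \<open>\<phi>\<close>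
  by \<open>rebase\<close>.\<close>

lemma exists_planar_matrix_model:
  fixes X :: "('s, 'v::ab_group_add, 'k) ssm"
  assumes X: "planar_ssm X"
    and classification: "\<And>(scale :: 'k \<Rightarrow> 'v \<Rightarrow> 'v) mult p B. assoc_alg scale mult \<Longrightarrow>
      assoc_alg.division_corner mult p \<Longrightarrow> finite B \<Longrightarrow> assoc_alg.corner mult p \<subseteq> module.span scale B \<Longrightarrow>
      \<exists>c \<psi>. assoc_alg.corner_iso scale mult p smul (Dom c) \<psi>"
  shows "\<exists>(X' :: ('s, 'd blocks, 'k) ssm) N n D x y.
    planar_ssm X' \<and> isomorphic_ssm X X' \<and> has_matrix_algebra smul N n (\<lambda>i. Dom (D i)) X' \<and>
    mutually_inverse N n (\<lambda>i. Dom (D i)) x y \<and>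
    (\<forall>a\<in>space_of X'. frobenius_form X' a = trace_form N n (blocks_mult n x a))"
proof -
  interpret pm: planar_model X by unfold_locales (rule X)
  interpret frob_alg_coefficients smul \<rho> Dom Q bar "scl X" pm.mult pm.one pm.\<epsilon> "states X" "bas X" pm.dual "Rc X"
  proof unfold_locales
    fix p assume p: "pm.division_corner p" "p \<in> pm.corner pm.one"
    \<comment> \<open>Inside the algebra the corner is finite-dimensional, as the classification
      demands.\<close>
    have "pm.corner p \<subseteq> pm.corner pm.one"
      using p(2) unfolding pm.corner_def by (auto simp: pm.mult_assoc[symmetric]) (metis pm.mult_assoc)+
    also have "\<dots> \<subseteq> pm.span (bas X ` states X)" by (rule pm.corner_subset_span)
    finally show "\<exists>c \<psi>. pm.corner_iso p smul (Dom c) \<psi>"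
      using pm.finite_states by (intro classification[OF pm.assoc_alg_axioms p(1)]) auto
  qed
  obtain N n D \<phi> x y where pos: "\<forall>i<N. 0 < n i" and bij: "bij_betw \<phi> (pm.corner pm.one) (matrices N n D)"
    and \<phi>_add: "\<And>a b. \<phi> (a + b) = \<phi> a + \<phi> b" and \<phi>_scale: "\<And>c a. \<phi> (scl X c a) = bsmul c (\<phi> a)"
    and \<phi>_mult: "\<And>a b. a \<in> pm.corner pm.one \<Longrightarrow> \<phi> (pm.mult a b) = blocks_mult n (\<phi> a) (\<phi> b)"
    and inv: "mutually_inverse N n (\<lambda>i. Dom (D i)) x y"
    and form: "\<And>a. a \<in> pm.corner pm.one \<Longrightarrow> pm.\<epsilon> a = trace_form N n (blocks_mult n x (\<phi> a))"
    by (rule exists_matrix_model, rule that)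
  interpret planar_rebase X bsmul \<phi>
    by unfold_locales (use \<phi>_add \<phi>_scale bij pm.corner_one in \<open>auto simp: bij_betw_def\<close>)
  have space: "space_of X' = matrices N n D"
    using bij by (simp add: space_of_rebase bij_betw_def pm.corner_one)
  have "\<forall>a\<in>space_of X'. \<forall>b\<in>space_of X'. mult_of X' a b = blocks_mult n a b"
    by (auto simp: space_of_rebase mult_of_rebase pm.mult_of_eq \<phi>_mult pm.corner_one)
  then have "has_matrix_algebra smul N n (\<lambda>i. Dom (D i)) X'"
    using pos space by (simp add: has_matrix_algebra_def)
  moreover have "\<forall>a\<in>space_of X'. frobenius_form X' a = trace_form N n (blocks_mult n x a)"
    by (auto simp: space_of_rebase frobenius_form_rebase pm.frobenius_form_eq form pm.corner_one)
  ultimately show ?thesis using planar_ssm_rebase isomorphic_rebase inv by blast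
qed

end

section \<open>The coefficient algebras of the two cases\<close>

lemma complex_coefficients:
  "coefficients (*) (\<lambda>z. z) (\<lambda>_::unit. UNIV) (\<lambda>_. {1}) (\<lambda>z::complex. z)"
  by unfold_locales (simp_all add: algebra_simps)

text \<open>These bases are orthonormal for \<open>Qre (p * quat_cnj q)\<close>, so the conjugates
  form the dual basis required of \<open>bar\<close>.\<close>

fun quat_basis :: "real_division \<Rightarrow> quat set" where
  "quat_basis RealD = {1}"
| "quat_basis ComplexD = {1, Quat 0 1 0 0}"
| "quat_basis QuaternionD = {1, Quat 0 1 0 0, Quat 0 0 1 0, Quat 0 0 0 1}"

lemmas quat_defs = quat_eq_iff zero_quat_def one_quat_def plus_quat_def scaleR_quat_def times_quat_def
  quat_cnj_def quat_of_complex_def of_real_def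

lemma division_ring_of_iff:
  "q \<in> division_ring_of RealD \<longleftrightarrow> Qi q = 0 \<and> Qj q = 0 \<and> Qk q = 0"
  "q \<in> division_ring_of ComplexD \<longleftrightarrow> Qj q = 0 \<and> Qk q = 0"
proof -
  show "q \<in> division_ring_of RealD \<longleftrightarrow> Qi q = 0 \<and> Qj q = 0 \<and> Qk q = 0"
    by (auto simp: quat_defs image_iff)
  show "q \<in> division_ring_of ComplexD \<longleftrightarrow> Qj q = 0 \<and> Qk q = 0"
    by (auto simp: quat_defs image_iff intro: exI[of _ "Complex (Qre q) (Qi q)"])
qed

lemma real_coefficients: "coefficients (*\<^sub>R) Qre division_ring_of quat_basis quat_cnj"
proof unfold_locales
  fix d
  show "finite (quat_basis d)" by (cases d) simp_all
  show "1 \<in> division_ring_of d"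
    by (cases d) (simp_all only: division_ring_of_iff, simp_all add: quat_defs)
  fix a b c
  show "c *\<^sub>R a \<in> division_ring_of d" if "a \<in> division_ring_of d"
    using that by (cases d) (simp_all only: division_ring_of_iff, simp_all add: quat_defs)
  show "a + b \<in> division_ring_of d" "a * b \<in> division_ring_of d" if "a \<in> division_ring_of d" "b \<in> division_ring_of d"
    using that by (cases d; simp only: division_ring_of_iff; simp add: quat_defs)+
  show "q \<in> division_ring_of d" "quat_cnj q \<in> division_ring_of d" if "q \<in> quat_basis d" for q
    using that by (cases d; simp only: division_ring_of_iff; auto simp: quat_defs)+
  show "a = (\<Sum>q\<in>quat_basis d. Qre (a * quat_cnj q) *\<^sub>R q)" if "a \<in> division_ring_of d"
    using that by (cases d; simp only: division_ring_of_iff; simp add: quat_defs)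
qed (simp_all add: quat_defs algebra_simps)

text \<open>The only division corner up to isomorphism consists of the multiples of
  \<open>p\<close>, so the label \<open>c\<close> has type \<open>unit\<close>.\<close>

lemma complex_classification:
  fixes scale :: "complex \<Rightarrow> 'v::ab_group_add \<Rightarrow> 'v" and mult :: "'v \<Rightarrow> 'v \<Rightarrow> 'v"
  assumes "assoc_alg scale mult" "assoc_alg.division_corner mult p" "finite B"
    "assoc_alg.corner mult p \<subseteq> module.span scale B"
  shows "\<exists>(c::unit) \<psi>. assoc_alg.corner_iso scale mult p (*) (UNIV :: complex set) \<psi>"
proof -
  interpret complex_assoc_alg scale mult using assms(1) by (simp add: complex_assoc_alg_def)
  have p0: "p \<noteq> 0" and pp: "mult p p = p" and pc: "p \<in> corner p"
    using assms(2) division_corner_unit_mem by (auto simp: division_corner_def)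
  have "bij_betw (\<lambda>c. scale c p) UNIV (corner p)"
    using division_corner_eq[OF assms(2-4)] p0
    by (intro bij_betw_imageI) (auto simp: inj_on_def intro: corner_closed pc)
  note b = this
  have 1: "scale (q + r) p = scale q p + scale r p" for q r by (simp add: scale_left_distrib)
  have 2: "scale (q * r) p = mult (scale q p) (scale r p)" for q r
    by (simp only: scale_mult mult_scale pp scale_scale mult.commute)
  have "corner_iso p (*) UNIV (inv_into UNIV (\<lambda>c. scale c p))"
    using corner_iso_inverse[of "\<lambda>c. scale c p" UNIV p "(*)", OF b] 1 2 by simp
  then show ?thesis by blast
qed

text \<open>The sum \<open>\<Sum> quat_cnj q * t * q\<close> is \<open>t\<close> for the reals and
  \<open>2 t\<close> for the complex numbers, where everything commutes; over the four quaternion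
  units the imaginary parts cancel and \<open>4 Re t\<close> remains.\<close>

lemma real_trace_condition_iff:
  assumes "R \<noteq> 0" "t \<in> division_ring_of d" "R *\<^sub>R (\<Sum>q\<in>quat_basis d. quat_cnj q * t * q) = 1"
  shows "real_trace_condition R d t"
proof (cases d)
  case RealD
  then show ?thesis using assms by (simp only: division_ring_of_iff) (simp add: quat_defs field_simps)
next
  case ComplexD
  then show ?thesis using assms
    by (simp only: division_ring_of_iff real_trace_condition.simps mult_2) (simp add: quat_defs field_simps)
next
  case QuaternionD
  then show ?thesis using assms by (simp add: quat_defs field_simps)
qed

section \<open>The theorem\<close>

lemma complex_matrix_model_trace:
  assumes "planar_ssm X" "complex_matrix_model N n x y X" "i < N"
  shows "Rc X * Tr n y i = 1"
proof -
  have X: "has_matrix_algebra (*) N n (\<lambda>i. UNIV) X" "mutually_inverse N n (\<lambda>i. UNIV) x y"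
    using assms(2) unfolding complex_matrix_model_def by blast+
  have form: "frobenius_form X a = coefficients.trace_form (\<lambda>z. z) N n (blocks_mult n x a)"
    if "a \<in> space_of X" for a
    using assms(2) that
    unfolding complex_matrix_model_def coefficients.trace_form_def[OF complex_coefficients] by blast
  show ?thesis
    using coefficients.planar_trace_condition[OF complex_coefficients assms(1) X form assms(3)] by simp
qed

lemma real_matrix_model_trace:
  assumes X: "planar_ssm X" "real_matrix_model N n D x y X" and i: "i < N"
  shows "real_trace_condition (Rc X) (D i) (Tr n y i)"
proof (rule real_trace_condition_iff)
  show "Rc X \<noteq> 0" using X(1) by (simp add: planar_ssm_def nondegenerate_data_def)
  have "y \<in> matrix_sum N n (\<lambda>i. division_ring_of (D i))"
    using X(2) by (simp add: real_matrix_model_def mutually_inverse_def)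
  then have "y i r r \<in> division_ring_of (D i)" if "r < n i" for r
    using that i unfolding matrix_sum_def mem_Collect_eq by presburger
  then show "Tr n y i \<in> division_ring_of (D i)"
    unfolding Tr_def by (intro coefficients.Dom_sum[OF real_coefficients]) simp
  show "Rc X *\<^sub>R (\<Sum>q\<in>quat_basis (D i). quat_cnj q * Tr n y i * q) = 1"
    using X(2) unfolding real_matrix_model_def
    by (intro coefficients.planar_trace_condition[OF real_coefficients X(1) _ _ _ i])
      (auto simp only: coefficients.trace_form_def[OF real_coefficients])
qed

lemma exists_complex_matrix_model:
  fixes X :: "('s, 'v::ab_group_add, complex) ssm"
  assumes "planar_ssm X"
  shows "\<exists>(X' :: ('s, complex blocks, complex) ssm) N n x y.
    planar_ssm X' \<and> isomorphic_ssm X X' \<and> complex_matrix_model N n x y X'"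
proof -
  have "\<exists>(X' :: ('s, complex blocks, complex) ssm) N n (D :: nat \<Rightarrow> unit) x y.
    planar_ssm X' \<and> isomorphic_ssm X X' \<and> has_matrix_algebra (*) N n (\<lambda>i. UNIV) X' \<and>
    mutually_inverse N n (\<lambda>i. UNIV) x y \<and>
    (\<forall>a\<in>space_of X'. frobenius_form X' a = coefficients.trace_form (\<lambda>z. z) N n (blocks_mult n x a))"
    by (rule coefficients.exists_planar_matrix_model[OF complex_coefficients assms])
      (rule complex_classification)
  then obtain X' :: "('s, complex blocks, complex) ssm" and N n and D :: "nat \<Rightarrow> unit" and x y
    where "planar_ssm X'" "isomorphic_ssm X X'" "has_matrix_algebra (*) N n (\<lambda>i. UNIV) X'"
      "mutually_inverse N n (\<lambda>i. UNIV) x y"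
      "\<forall>a\<in>space_of X'. frobenius_form X' a = coefficients.trace_form (\<lambda>z. z) N n (blocks_mult n x a)"
    by (elim exE conjE) (rule that)
  then have "complex_matrix_model N n x y X'"
    by (simp add: complex_matrix_model_def coefficients.trace_form_def[OF complex_coefficients])
  with \<open>planar_ssm X'\<close> \<open>isomorphic_ssm X X'\<close> show ?thesis by (intro exI conjI)
qed

lemma exists_real_matrix_model:
  fixes X :: "('s, 'v::ab_group_add, real) ssm"
  assumes "planar_ssm X"
  shows "\<exists>(X' :: ('s, quat blocks, real) ssm) N n D x y.
    planar_ssm X' \<and> isomorphic_ssm X X' \<and> real_matrix_model N n D x y X'"
proof -
  have "\<exists>(X' :: ('s, quat blocks, real) ssm) N n D x y.
    planar_ssm X' \<and> isomorphic_ssm X X' \<and> has_matrix_algebra (*\<^sub>R) N n (\<lambda>i. division_ring_of (D i)) X' \<and>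
    mutually_inverse N n (\<lambda>i. division_ring_of (D i)) x y \<and>
    (\<forall>a\<in>space_of X'. frobenius_form X' a = coefficients.trace_form Qre N n (blocks_mult n x a))"
    by (rule coefficients.exists_planar_matrix_model[OF real_coefficients assms])
      (rule real_assoc_alg.division_corner_classification[OF real_assoc_alg.intro])
  then obtain X' :: "('s, quat blocks, real) ssm" and N n D x y
    where "planar_ssm X'" "isomorphic_ssm X X'" "has_matrix_algebra (*\<^sub>R) N n (\<lambda>i. division_ring_of (D i)) X'"
      "mutually_inverse N n (\<lambda>i. division_ring_of (D i)) x y"
      "\<forall>a\<in>space_of X'. frobenius_form X' a = coefficients.trace_form Qre N n (blocks_mult n x a)"
    by (elim exE conjE) (rule that)
  then have "real_matrix_model N n D x y X'"
    by (simp add: real_matrix_model_def coefficients.trace_form_def[OF real_coefficients])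
  with \<open>planar_ssm X'\<close> \<open>isomorphic_ssm X X'\<close> show ?thesis by (intro exI conjI)
qed

text \<open>Necessity of the trace condition is proved for every planar matrix model of the given
  types; the models provided by the existence parts satisfy it as instances.\<close>

theorem theorem3p5:
  fixes X :: "('s, 'v::ab_group_add, complex) ssm"
    and Y :: "('t, 'w::ab_group_add, real) ssm"
  shows
    "(planar_ssm X \<longrightarrow>
       (\<exists>(X' :: ('s, complex blocks, complex) ssm) N n x y.
          planar_ssm X' \<and> isomorphic_ssm X X' \<and> complex_matrix_model N n x y X' \<and>
          (\<forall>i<N. Rc X' * Tr n y i = 1))) \<and>
     (\<forall>(X' :: ('s, complex blocks, complex) ssm) N n x y.
        planar_ssm X' \<and> complex_matrix_model N n x y X' \<longrightarrow>
        (\<forall>i<N. Rc X' * Tr n y i = 1)) \<and>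
     (planar_ssm Y \<longrightarrow>
       (\<exists>(Y' :: ('t, quat blocks, real) ssm) N n D x y.
          planar_ssm Y' \<and> isomorphic_ssm Y Y' \<and> real_matrix_model N n D x y Y' \<and>
          (\<forall>i<N. real_trace_condition (Rc Y') (D i) (Tr n y i)))) \<and>
     (\<forall>(Y' :: ('t, quat blocks, real) ssm) N n D x y.
        planar_ssm Y' \<and> real_matrix_model N n D x y Y' \<longrightarrow>
        (\<forall>i<N. real_trace_condition (Rc Y') (D i) (Tr n y i)))"
proof (intro conjI impI)
  assume "planar_ssm X"
  from exists_complex_matrix_model[OF this] obtain X' :: "('s, complex blocks, complex) ssm" and N n x y
    where X': "planar_ssm X'" "isomorphic_ssm X X'" "complex_matrix_model N n x y X'"
    by (elim exE conjE) (rule that)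
  moreover from X' have "\<forall>i<N. Rc X' * Tr n y i = 1"
    by (intro allI impI complex_matrix_model_trace)
  ultimately show "\<exists>(X' :: ('s, complex blocks, complex) ssm) N n x y.
      planar_ssm X' \<and> isomorphic_ssm X X' \<and> complex_matrix_model N n x y X' \<and>
      (\<forall>i<N. Rc X' * Tr n y i = 1)"
    by (intro exI conjI)
next
  assume "planar_ssm Y"
  from exists_real_matrix_model[OF this] obtain Y' :: "('t, quat blocks, real) ssm" and N n D x y
    where Y': "planar_ssm Y'" "isomorphic_ssm Y Y'" "real_matrix_model N n D x y Y'"
    by (elim exE conjE) (rule that)
  moreover from Y' have "\<forall>i<N. real_trace_condition (Rc Y') (D i) (Tr n y i)"
    by (intro allI impI real_matrix_model_trace)
  ultimately show "\<exists>(Y' :: ('t, quat blocks, real) ssm) N n D x y.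
      planar_ssm Y' \<and> isomorphic_ssm Y Y' \<and> real_matrix_model N n D x y Y' \<and>
      (\<forall>i<N. real_trace_condition (Rc Y') (D i) (Tr n y i))"
    by (intro exI conjI)
qed ((intro allI impI, elim conjE, rule complex_matrix_model_trace, assumption+),
    (intro allI impI, elim conjE, rule real_matrix_model_trace, assumption+))

end
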